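(* Consider the Lagrangian compressible Euler equations for a polytropic ideal gas. Assume that the (variation of the) data is compactly supported and that the entropy is monotone. Then a globally defined shock-free solution is either eventually noninteracting or contains an asymptotic vacuum.
   Context: Equations. Fix constants $\gamma>1$, $K>0$, $c_v>0$. The Lagrangian compressible Euler equations are $$\tau_t-u_x=0,\quad u_t+p_x=0,\quad (\tfrac12u^2+e)_t+(up)_x=0,$$ with specific volume $\tau=1/\rho$ ($\rho$ the density), velocity $u$, pressure $p=Ke^{S/c_v}\tau^{-\gamma}$, entropy $S$, and $e=p\tau/(\gamma-1)$. For classical solutions the third equation can be replaced by $S_t=0$. The Lagrangian sound speed is $c=\sqrt{-p_\tau}$. Shock-free solution: a solution in which the velocity $u$ and pressure $p$ are $C^2$, while the entropy $S(x)$ is $C^2$ except at finitely many points, and one-sided limits of $S$ and $S_x$ exist everywhere. Eventually noninteracting: all wave interactions end in finite time; that is, for $t$ large enough, the solution consists of three regions, defined by outgoing backward, stationary and forward waves respectively. The forward and backward waves are either rarefactions or a single shock. (A stationary wave is a time-independent state with $u$ and $p$ constant and entropy a function of $x$.) Asymptotic vacuum: a characteristic (a curve with $dx/dt=c$ or $dx/dt=-c$) with a vertical asymptote in the $(x,t)$-plane; along it necessarily $\rho\to0$ as $t\to\infty$. *)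

theory Defs
  imports "HOL-Analysis.Analysis"
begin

text \<open>
  One-dimensional Lagrangian gas dynamics for a polytropic ideal gas with constants
  \<open>\<gamma>\<close>, \<open>K\<close>, \<open>cv\<close>. A flow is given by the fields specific volume \<open>\<tau>\<close>, velocity \<open>u\<close> and
  entropy \<open>S\<close>, each a function of the material coordinate \<open>x\<close> and the time \<open>t\<close>; only times
  \<open>t \<ge> 0\<close> matter.
\<close>

type_synonym field2 = "real \<Rightarrow> real \<Rightarrow> real"

definition pressure :: "real \<Rightarrow> real \<Rightarrow> real \<Rightarrow> real \<Rightarrow> real \<Rightarrow> real" where
  "pressure \<gamma> K cv S \<tau> = K * exp (S / cv) * \<tau> powr (- \<gamma>)"

definition internal_energy :: "real \<Rightarrow> real \<Rightarrow> real \<Rightarrow> real \<Rightarrow> real \<Rightarrow> real" where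
  "internal_energy \<gamma> K cv S \<tau> = pressure \<gamma> K cv S \<tau> * \<tau> / (\<gamma> - 1)"

definition sound_speed :: "real \<Rightarrow> real \<Rightarrow> real \<Rightarrow> real \<Rightarrow> real \<Rightarrow> real" where
  "sound_speed \<gamma> K cv S \<tau> = sqrt (- deriv (pressure \<gamma> K cv S) \<tau>)"

text \<open>The antiderivative \<open>\<integral> c d\<tau>\<close> taken from \<open>\<tau>\<close> to infinity, which for this pressure law is
  \<open>2 c \<tau> / (\<gamma> - 1)\<close>. Where the entropy is constant, \<open>u + h\<close> and \<open>u - h\<close> are the Riemann
  invariants: they are constant along forward and backward characteristics, respectively.\<close>

definition acoustic_potential :: "real \<Rightarrow> real \<Rightarrow> real \<Rightarrow> real \<Rightarrow> real \<Rightarrow> real" where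
  "acoustic_potential \<gamma> K cv S \<tau> = 2 * sound_speed \<gamma> K cv S \<tau> * \<tau> / (\<gamma> - 1)"


subsection \<open>The equations and shock-free solutions\<close>

text \<open>The equation \<open>w\<^sub>t + f\<^sub>x = 0\<close> at the point \<open>(x, t)\<close>; the time derivative is one-sided at
  \<open>t = 0\<close>.\<close>

definition conservation_law_at :: "field2 \<Rightarrow> field2 \<Rightarrow> real \<Rightarrow> real \<Rightarrow> bool" where
  "conservation_law_at w f x t \<longleftrightarrow>
     (\<exists>d. ((\<lambda>s. w x s) has_real_derivative d) (at t within {0..}) \<and>
          ((\<lambda>y. f y t) has_real_derivative - d) (at x))"

definition euler_at :: "real \<Rightarrow> real \<Rightarrow> real \<Rightarrow> field2 \<Rightarrow> field2 \<Rightarrow> field2 \<Rightarrow> real \<Rightarrow> real \<Rightarrow> bool" where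
  "euler_at \<gamma> K cv \<tau> u S x t \<longleftrightarrow>
     conservation_law_at \<tau> (\<lambda>x t. - u x t) x t \<and>
     conservation_law_at u (\<lambda>x t. pressure \<gamma> K cv (S x t) (\<tau> x t)) x t \<and>
     conservation_law_at
       (\<lambda>x t. (u x t)\<^sup>2 / 2 + internal_energy \<gamma> K cv (S x t) (\<tau> x t))
       (\<lambda>x t. u x t * pressure \<gamma> K cv (S x t) (\<tau> x t)) x t"

definition C1_on :: "(real \<times> real) set \<Rightarrow> (real \<times> real \<Rightarrow> real) \<Rightarrow> bool" where
  "C1_on D f \<longleftrightarrow> (\<exists>fx ft. continuous_on D fx \<and> continuous_on D ft \<and>
     (\<forall>z\<in>D. (f has_derivative (\<lambda>(h, k). fx z * h + ft z * k)) (at z within D)))"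

definition C2_on :: "(real \<times> real) set \<Rightarrow> (real \<times> real \<Rightarrow> real) \<Rightarrow> bool" where
  "C2_on D f \<longleftrightarrow> (\<exists>fx ft. C1_on D fx \<and> C1_on D ft \<and>
     (\<forall>z\<in>D. (f has_derivative (\<lambda>(h, k). fx z * h + ft z * k)) (at z within D)))"

definition piecewise_C2_off :: "real set \<Rightarrow> (real \<Rightarrow> real) \<Rightarrow> bool" where
  "piecewise_C2_off J f \<longleftrightarrow> finite J \<and>
     (\<exists>f' f''. (\<forall>x\<in>- J. (f has_real_derivative f' x) (at x) \<and>
                        (f' has_real_derivative f'' x) (at x)) \<and>
               continuous_on (- J) f'') \<and>
     (\<forall>x. (\<exists>l. (f \<longlongrightarrow> l) (at_left x)) \<and> (\<exists>l. (f \<longlongrightarrow> l) (at_right x)) \<and>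
          (\<exists>l. (deriv f \<longlongrightarrow> l) (at_left x)) \<and> (\<exists>l. (deriv f \<longlongrightarrow> l) (at_right x)))"

text \<open>
  Shock-free solution, globally defined (all \<open>x\<close>, all \<open>t \<ge> 0\<close>), without vacuum in finite time.
  The entropy is time-independent, and the equations hold classically away from the finitely
  many stationary lines \<open>x \<in> J\<close> where \<open>S\<close> is not \<open>C\<^sup>2\<close>. On these lines \<open>u\<close> and \<open>p\<close> are
  continuous, which is the Rankine--Hugoniot condition for a stationary discontinuity.
\<close>

definition global_shock_free_solution ::
    "real \<Rightarrow> real \<Rightarrow> real \<Rightarrow> field2 \<Rightarrow> field2 \<Rightarrow> field2 \<Rightarrow> bool" where
  "global_shock_free_solution \<gamma> K cv \<tau> u S \<longleftrightarrow>
     (\<forall>x. \<forall>t\<ge>0. \<tau> x t > 0) \<and>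
     (\<forall>x. \<forall>t\<ge>0. S x t = S x 0) \<and>
     C2_on (UNIV \<times> {0..}) (\<lambda>(x, t). u x t) \<and>
     C2_on (UNIV \<times> {0..}) (\<lambda>(x, t). pressure \<gamma> K cv (S x t) (\<tau> x t)) \<and>
     (\<exists>J. piecewise_C2_off J (\<lambda>x. S x 0) \<and>
          (\<forall>x\<in>- J. \<forall>t\<ge>0. euler_at \<gamma> K cv \<tau> u S x t))"

text \<open>The variation of \<open>f\<close> is compactly supported; the two constant values may differ.\<close>

definition compactly_supported_variation :: "(real \<Rightarrow> 'a) \<Rightarrow> bool" where
  "compactly_supported_variation f \<longleftrightarrow>
     (\<exists>a b. a \<le> b \<and> (\<forall>x\<le>a. f x = f a) \<and> (\<forall>x\<ge>b. f x = f b))"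


subsection \<open>Asymptotic vacuum\<close>

text \<open>
  A characteristic that converges to a finite \<open>x\<close> as \<open>t \<rightarrow> \<infinity>\<close>. A characteristic is strictly
  monotone in \<open>x\<close> and so meets the finitely many lines of discontinuity of \<open>S\<close>, where it may
  have a corner, at most once each; the starting time \<open>t0\<close> can be taken after the last of these.
\<close>

definition contains_asymptotic_vacuum ::
    "real \<Rightarrow> real \<Rightarrow> real \<Rightarrow> field2 \<Rightarrow> field2 \<Rightarrow> bool" where
  "contains_asymptotic_vacuum \<gamma> K cv \<tau> S \<longleftrightarrow>
     (\<exists>X t0 xlim. t0 \<ge> 0 \<and>
        ((\<forall>t\<ge>t0. (X has_real_derivative sound_speed \<gamma> K cv (S (X t) t) (\<tau> (X t) t))
                   (at t within {t0..})) \<or>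
         (\<forall>t\<ge>t0. (X has_real_derivative - sound_speed \<gamma> K cv (S (X t) t) (\<tau> (X t) t))
                   (at t within {t0..}))) \<and>
        (X \<longlongrightarrow> xlim) at_top)"


subsection \<open>Outgoing waves\<close>

text \<open>
  A forward rarefaction for \<open>t \<ge> T\<close> with trailing edge \<open>b\<close>, a forward characteristic, filling
  \<open>x \<ge> b t\<close>: the entropy and the backward Riemann invariant are constant and the forward
  characteristic speed is nondecreasing in \<open>x\<close>. The trivial wave (a constant state) is
  included. Backward rarefactions are the mirror image.
\<close>

definition forward_rarefaction ::
    "real \<Rightarrow> real \<Rightarrow> real \<Rightarrow> field2 \<Rightarrow> field2 \<Rightarrow> field2 \<Rightarrow> real \<Rightarrow> (real \<Rightarrow> real) \<Rightarrow> bool" where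
  "forward_rarefaction \<gamma> K cv \<tau> u S T b \<longleftrightarrow>
     (\<forall>t\<ge>T. (b has_real_derivative sound_speed \<gamma> K cv (S (b t) t) (\<tau> (b t) t))
              (at t within {T..})) \<and>
     (\<exists>S1. \<forall>t\<ge>T. \<forall>x\<ge>b t. S x t = S1) \<and>
     (\<exists>k. \<forall>t\<ge>T. \<forall>x\<ge>b t. u x t - acoustic_potential \<gamma> K cv (S x t) (\<tau> x t) = k) \<and>
     (\<forall>t\<ge>T. mono_on {b t..} (\<lambda>x. sound_speed \<gamma> K cv (S x t) (\<tau> x t)))"

definition backward_rarefaction ::
    "real \<Rightarrow> real \<Rightarrow> real \<Rightarrow> field2 \<Rightarrow> field2 \<Rightarrow> field2 \<Rightarrow> real \<Rightarrow> (real \<Rightarrow> real) \<Rightarrow> bool" where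
  "backward_rarefaction \<gamma> K cv \<tau> u S T a \<longleftrightarrow>
     (\<forall>t\<ge>T. (a has_real_derivative - sound_speed \<gamma> K cv (S (a t) t) (\<tau> (a t) t))
              (at t within {T..})) \<and>
     (\<exists>S1. \<forall>t\<ge>T. \<forall>x\<le>a t. S x t = S1) \<and>
     (\<exists>k. \<forall>t\<ge>T. \<forall>x\<le>a t. u x t + acoustic_potential \<gamma> K cv (S x t) (\<tau> x t) = k) \<and>
     (\<forall>t\<ge>T. mono_on {..a t} (\<lambda>x. - sound_speed \<gamma> K cv (S x t) (\<tau> x t)))"

text \<open>The jump relations \<open>\<sigma> [w] = [f]\<close> of the three conservation laws for a discontinuity of
  speed \<open>\<sigma>\<close>; subscripts \<open>l\<close> and \<open>r\<close> are the states to its left and right.\<close>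

definition rankine_hugoniot ::
    "real \<Rightarrow> real \<Rightarrow> real \<Rightarrow> real \<Rightarrow> real \<times> real \<times> real \<Rightarrow> real \<times> real \<times> real \<Rightarrow> bool" where
  "rankine_hugoniot \<gamma> K cv \<sigma> = (\<lambda>(\<tau>l, ul, Sl) (\<tau>r, ur, Sr).
     (let pl = pressure \<gamma> K cv Sl \<tau>l; pr = pressure \<gamma> K cv Sr \<tau>r;
          el = internal_energy \<gamma> K cv Sl \<tau>l; er = internal_energy \<gamma> K cv Sr \<tau>r
      in \<sigma> * (\<tau>r - \<tau>l) = - (ur - ul) \<and>
         \<sigma> * (ur - ul) = pr - pl \<and>
         \<sigma> * ((ur\<^sup>2 / 2 + er) - (ul\<^sup>2 / 2 + el)) = ur * pr - ul * pl))"

text \<open>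
  A single forward shock along \<open>x = b t\<close>, of constant speed and strength, running into a constant
  state and satisfying the Lax entropy condition. The state behind it, taken as a one-sided
  limit, belongs to the stationary region. Backward shocks are the mirror image.
\<close>

definition single_forward_shock ::
    "real \<Rightarrow> real \<Rightarrow> real \<Rightarrow> field2 \<Rightarrow> field2 \<Rightarrow> field2 \<Rightarrow> real \<Rightarrow> (real \<Rightarrow> real) \<Rightarrow> bool" where
  "single_forward_shock \<gamma> K cv \<tau> u S T b \<longleftrightarrow>
     (\<exists>\<sigma> \<tau>l ul Sl \<tau>r ur Sr.
        (\<forall>t\<ge>T. (b has_real_derivative \<sigma>) (at t within {T..})) \<and>
        (\<forall>t\<ge>T. ((\<lambda>x. (\<tau> x t, u x t, S x t)) \<longlongrightarrow> (\<tau>l, ul, Sl)) (at_left (b t))) \<and>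
        (\<forall>t\<ge>T. \<forall>x>b t. (\<tau> x t, u x t, S x t) = (\<tau>r, ur, Sr)) \<and>
        \<tau>l > 0 \<and> \<tau>r > 0 \<and>
        rankine_hugoniot \<gamma> K cv \<sigma> (\<tau>l, ul, Sl) (\<tau>r, ur, Sr) \<and>
        sound_speed \<gamma> K cv Sr \<tau>r < \<sigma> \<and> \<sigma> < sound_speed \<gamma> K cv Sl \<tau>l)"

definition single_backward_shock ::
    "real \<Rightarrow> real \<Rightarrow> real \<Rightarrow> field2 \<Rightarrow> field2 \<Rightarrow> field2 \<Rightarrow> real \<Rightarrow> (real \<Rightarrow> real) \<Rightarrow> bool" where
  "single_backward_shock \<gamma> K cv \<tau> u S T a \<longleftrightarrow>
     (\<exists>\<sigma> \<tau>l ul Sl \<tau>r ur Sr.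
        (\<forall>t\<ge>T. (a has_real_derivative \<sigma>) (at t within {T..})) \<and>
        (\<forall>t\<ge>T. ((\<lambda>x. (\<tau> x t, u x t, S x t)) \<longlongrightarrow> (\<tau>r, ur, Sr)) (at_right (a t))) \<and>
        (\<forall>t\<ge>T. \<forall>x<a t. (\<tau> x t, u x t, S x t) = (\<tau>l, ul, Sl)) \<and>
        \<tau>l > 0 \<and> \<tau>r > 0 \<and>
        rankine_hugoniot \<gamma> K cv \<sigma> (\<tau>l, ul, Sl) (\<tau>r, ur, Sr) \<and>
        - sound_speed \<gamma> K cv Sr \<tau>r < \<sigma> \<and> \<sigma> < - sound_speed \<gamma> K cv Sl \<tau>l)"

definition stationary_between ::
    "real \<Rightarrow> real \<Rightarrow> real \<Rightarrow> field2 \<Rightarrow> field2 \<Rightarrow> field2 \<Rightarrow> real \<Rightarrow>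
     (real \<Rightarrow> real) \<Rightarrow> (real \<Rightarrow> real) \<Rightarrow> bool" where
  "stationary_between \<gamma> K cv \<tau> u S T a b \<longleftrightarrow>
     (\<exists>u0 p0 S0. \<forall>t\<ge>T. \<forall>x. a t < x \<and> x < b t \<longrightarrow>
        u x t = u0 \<and> pressure \<gamma> K cv (S x t) (\<tau> x t) = p0 \<and> S x t = S0 x)"

definition eventually_noninteracting ::
    "real \<Rightarrow> real \<Rightarrow> real \<Rightarrow> field2 \<Rightarrow> field2 \<Rightarrow> field2 \<Rightarrow> bool" where
  "eventually_noninteracting \<gamma> K cv \<tau> u S \<longleftrightarrow>
     (\<exists>T\<ge>0. \<exists>a b. (\<forall>t\<ge>T. a t < b t) \<and>
        (backward_rarefaction \<gamma> K cv \<tau> u S T a \<or> single_backward_shock \<gamma> K cv \<tau> u S T a) \<and>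
        stationary_between \<gamma> K cv \<tau> u S T a b \<and>
        (forward_rarefaction \<gamma> K cv \<tau> u S T b \<or> single_forward_shock \<gamma> K cv \<tau> u S T b))"

end

theory Submission
  imports Defs
begin

text \<open>
  Outside the entropy variation \<open>[a, b]\<close> the solution is a simple wave, and since it never breaks,
  \<open>u\<^sub>t \<ge> 0\<close> at \<open>x = a\<close> and \<open>u\<^sub>t \<le> 0\<close> at \<open>x = b\<close>. Inside, take \<open>x\<close> as the time variable. The speed factors
  as \<open>c = C p * \<sigma> x\<close> with \<open>\<sigma>\<close> a monotone function of the entropy, and a maximum principle along
  characteristics shows that, for \<open>\<sigma>\<close> decreasing, the cone condition \<open>c u\<^sub>t + \<bar>p\<^sub>t\<bar> \<le> 0\<close> propagates from
  right to left and \<open>\<plusminus> p\<^sub>t + c \<bar>u\<^sub>t\<bar> \<le> 0\<close> from left to right. The domains of dependence are bounded by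
  characteristics crossing \<open>[a, b]\<close>, which all cross in finite time unless one of them has a
  vertical asymptote. The first condition holds at \<open>b\<close>, so it reaches \<open>a\<close>, where together with the
  sign of \<open>u\<^sub>t\<close> it gives \<open>p\<^sub>t = u\<^sub>t = 0\<close>; the second one carries this back across \<open>[a, b]\<close>.
\<close>

text \<open>For a smooth entropy, \<open>p\<^sub>t \<plusminus> c u\<^sub>t\<close> would obey along
  characteristics an equation in which \<open>S\<^sub>x\<close> couples the two signs; at a jump of
  \<open>S\<close> that term is meaningless. It is never formed. At a point of maximum the entropy
  is frozen, which leaves a linear homogeneous equation whose growth a weight
  \<open>exp (- \<Lambda> * x)\<close> absorbs, and the true entropy is put back by comparing
  coefficients. The comparison has the right sign for a condition
  \<open>Y + m * \<bar>Z\<bar> \<le> 0\<close> that travels in the direction in which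
  \<open>m\<close> decreases. Divided by \<open>\<sigma>\<close>, the first cone condition has the
  coefficient \<open>1 / \<sigma>\<close>, while the second has \<open>\<sigma>\<close>: hence the
  opposite directions of travel, and hence the role of a monotone entropy. The jumps shape the rest
  too: one-sided limits of \<open>\<sigma>\<close> replace its values, maxima exist by
  semicontinuity, and characteristics are found in a coordinate without jumps. Outside
  \<open>[a, b]\<close>, straight lines of frozen slope are shown to carry constant pressure. The
  right end is always the mirror image of the left.\<close>

lemma compact_continuous_bound:
  fixes f :: "'a::topological_space \<Rightarrow> real"
  assumes "compact K" "continuous_on K f"
  shows "\<exists>M>0. \<forall>x\<in>K. \<bar>f x\<bar> \<le> M"
proof -
  have "bounded (f ` K)"
    using assms compact_continuous_image compact_imp_bounded by blast
  then show ?thesis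
    by (simp add: bounded_pos)
qed

section \<open>Derivatives along paths\<close>

lemma DERIV_unique_Ici:
  fixes f :: "real \<Rightarrow> real"
  assumes "(f has_real_derivative c) (at t within {l..})" "(f has_real_derivative d) (at t within {l..})"
    and "l \<le> t"
  shows "c = d"
proof -
  have "t islimpt {l..}"
  proof (rule islimpt_subset)
    show "t islimpt {t<..<t+1}" by (simp add: islimpt_greaterThanLessThan1)
  qed (use assms in auto)
  then have "at t within {l..} \<noteq> bot"
    by (simp add: trivial_limit_within)
  then show ?thesis
    using assms(1,2) tendsto_unique unfolding has_field_derivative_iff by blast
qed

lemma has_real_derivative_along_path:
  fixes f :: "real \<times> real \<Rightarrow> real"
  assumes "(f has_derivative (\<lambda>(h, k). A * h + B * k)) (at (x s, y s) within S)"
    and "(x has_real_derivative dx) (at s within I)" "(y has_real_derivative dy) (at s within I)"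
    and "\<And>r. r \<in> I \<Longrightarrow> (x r, y r) \<in> S"
  shows "((\<lambda>r. f (x r, y r)) has_real_derivative A * dx + B * dy) (at s within I)"
proof -
  have 1: "((\<lambda>r. (x r, y r)) has_derivative (\<lambda>h. (dx * h, dy * h))) (at s within I)"
    using assms(2,3) unfolding has_field_derivative_def by (intro has_derivative_Pair)
  have 2: "(f has_derivative (\<lambda>(h, k). A * h + B * k)) (at (x s, y s) within (\<lambda>r. (x r, y r)) ` I)"
    by (rule has_derivative_subset[OF assms(1)]) (use assms(4) in auto)
  from has_derivative_in_compose[OF 1 2] show ?thesis
    unfolding has_field_derivative_def
    by (rule has_derivative_eq_rhs) (auto simp: o_def algebra_simps)
qed

lemma DERIV_pos_right_increases:
  fixes f :: "real \<Rightarrow> real"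
  assumes "(f has_real_derivative d) (at 0 within {0..})" "d > 0" "\<delta> > 0"
  shows "\<exists>k. 0 < k \<and> k < \<delta> \<and> f k > f 0"
proof -
  from has_real_derivative_pos_inc_right[OF assms(1,2)] obtain e where
    e: "e > 0" "\<And>h. h > 0 \<Longrightarrow> 0 + h \<in> {0..} \<Longrightarrow> h < e \<Longrightarrow> f 0 < f (0 + h)" by blast
  then show ?thesis using assms(3)
    by (intro exI[of _ "min e \<delta> / 2"]) (auto simp: min_def)
qed

lemma has_real_derivative_cong_on:
  fixes f g :: "real \<Rightarrow> real"
  assumes "(f has_real_derivative d) (at x within S)" "x \<in> S" "\<And>y. y \<in> S \<Longrightarrow> f y = g y"
  shows "(g has_real_derivative d) (at x within S)"
  by (rule has_field_derivative_transform_within[OF assms(1), of 1]) (use assms in auto)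

text \<open>The difference \<open>f (y, s) - f (x - 1, s)\<close> is an integral of
  \<open>fx\<close>; Leibniz's rule differentiates it in time, and the fundamental theorem of
  calculus then in \<open>y\<close>. This works up to the boundary \<open>t = 0\<close>, where time
  derivatives are one-sided. The base point \<open>x - 1\<close> is just some point to the left of
  \<open>x\<close>.\<close>

lemma mixed_partials_eq:
  fixes f fx ft :: "real \<times> real \<Rightarrow> real"
  defines "D \<equiv> UNIV \<times> {0::real..}"
  assumes f: "\<And>z. z \<in> D \<Longrightarrow> (f has_derivative (\<lambda>(h, k). fx z * h + ft z * k)) (at z within D)"
    and fx: "\<And>z. z \<in> D \<Longrightarrow> (fx has_derivative (\<lambda>(h, k). fxx z * h + fxt z * k)) (at z within D)"
    and ft: "\<And>z. z \<in> D \<Longrightarrow> (ft has_derivative (\<lambda>(h, k). ftx z * h + ftt z * k)) (at z within D)"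
    and cont: "continuous_on D fxt"
    and z: "(x, t) \<in> D"
  shows "ftx (x, t) = fxt (x, t)"
proof -
  have xder: "((\<lambda>y. g (y, s)) has_real_derivative gx (y, s)) (at y within I)"
    if "\<And>z. z \<in> D \<Longrightarrow> (g has_derivative (\<lambda>(h, k). gx z * h + gt z * k)) (at z within D)" "s \<ge> 0"
    for g gx gt :: "real \<times> real \<Rightarrow> real" and y s I
    using has_real_derivative_along_path[of g "gx (y, s)" "gt (y, s)" "\<lambda>y. y" y "\<lambda>_. s" D 1 UNIV 0]
      that(1)[of "(y, s)"] that(2)
    by (auto simp: D_def intro: has_field_derivative_at_within)
  have tder: "((\<lambda>s. g (y, s)) has_real_derivative gt (y, s)) (at s within {0..})"
    if "\<And>z. z \<in> D \<Longrightarrow> (g has_derivative (\<lambda>(h, k). gx z * h + gt z * k)) (at z within D)" "s \<ge> 0"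
    for g gx gt :: "real \<times> real \<Rightarrow> real" and y s
    using has_real_derivative_along_path[of g "gx (y, s)" "gt (y, s)" "\<lambda>_. y" s "\<lambda>s. s" D 0 "{0..}" 1]
      that(1)[of "(y, s)"] that(2)
    by (auto simp: D_def)
  have t: "t \<ge> 0" using z by (simp add: D_def)
  have contfx: "continuous_on D fx"
    by (rule has_derivative_continuous_on) (rule fx)
  have contx: "continuous_on {x-1..y} (\<lambda>r. fx (r, s))" if "s \<ge> 0" for y s
    by (rule continuous_on_compose2[OF contfx]) (use that in \<open>auto simp: D_def intro!: continuous_intros\<close>)
  have contxt: "continuous_on {x-1..y} (\<lambda>r. fxt (r, s))" if "s \<ge> 0" for y s
    by (rule continuous_on_compose2[OF cont]) (use that in \<open>auto simp: D_def intro!: continuous_intros\<close>)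
  have eq: "ft (y, t) = ft (x - 1, t) + integral {x-1..y} (\<lambda>r. fxt (r, t))" if "y \<ge> x - 1" for y
  proof -
    have int: "integral {x-1..y} (\<lambda>r. fx (r, s)) = f (y, s) - f (x - 1, s)" if "s \<ge> 0" for s
      by (rule integral_unique[OF fundamental_theorem_of_calculus])
        (use \<open>y \<ge> x - 1\<close> xder[OF f that] in \<open>auto simp flip: has_real_derivative_iff_has_vector_derivative\<close>)
    have "((\<lambda>s. integral (cbox (x-1) y) (\<lambda>r. fx (r, s))) has_real_derivative
        integral (cbox (x-1) y) (\<lambda>r. fxt (r, t))) (at t within {0..})"
    proof (rule leibniz_rule_field_derivative)
      show "continuous_on ({0..} \<times> cbox (x-1) y) (\<lambda>(s, r). fxt (r, s))"
        unfolding split_def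
        by (rule continuous_on_compose2[OF cont]) (auto simp: D_def intro!: continuous_intros)
    qed (use t tder[OF fx] contx in \<open>auto intro: integrable_continuous_real\<close>)
    from this[unfolded cbox_interval] have 1: "((\<lambda>s. f (y, s) - f (x - 1, s)) has_real_derivative
        integral {x-1..y} (\<lambda>r. fxt (r, t))) (at t within {0..})"
      by (rule has_real_derivative_cong_on) (use t int in auto)
    have 2: "((\<lambda>s. f (y, s) - f (x - 1, s)) has_real_derivative ft (y, t) - ft (x - 1, t)) (at t within {0..})"
      by (intro DERIV_diff tder[OF f] t)
    from DERIV_unique_Ici[OF 1 2 t] show ?thesis by simp
  qed
  have "((\<lambda>y. integral {x-1..y} (\<lambda>r. fxt (r, t))) has_real_derivative fxt (x, t)) (at x within {x-1..x+1})"
    by (rule integral_has_real_derivative[OF contxt[OF t]]) auto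
  then have "((\<lambda>y. ft (x - 1, t) + integral {x-1..y} (\<lambda>r. fxt (r, t))) has_real_derivative fxt (x, t)) (at x within {x-1..x+1})"
    by (auto intro!: derivative_eq_intros)
  then have "((\<lambda>y. ft (y, t)) has_real_derivative fxt (x, t)) (at x within {x-1..x+1})"
    by (rule has_real_derivative_cong_on) (auto intro!: eq[symmetric])
  then have "((\<lambda>y. ft (y, t)) has_real_derivative fxt (x, t)) (at x)"
    by (simp add: at_within_Icc_at)
  with xder[OF ft t, of x UNIV] show ?thesis
    using DERIV_unique by blast
qed

text \<open>Gronwall's argument: the bound on \<open>f'\<close> makes
  \<open>(f t)\<^sup>2 * exp (- 2 * M * t)\<close> nonincreasing.\<close>

lemma linear_ode_zero:
  fixes f :: "real \<Rightarrow> real"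
  assumes "l \<le> r" "f l = 0"
    and der: "\<And>t. t \<in> {l..r} \<Longrightarrow> (f has_real_derivative f' t) (at t within {l..r})"
    and bd: "\<And>t. t \<in> {l..r} \<Longrightarrow> \<bar>f' t\<bar> \<le> M * \<bar>f t\<bar>"
  shows "f r = 0"
proof -
  define g where "g = (\<lambda>t. (f t)\<^sup>2 * exp (- 2 * M * t))"
  have "g r \<le> g l"
  proof (rule DERIV_nonpos_imp_decreasing_open[OF \<open>l \<le> r\<close>])
    fix t assume t: "l < t" "t < r"
    then have "(f has_real_derivative f' t) (at t)"
      using der[of t] by (simp add: at_within_Icc_at)
    then have "(g has_real_derivative (2 * f t * f' t - 2 * M * (f t)\<^sup>2) * exp (- 2 * M * t)) (at t)"
      unfolding g_def by (auto intro!: derivative_eq_intros simp: algebra_simps power2_eq_square)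
    moreover have "f t * f' t \<le> M * (f t)\<^sup>2"
    proof -
      have "f t * f' t \<le> \<bar>f t\<bar> * \<bar>f' t\<bar>" by (metis abs_ge_self abs_mult)
      also have "\<dots> \<le> \<bar>f t\<bar> * (M * \<bar>f t\<bar>)" using bd[of t] t by (intro mult_left_mono) auto
      also have "\<dots> = M * (f t)\<^sup>2" by (simp add: power2_eq_square)
      finally show ?thesis .
    qed
    ultimately show "\<exists>y. (g has_real_derivative y) (at t) \<and> y \<le> 0"
      by (intro exI conjI) (assumption, auto intro!: mult_nonpos_nonneg)
  next
    show "continuous_on {l..r} g" unfolding g_def
      using der by (intro continuous_intros DERIV_continuous_on[of _ f f']) auto
  qed
  then have "(f r)\<^sup>2 * exp (- 2 * M * r) \<le> 0"
    using \<open>f l = 0\<close> by (simp add: g_def)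
  then show ?thesis by (simp add: mult_le_0_iff)
qed

section \<open>Global solutions of scalar ordinary differential equations\<close>

text \<open>Picard iteration on the whole half-line at once: the iterates do not depend on
  \<open>N\<close>, and a Lipschitz constant for each bounded time interval makes them converge
  uniformly there, so that no local solutions have to be glued.\<close>

lemma picard_lindelof_Ici:
  fixes G :: "real \<Rightarrow> real \<Rightarrow> real"
  assumes cont: "continuous_on (UNIV \<times> {t0..}) (\<lambda>(y, t). G y t)"
    and lip: "\<And>N. \<exists>L>0. \<forall>t\<in>{t0..N}. \<forall>y z. \<bar>G y t - G z t\<bar> \<le> L * \<bar>y - z\<bar>"
  obtains \<eta> where "\<eta> t0 = y0" "\<And>t. t \<ge> t0 \<Longrightarrow> (\<eta> has_real_derivative G (\<eta> t) t) (at t within {t0..})"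
proof -
  define it where "it = rec_nat (\<lambda>t. y0) (\<lambda>_ g t. y0 + integral {t0..t} (\<lambda>s. G (g s) s))"
  have it0: "it 0 = (\<lambda>t. y0)" and itS: "it (Suc n) = (\<lambda>t. y0 + integral {t0..t} (\<lambda>s. G (it n s) s))" for n
    by (simp_all add: it_def)
  have contG: "continuous_on {t0..N} (\<lambda>s. G (g s) s)" if "continuous_on {t0..N} g" for g N
  proof -
    have "continuous_on {t0..N} (\<lambda>s. (\<lambda>(y, t). G y t) (g s, s))"
      by (rule continuous_on_compose2[OF cont]) (use that in \<open>auto intro!: continuous_on_Pair continuous_on_id\<close>)
    then show ?thesis by simp
  qed
  have contit: "continuous_on {t0..N} (it n)" for n N
  proof (induction n)
    case (Suc n)
    show ?case unfolding itS
      by (intro continuous_intros indefinite_integral_continuous_1 integrable_continuous_real contG Suc)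
  qed (simp add: it0)
  have geom: "\<exists>M\<ge>0. \<forall>n. \<forall>t\<in>{t0..N}. \<bar>it (Suc n) t - it n t\<bar> \<le> M * (1/2) ^ n" for N
  proof -
    obtain L where L: "L > 0" "\<And>t y z. t \<in> {t0..N} \<Longrightarrow> \<bar>G y t - G z t\<bar> \<le> L * \<bar>y - z\<bar>"
      using lip by blast
    have "continuous_on {t0..N} (\<lambda>t. it 1 t - it 0 t)"
      by (rule continuous_on_diff; rule contit)
    from compact_continuous_bound[OF compact_Icc this]
    obtain M where "M > 0" and M: "\<forall>t\<in>{t0..N}. \<bar>it 1 t - it 0 t\<bar> \<le> M" by blast
    \<comment> \<open>The exponential weight replaces the usual factorials: integrating
      \<open>L * exp (2 * L * s)\<close> returns half the weight, so each iteration halves the bound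
      on intervals of any length.\<close>
    have key: "\<bar>it (Suc n) t - it n t\<bar> \<le> M * (1/2)^n * exp (2 * L * (t - t0))" if "t \<in> {t0..N}" for n t
      using that
    proof (induction n arbitrary: t)
      case 0
      have "M * 1 \<le> M * exp (2 * L * (t - t0))"
        using 0 L(1) \<open>M > 0\<close> by (intro mult_left_mono) auto
      with bspec[OF M 0] show ?case by simp
    next
      case (Suc n)
      have c1: "continuous_on {t0..t} (\<lambda>s. G (it m s) s)" for m
        by (intro contG contit)
      define E where "E = (\<lambda>s. M * (1/2)^(Suc n) * exp (2 * L * (s - t0)))"
      have E: "((\<lambda>s. L * (M * (1/2)^n * exp (2 * L * (s - t0)))) has_integral E t - E t0) {t0..t}"
      proof (rule fundamental_theorem_of_calculus)
        fix s assume "s \<in> {t0..t}"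
        show "(E has_vector_derivative L * (M * (1/2)^n * exp (2 * L * (s - t0)))) (at s within {t0..t})"
          unfolding E_def has_real_derivative_iff_has_vector_derivative[symmetric]
          by (auto intro!: derivative_eq_intros)
      qed (use Suc in auto)
      have "\<bar>it (Suc (Suc n)) t - it (Suc n) t\<bar> = \<bar>integral {t0..t} (\<lambda>s. G (it (Suc n) s) s - G (it n s) s)\<bar>"
        using fun_cong[OF itS[of "Suc n"], of t] fun_cong[OF itS[of n], of t]
          integral_diff[OF integrable_continuous_real[OF c1[of "Suc n"]] integrable_continuous_real[OF c1[of n]]]
        by simp
      also have "\<dots> \<le> integral {t0..t} (\<lambda>s. L * (M * (1/2)^n * exp (2 * L * (s - t0))))"
        unfolding real_norm_def[symmetric]
      proof (rule integral_norm_bound_integral)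
        show "norm (G (it (Suc n) s) s - G (it n s) s) \<le> L * (M * (1/2)^n * exp (2 * L * (s - t0)))"
          if "s \<in> {t0..t}" for s
        proof -
          have s: "s \<in> {t0..N}" using that Suc.prems by auto
          from L(2)[OF s] have "\<bar>G (it (Suc n) s) s - G (it n s) s\<bar> \<le> L * \<bar>it (Suc n) s - it n s\<bar>" .
          also have "\<dots> \<le> L * (M * (1/2)^n * exp (2 * L * (s - t0)))"
            using L(1) Suc.IH[OF s] by simp
          finally show ?thesis by simp
        qed
      qed (use c1 E in \<open>auto intro!: integrable_continuous_real continuous_intros\<close>)
      also have "\<dots> = E t - E t0" using E by (rule integral_unique)
      also have "\<dots> \<le> E t" using \<open>M > 0\<close> by (simp add: E_def)
      finally show ?case by (simp add: E_def)
    qed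
    show ?thesis
    proof (intro exI[of _ "M * exp (2 * L * \<bar>N - t0\<bar>)"] conjI allI ballI)
      fix n t assume t: "t \<in> {t0..N}"
      have "exp (2 * L * (t - t0)) \<le> exp (2 * L * \<bar>N - t0\<bar>)"
        using t L(1) by auto
      then have "M * (1/2)^n * exp (2 * L * (t - t0)) \<le> M * (1/2)^n * exp (2 * L * \<bar>N - t0\<bar>)"
        using \<open>M > 0\<close> by (intro mult_left_mono) auto
      with key[OF t, of n] show "\<bar>it (Suc n) t - it n t\<bar> \<le> M * exp (2 * L * \<bar>N - t0\<bar>) * (1/2) ^ n"
        by (simp add: mult_ac)
    qed (use \<open>M > 0\<close> in auto)
  qed
  define \<eta> where "\<eta> t = y0 + (\<Sum>n. it (Suc n) t - it n t)" for t
  have ulim: "uniform_limit {t0..N} it \<eta> sequentially" for N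
  proof -
    obtain M where M: "\<And>n t. t \<in> {t0..N} \<Longrightarrow> \<bar>it (Suc n) t - it n t\<bar> \<le> M * (1/2) ^ n"
      using geom by blast
    have "uniform_limit {t0..N} (\<lambda>n t. \<Sum>i<n. it (Suc i) t - it i t) (\<lambda>t. \<Sum>n. it (Suc n) t - it n t) sequentially"
      by (rule Weierstrass_m_test[where M = "\<lambda>n. M * (1/2) ^ n"]) (use M in \<open>auto intro!: summable_mult summable_geometric\<close>)
    then have "uniform_limit {t0..N} (\<lambda>n t. y0 + (\<Sum>i<n. it (Suc i) t - it i t)) \<eta> sequentially"
      unfolding \<eta>_def by (intro uniform_limit_intros)
    moreover have "(\<lambda>n t. y0 + (\<Sum>i<n. it (Suc i) t - it i t)) = it"
      using sum_lessThan_telescope[of "\<lambda>i. it i t" for t] by (intro ext) (simp add: it0)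
    ultimately show ?thesis by simp
  qed
  have cont\<eta>: "continuous_on {t0..N} \<eta>" for N
    by (rule uniform_limit_theorem[OF always_eventually ulim]) (simp_all add: contit)
  have fix_eq: "\<eta> t = y0 + integral {t0..t} (\<lambda>s. G (\<eta> s) s)" if t: "t \<ge> t0" for t
  proof -
    obtain L where L: "L > 0" "\<And>s y z. s \<in> {t0..t} \<Longrightarrow> \<bar>G y s - G z s\<bar> \<le> L * \<bar>y - z\<bar>"
      using lip by blast
    have "uniform_limit {t0..t} (\<lambda>n s. G (it n s) s) (\<lambda>s. G (\<eta> s) s) sequentially"
    proof (rule uniform_limitI)
      fix e :: real assume "e > 0"
      then have "\<forall>\<^sub>F n in sequentially. \<forall>s\<in>{t0..t}. dist (it n s) (\<eta> s) < e / L"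
        using L(1) by (intro uniform_limitD[OF ulim]) auto
      then show "\<forall>\<^sub>F n in sequentially. \<forall>s\<in>{t0..t}. dist (G (it n s) s) (G (\<eta> s) s) < e"
      proof eventually_elim
        case (elim n)
        show ?case
        proof
          fix s assume s: "s \<in> {t0..t}"
          have "dist (G (it n s) s) (G (\<eta> s) s) \<le> L * dist (it n s) (\<eta> s)"
            using L(2)[OF s] by (simp add: dist_real_def)
          also have "\<dots> < L * (e / L)" using elim s L(1) by (intro mult_strict_left_mono) auto
          finally show "dist (G (it n s) s) (G (\<eta> s) s) < e" using L(1) by simp
        qed
      qed
    qed
    then obtain I J where IJ: "\<And>n. ((\<lambda>s. G (it n s) s) has_integral I n) {t0..t}"
      "((\<lambda>s. G (\<eta> s) s) has_integral J) {t0..t}" "I \<longlonglongrightarrow> J"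
      by (rule uniform_limit_integral) (auto intro!: contG contit)
    then have "(\<lambda>n. integral {t0..t} (\<lambda>s. G (it n s) s)) \<longlonglongrightarrow> integral {t0..t} (\<lambda>s. G (\<eta> s) s)"
      by (simp add: integral_unique[OF IJ(1)] integral_unique[OF IJ(2)])
    then have "(\<lambda>n. it (Suc n) t) \<longlonglongrightarrow> y0 + integral {t0..t} (\<lambda>s. G (\<eta> s) s)"
      unfolding itS by (intro tendsto_intros)
    moreover have "(\<lambda>n. it n t) \<longlonglongrightarrow> \<eta> t"
      by (rule tendsto_uniform_limitI[OF ulim[of t]]) (use t in auto)
    ultimately show ?thesis
      using LIMSEQ_unique LIMSEQ_Suc by blast
  qed
  show thesis
  proof
    show "\<eta> t0 = y0" using fix_eq[of t0] by simp
    fix t assume t: "t \<ge> t0"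
    have "((\<lambda>t. integral {t0..t} (\<lambda>s. G (\<eta> s) s)) has_real_derivative G (\<eta> t) t) (at t within {t0..t+1})"
      by (rule integral_has_real_derivative) (use t in \<open>auto intro!: contG cont\<eta>\<close>)
    then have "((\<lambda>t. y0 + integral {t0..t} (\<lambda>s. G (\<eta> s) s)) has_real_derivative G (\<eta> t) t) (at t within {t0..t+1})"
      by (auto intro!: derivative_eq_intros)
    then have "(\<eta> has_real_derivative G (\<eta> t) t) (at t within {t0..t+1})"
      by (rule has_real_derivative_cong_on) (use fix_eq t in auto)
    moreover have "at t within {t0..t+1} = at t within {t0..}"
      by (rule at_within_nhd[of _ "{..<t+1}"]) (use t in auto)
    ultimately show "(\<eta> has_real_derivative G (\<eta> t) t) (at t within {t0..})" by simp
  qed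
qed

section \<open>Maximum principles\<close>

text \<open>Wherever \<open>f\<close> exceeds \<open>M\<close>, it is stationary along the direction
  \<open>(d, - 1)\<close>; after a small tilt in time this excludes a maximum above
  \<open>M\<close>. Only a short tangent segment inside \<open>K\<close> is required at each point,
  so the bound comes without integrating the characteristic through \<open>z0\<close>.\<close>

lemma transport_le:
  fixes f :: "real \<times> real \<Rightarrow> real"
  assumes "compact K" "\<And>z. z \<in> K \<Longrightarrow> snd z \<ge> 0"
    and der: "\<And>z. z \<in> K \<Longrightarrow> (f has_derivative (\<lambda>(h, k). A z * h + B z * k)) (at z within K)"
    and step: "\<And>x t. (x, t) \<in> K \<Longrightarrow> f (x, t) \<le> M \<or> 
      (\<exists>d \<delta>. \<delta> > 0 \<and> A (x, t) * d = B (x, t) \<and> (\<forall>s. 0 \<le> s \<and> s < \<delta> \<longrightarrow> (x + d * s, t - s) \<in> K))"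
    and z0: "z0 \<in> K"
  shows "f z0 \<le> M"
proof (rule ccontr)
  assume "\<not> f z0 \<le> M"
  \<comment> \<open>A tilt so small that subtracting \<open>\<eta> * snd z\<close> keeps the value
    at \<open>z0\<close> above \<open>M\<close>. The tilted function then has slope
    \<open>\<eta> > 0\<close> backwards in time. The summand 1 covers
    \<open>snd z0 = 0\<close>.\<close>
  define \<eta> where "\<eta> = (f z0 - M) / (2 * (snd z0 + 1))"
  have s0: "snd z0 \<ge> 0" using assms z0 by auto
  then have \<eta>: "\<eta> > 0" using \<open>\<not> f z0 \<le> M\<close> by (simp add: \<eta>_def)
  have "\<eta> * snd z0 < f z0 - M"
  proof -
    have "\<eta> * (2 * (snd z0 + 1)) = f z0 - M" using s0 by (simp add: \<eta>_def)
    then have "2 * (\<eta> * snd z0) + 2 * \<eta> = f z0 - M" by (simp add: algebra_simps)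
    moreover have "\<eta> * snd z0 \<ge> 0" using \<eta> s0 by simp
    ultimately show ?thesis using \<eta> by linarith
  qed
  define g where "g z = f z - \<eta> * snd z" for z
  have "continuous_on K f" by (rule has_derivative_continuous_on) (rule der)
  then have "continuous_on K g" unfolding g_def by (intro continuous_intros)
  from continuous_attains_sup[OF \<open>compact K\<close> _ this] z0 obtain z where
    z: "z \<in> K" "\<And>y. y \<in> K \<Longrightarrow> g y \<le> g z" by blast
  obtain x t where xt: "z = (x, t)" by (cases z)
  have "g z \<ge> g z0" using z z0 by blast
  moreover have "\<eta> * snd z \<ge> 0" using \<eta> assms(2)[OF z(1)] by simp
  ultimately have "f z > M"
    using \<open>\<eta> * snd z0 < f z0 - M\<close> unfolding g_def by linarith
  with step[of x t] z(1) xt obtain d \<delta> where d: "\<delta> > 0" "A z * d = B z"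
    "\<And>s. 0 \<le> s \<Longrightarrow> s < \<delta> \<Longrightarrow> (x + d * s, t - s) \<in> K" by auto
  have "((\<lambda>s. f (x + d * s, t - s)) has_real_derivative A z * d + B z * (-1)) (at 0 within {0..<\<delta>})"
    by (rule has_real_derivative_along_path[where S = K])
      (use der[OF z(1)] d(3) in \<open>auto simp: xt intro!: derivative_eq_intros\<close>)
  then have "((\<lambda>s. g (x + d * s, t - s)) has_real_derivative \<eta>) (at 0 within {0..<\<delta>})"
    unfolding g_def using d(2) by (auto intro!: derivative_eq_intros)
  moreover have "at (0::real) within {0..<\<delta>} = at 0 within {0..}"
    by (rule at_within_nhd[of _ "{..<\<delta>}"]) (use d(1) in auto)
  ultimately obtain k where "0 < k" "k < \<delta>" "g (x + d * k, t - k) > g z"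
    using DERIV_pos_right_increases[OF _ \<eta> d(1), of "\<lambda>s. g (x + d * s, t - s)"] by (auto simp: xt)
  moreover have "g (x + d * k, t - k) \<le> g z"
    using \<open>0 < k\<close> \<open>k < \<delta>\<close> by (intro z(2) d(3)) auto
  ultimately show False by linarith
qed

lemma cone_max_principle:
  fixes Y Z :: "real \<times> real \<Rightarrow> real" and m :: "real \<Rightarrow> real"
  assumes "compact \<Delta>" and contY: "continuous_on \<Delta> Y" and contZ: "continuous_on \<Delta> Z"
    and m: "antimono m" "\<And>x. m x > 0" "\<And>x. (m \<longlongrightarrow> m x) (at_left x)"
    and base: "\<And>t. (a, t) \<in> \<Delta> \<Longrightarrow> Y (a, t) + m a * \<bar>Z (a, t)\<bar> \<le> 0"
    and step: "\<And>x t e. (x, t) \<in> \<Delta> \<Longrightarrow> x \<noteq> a \<Longrightarrow> e \<in> {1, - 1} \<Longrightarrow> 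
      Y (x, t) + e * m x * Z (x, t) > 0 \<Longrightarrow>
      \<exists>x' t'. (x', t') \<in> \<Delta> \<and> x' \<le> x \<and> 
        exp (- \<Lambda> * x') * (Y (x', t') + e * m x * Z (x', t')) > exp (- \<Lambda> * x) * (Y (x, t) + e * m x * Z (x, t))"
    and z0: "(x0, t0) \<in> \<Delta>"
  shows "Y (x0, t0) + m x0 * \<bar>Z (x0, t0)\<bar> \<le> 0"
proof (rule ccontr)
  assume neg: "\<not> ?thesis"
  \<comment> \<open>The cone expression need not be continuous where \<open>m\<close> jumps. With
    the coefficient as an extra variable \<open>q\<close> ranging up to \<open>m x\<close>, the
    function \<open>F\<close> is continuous and the set \<open>H\<close> is still compact.\<close>
  define H where "H = {((x, t), q). (x, t) \<in> \<Delta> \<and> 0 \<le> q \<and> q \<le> m x}"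
  define F where "F w = exp (- \<Lambda> * fst (fst w)) * (Y (fst w) + snd w * \<bar>Z (fst w)\<bar>)" for w :: "(real \<times> real) \<times> real"
  have "compact H"
  proof -
    from compact_continuous_bound[OF \<open>compact \<Delta>\<close> continuous_on_fst[OF continuous_on_id]]
    obtain M where M: "\<forall>z\<in>\<Delta>. \<bar>fst z\<bar> \<le> M" by blast
    define l where "l = - M"
    have l: "l \<le> fst z" if "z \<in> \<Delta>" for z
      using bspec[OF M that] by (simp add: l_def)
    have "H = (\<Delta> \<times> {0..m l}) \<inter> - {((x, t :: real), q). q > m x}"
      using l monotoneD[OF m(1)] by (fastforce simp: H_def)
    \<comment> \<open>Upper semicontinuity: left-continuity gives some \<open>y < x\<close> with
      \<open>m y < q\<close>, and monotonicity extends this bound to everything right of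
      \<open>y\<close>.\<close>
    moreover have "open {((x, t :: real), q). q > m x}"
    proof (subst open_subopen, rule ballI)
      fix w :: "(real \<times> real) \<times> real" assume "w \<in> {((x, t), q). q > m x}"
      then obtain x t q where w: "w = ((x, t), q)" and q: "q > m x" by auto
      then have "\<forall>\<^sub>F y in at_left x. m y < q" using m(3)[of x] order_tendstoD(2) by blast
      then obtain y where y: "y < x" "m y < q"
        by (metis eventually_at_left dense lt_ex)
      have "open (({y<..} \<times> (UNIV :: real set)) \<times> {m y<..})" by (intro open_Times) auto
      moreover have "w \<in> ({y<..} \<times> UNIV) \<times> {m y<..}" using y w by auto
      moreover have "({y<..} \<times> UNIV) \<times> {m y<..} \<subseteq> {((x, t :: real), q). q > m x}"
        using monotoneD[OF m(1)] by (force dest: less_imp_le)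
      ultimately show "\<exists>T. open T \<and> w \<in> T \<and> T \<subseteq> {((x, t :: real), q). q > m x}" by blast
    qed
    ultimately show ?thesis
      using compact_Int_closed[OF compact_Times[OF \<open>compact \<Delta>\<close> compact_Icc]] closed_Compl by metis
  qed
  moreover have "continuous_on H F"
    unfolding F_def
    by (intro continuous_intros continuous_on_compose2[OF contY] continuous_on_compose2[OF contZ])
      (auto simp: H_def)
  moreover have w0: "((x0, t0), m x0) \<in> H" using z0 m(2)[of x0] by (simp add: H_def less_imp_le)
  ultimately obtain w where w: "w \<in> H" "\<And>v. v \<in> H \<Longrightarrow> F v \<le> F w"
    using continuous_attains_sup[of H F] by blast
  obtain x t q where xt: "w = ((x, t), q)" by (metis prod.exhaust)
  have in\<Delta>: "(x, t) \<in> \<Delta>" and q: "0 \<le> q" "q \<le> m x" using w(1) by (auto simp: H_def xt)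
  have mono: "Y (y, s) + r * \<bar>Z (y, s)\<bar> \<le> Y (y, s) + r' * \<bar>Z (y, s)\<bar>" if "r \<le> r'" for r r' y s
    using that by (simp add: mult_right_mono)
  have "F w > 0"
    using w(2)[OF w0] neg by (smt (verit) F_def exp_gt_zero fst_conv snd_conv mult_pos_pos)
  \<comment> \<open>The expression is nondecreasing in \<open>q\<close>, so the maximum may be taken
    at the full coefficient \<open>q = m x\<close>.\<close>
  have le: "F w \<le> F ((x, t), m x)" using mono[OF q(2), of x t] by (simp add: F_def xt)
  with \<open>F w > 0\<close> have "F ((x, t), m x) > 0" by linarith
  then have pos: "Y (x, t) + m x * \<bar>Z (x, t)\<bar> > 0"
    by (simp add: F_def zero_less_mult_iff)
  obtain e :: real where e: "e \<in> {1, -1}" "e * Z (x, t) = \<bar>Z (x, t)\<bar>"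
    using that[of "if Z (x, t) \<ge> 0 then 1 else - 1"] by auto
  from e(2) have e': "e * m x * Z (x, t) = m x * \<bar>Z (x, t)\<bar>"
    by (metis mult.assoc mult.commute)
  have "x \<noteq> a" using base pos in\<Delta> by force
  from step[OF in\<Delta> this e(1)] pos e' obtain x' t' where
    xt': "(x', t') \<in> \<Delta>" "x' \<le> x" 
      "exp (- \<Lambda> * x') * (Y (x', t') + e * m x * Z (x', t')) > exp (- \<Lambda> * x) * (Y (x, t) + m x * \<bar>Z (x, t)\<bar>)"
    by auto
  have "e * m x * Z (x', t') \<le> m x' * \<bar>Z (x', t')\<bar>"
  proof -
    have "e * Z (x', t') \<le> \<bar>Z (x', t')\<bar>" using e(1) by auto
    then have "m x * (e * Z (x', t')) \<le> m x * \<bar>Z (x', t')\<bar>" using m(2)[of x] by simp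
    also have "\<dots> \<le> m x' * \<bar>Z (x', t')\<bar>"
      using monotoneD[OF m(1) xt'(2)] by (simp add: mult_right_mono)
    finally show ?thesis by (simp add: mult_ac)
  qed
  then have "exp (- \<Lambda> * x') * (Y (x', t') + e * m x * Z (x', t')) \<le> F ((x', t'), m x')"
    by (simp add: F_def)
  also have "\<dots> \<le> F w"
    using w(2)[of "((x', t'), m x')"] xt'(1) m(2)[of x'] by (simp add: H_def less_imp_le)
  finally show False using xt'(3) le by (simp add: F_def)
qed

section \<open>Gas flows\<close>

abbreviation future :: "(real \<times> real) set" where "future \<equiv> UNIV \<times> {0..}"

text \<open>The two directions of propagation are merged into the sign \<open>e\<close>, which a
  reflection of \<open>x\<close> merely flips.\<close>

definition asymptotic_characteristic :: "(real \<Rightarrow> real) \<Rightarrow> (real \<times> real \<Rightarrow> real) \<Rightarrow> (real \<Rightarrow> real) \<Rightarrow> bool" where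
  "asymptotic_characteristic C p \<sigma> \<longleftrightarrow> (\<exists>X t0 xlim e. t0 \<ge> 0 \<and> e \<in> {1, - 1} \<and>
     (\<forall>t\<ge>t0. (X has_real_derivative e * (C (p (X t, t)) * \<sigma> (X t))) (at t within {t0..})) \<and>
     (X \<longlongrightarrow> xlim) at_top)"

text \<open>\<open>C\<close> is the sound speed as a function of pressure, up to a factor that
  depends on the entropy; its strict monotonicity is the genuine nonlinearity that makes compressive
  waves break. With \<open>H\<close> an antiderivative of \<open>1 / C\<close>, the Riemann
  invariants are \<open>u \<plusminus> H p / \<sigma>\<close>.\<close>

locale gas =
  fixes C C' H :: "real \<Rightarrow> real"
  assumes C_pos: "r > 0 \<Longrightarrow> C r > 0"
    and C_deriv: "r > 0 \<Longrightarrow> (C has_real_derivative C' r) (at r)"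
    and C'_cont: "continuous_on {0<..} C'"
    and C_strict: "0 < r \<Longrightarrow> r < s \<Longrightarrow> C r < C s"
    and H_deriv: "r > 0 \<Longrightarrow> (H has_real_derivative 1 / C r) (at r)"
begin

lemma C_cont: "continuous_on {0<..} C"
  using C_deriv by (intro continuous_at_imp_continuous_on ballI DERIV_isCont) auto

lemma H_inj: "r = s" if "0 < r" "0 < s" "H r = H s"
proof -
  have *: "H x < H y" if "0 < x" "x < y" for x y
  proof (rule DERIV_pos_imp_increasing[OF \<open>x < y\<close>])
    fix z assume "x \<le> z" "z \<le> y"
    then show "\<exists>d. (H has_real_derivative d) (at z) \<and> d > 0"
      using H_deriv[of z] C_pos[of z] that by (intro exI[of _ "1 / C z"]) auto
  qed
  show ?thesis using *[of r s] *[of s r] that by (cases r s rule: linorder_cases) auto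
qed

lemma C_lipschitz:
  assumes "m > 0"
  shows "\<exists>L>0. \<forall>r\<in>{m..M}. \<forall>s\<in>{m..M}. \<bar>C r - C s\<bar> \<le> L * \<bar>r - s\<bar>"
proof -
  have "continuous_on {m..M} C'"
    by (rule continuous_on_subset[OF C'_cont]) (use assms in auto)
  from compact_continuous_bound[OF compact_Icc this]
  obtain L where L: "L > 0" "\<forall>r\<in>{m..M}. \<bar>C' r\<bar> \<le> L" by blast
  have "norm (C r - C s) \<le> L * norm (r - s)" if "r \<in> {m..M}" "s \<in> {m..M}" for r s
  proof (rule field_differentiable_bound[of "{m..M}" C C'])
    show "(C has_field_derivative C' z) (at z within {m..M})" if "z \<in> {m..M}" for z
      using C_deriv[of z] that assms by (auto intro: has_field_derivative_at_within)
  qed (use L that in auto)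
  then show ?thesis using L(1) by auto
qed

end

text \<open>The Euler equations with \<open>p\<close> and \<open>u\<close> as unknowns. The momentum
  equation is built into \<open>dp\<close> and, differentiated in time, into \<open>dpt\<close>; the
  equation for \<open>ux\<close> is required with both one-sided limits \<open>sl\<close> and
  \<open>sr\<close>, since \<open>\<sigma>\<close> may jump on \<open>J\<close> while
  \<open>u\<close> and \<open>p\<close> are smooth. The list of assumptions is symmetric under
  reflection of \<open>x\<close>.\<close>

locale flow = gas +
  fixes p u pt ut ux utx utt ptt :: "real \<times> real \<Rightarrow> real"
    and \<sigma> sl sr :: "real \<Rightarrow> real" and J :: "real set" and a b :: real
  assumes p_pos: "z \<in> future \<Longrightarrow> p z > 0"
    and dp: "z \<in> future \<Longrightarrow> (p has_derivative (\<lambda>(h, k). - ut z * h + pt z * k)) (at z within future)"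
    and du: "z \<in> future \<Longrightarrow> (u has_derivative (\<lambda>(h, k). ux z * h + ut z * k)) (at z within future)"
    and dut: "z \<in> future \<Longrightarrow> (ut has_derivative (\<lambda>(h, k). utx z * h + utt z * k)) (at z within future)"
    and dpt: "z \<in> future \<Longrightarrow> (pt has_derivative (\<lambda>(h, k). - utt z * h + ptt z * k)) (at z within future)"
    and dux: "t \<ge> 0 \<Longrightarrow> ((\<lambda>s. ux (x, s)) has_real_derivative utx (x, t)) (at t within {0..})"
    and ux_left: "t \<ge> 0 \<Longrightarrow> ux (x, t) = - pt (x, t) / (C (p (x, t)) * sl x)\<^sup>2"
    and ux_right: "t \<ge> 0 \<Longrightarrow> ux (x, t) = - pt (x, t) / (C (p (x, t)) * sr x)\<^sup>2"
    and \<sigma>_mono: "mono \<sigma> \<or> antimono \<sigma>"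
    and \<sigma>_pos: "\<sigma> x > 0" "sl x > 0" "sr x > 0"
    and sl: "(\<sigma> \<longlongrightarrow> sl x) (at_left x)"
    and sr: "(\<sigma> \<longlongrightarrow> sr x) (at_right x)"
    and J: "finite J" "J \<subseteq> {a<..<b}" "x \<notin> J \<Longrightarrow> sl x = \<sigma> x" "x \<notin> J \<Longrightarrow> sr x = \<sigma> x"
    and ab: "a < b"
    and \<sigma>_const: "x \<le> a \<Longrightarrow> \<sigma> x = \<sigma> a" "b \<le> x \<Longrightarrow> \<sigma> x = \<sigma> b"
    and data_left: "x \<le> a \<Longrightarrow> p (x, 0) = p (a, 0)" "x \<le> a \<Longrightarrow> u (x, 0) = u (a, 0)"
    and data_right: "b \<le> x \<Longrightarrow> p (x, 0) = p (b, 0)" "b \<le> x \<Longrightarrow> u (x, 0) = u (b, 0)"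

lemma has_derivative_reflect:
  assumes "(f has_derivative (\<lambda>(h, k). A * h + B * k)) (at (- x, t) within future)"
  shows "((\<lambda>(x, t). f (- x, t)) has_derivative (\<lambda>(h, k). - A * h + B * k)) (at (x, t) within future)"
proof -
  have 1: "((\<lambda>z :: real \<times> real. (- fst z, snd z)) has_derivative (\<lambda>z. (- fst z, snd z))) (at (x, t) within future)"
    by (auto intro!: derivative_eq_intros)
  have 2: "(f has_derivative (\<lambda>(h, k). A * h + B * k)) (at (- fst (x, t), snd (x, t)) within (\<lambda>z. (- fst z, snd z)) ` future)"
    by (rule has_derivative_subset) (use assms in auto)
  from has_derivative_in_compose[OF 1 2] show ?thesis
    by (simp add: split_def)
qed

lemma has_derivative_neg2:
  fixes f :: "real \<times> real \<Rightarrow> real"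
  assumes "(f has_derivative (\<lambda>(h, k). A * h + B * k)) F"
  shows "((\<lambda>z. - f z) has_derivative (\<lambda>(h, k). (- A) * h + (- B) * k)) F"
  by (rule has_derivative_eq_rhs[OF has_derivative_minus[OF assms]]) (auto simp: fun_eq_iff)

lemma asymptotic_characteristic_reflect:
  assumes "asymptotic_characteristic C (\<lambda>(x, t). p (- x, t)) (\<lambda>x. \<sigma> (- x))"
  shows "asymptotic_characteristic C p \<sigma>"
proof -
  obtain X t0 xlim e where X: "t0 \<ge> 0" "e \<in> {1, - 1 :: real}" "(X \<longlongrightarrow> xlim) at_top"
    "\<And>t. t \<ge> t0 \<Longrightarrow> (X has_real_derivative e * (C (p (- X t, t)) * \<sigma> (- X t))) (at t within {t0..})"
    using assms unfolding asymptotic_characteristic_def by auto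
  show ?thesis unfolding asymptotic_characteristic_def
    by (rule exI[of _ "\<lambda>t. - X t"], rule exI[of _ t0], rule exI[of _ "- xlim"], rule exI[of _ "- e"])
      (use X(1,2) DERIV_minus[OF X(4)] tendsto_minus[OF X(3)] in auto)
qed

context flow
begin

text \<open>The equations are invariant under \<open>x \<mapsto> - x\<close>,
  \<open>u \<mapsto> - u\<close>, which exchanges forward and backward waves, the two one-sided
  limits, and the two ends of \<open>[a, b]\<close>. Facts about the right end are obtained in this
  way from those about the left end.\<close>

lemma reflect: "flow C C' H (\<lambda>(x, t). p (- x, t)) (\<lambda>(x, t). - u (- x, t)) (\<lambda>(x, t). pt (- x, t))
  (\<lambda>(x, t). - ut (- x, t)) (\<lambda>(x, t). ux (- x, t)) (\<lambda>(x, t). utx (- x, t)) (\<lambda>(x, t). - utt (- x, t))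
  (\<lambda>(x, t). ptt (- x, t)) (\<lambda>x. \<sigma> (- x)) (\<lambda>x. sr (- x)) (\<lambda>x. sl (- x)) (uminus ` J) (- b) (- a)"
proof unfold_locales
  show "0 < (case z of (x, t) \<Rightarrow> p (- x, t))" if "z \<in> future" for z
    using that p_pos by (auto simp: split_def)
next
  fix z :: "real \<times> real" assume z: "z \<in> future"
  obtain x t where xt: "z = (x, t)" by (cases z)
  have z': "(- x, t) \<in> future" using z xt by auto
  show "((\<lambda>(x, t). p (- x, t)) has_derivative
      (\<lambda>(h, k). - (case z of (x, t) \<Rightarrow> - ut (- x, t)) * h + (case z of (x, t) \<Rightarrow> pt (- x, t)) * k)) (at z within future)"
    using has_derivative_reflect[OF dp[OF z']] by (simp add: xt)
  show "((\<lambda>(x, t). - u (- x, t)) has_derivative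
      (\<lambda>(h, k). (case z of (x, t) \<Rightarrow> ux (- x, t)) * h + (case z of (x, t) \<Rightarrow> - ut (- x, t)) * k)) (at z within future)"
    using has_derivative_neg2[OF has_derivative_reflect[OF du[OF z']]] by (simp add: xt split_def)
  show "((\<lambda>(x, t). - ut (- x, t)) has_derivative
      (\<lambda>(h, k). (case z of (x, t) \<Rightarrow> utx (- x, t)) * h + (case z of (x, t) \<Rightarrow> - utt (- x, t)) * k)) (at z within future)"
    using has_derivative_neg2[OF has_derivative_reflect[OF dut[OF z']]] by (simp add: xt split_def)
  show "((\<lambda>(x, t). pt (- x, t)) has_derivative
      (\<lambda>(h, k). - (case z of (x, t) \<Rightarrow> - utt (- x, t)) * h + (case z of (x, t) \<Rightarrow> ptt (- x, t)) * k)) (at z within future)"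
    using has_derivative_reflect[OF dpt[OF z']] by (simp add: xt)
next
  show "mono (\<lambda>x. \<sigma> (- x)) \<or> antimono (\<lambda>x. \<sigma> (- x))"
    using \<sigma>_mono by (auto simp: monotone_on_def)
  show "((\<lambda>x. \<sigma> (- x)) \<longlongrightarrow> sr (- x)) (at_left x)" for x
    using sr[of "- x"] by (simp add: at_left_minus[of x] filterlim_filtermap)
  show "((\<lambda>x. \<sigma> (- x)) \<longlongrightarrow> sl (- x)) (at_right x)" for x
    using sl[of "- x"] by (simp add: at_right_minus[of x] filterlim_filtermap)
  show "sr (- x) = \<sigma> (- x)" "sl (- x) = \<sigma> (- x)" if "x \<notin> uminus ` J" for x
    using J(3,4)[of "- x"] that by force+
  show "uminus ` J \<subseteq> {- b<..<- a}" using J(2) by auto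
qed (use dux ux_left ux_right \<sigma>_pos J(1) ab in \<open>auto intro: data_left data_right \<sigma>_const\<close>)

lemma continuous_fields:
  "continuous_on future p" "continuous_on future u" "continuous_on future pt" "continuous_on future ut"
  by (rule has_derivative_continuous_on, rule dp du dpt dut, assumption)+

lemma continuous_Cp: "continuous_on future (\<lambda>z. C (p z))"
  by (rule continuous_on_compose2[OF C_cont continuous_fields(1)]) (use p_pos in auto)

lemma p_range:
  assumes "compact K" "K \<subseteq> future"
  shows "\<exists>m>0. \<exists>M. \<forall>z\<in>K. p z \<in> {m..M}"
proof (cases "K = {}")
  case False
  have c: "continuous_on K p" using continuous_fields(1) assms(2) by (rule continuous_on_subset)
  obtain z where z: "z \<in> K" "\<And>y. y \<in> K \<Longrightarrow> p z \<le> p y"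
    using continuous_attains_inf[OF assms(1) False c] by blast
  obtain z' where z': "z' \<in> K" "\<And>y. y \<in> K \<Longrightarrow> p y \<le> p z'"
    using continuous_attains_sup[OF assms(1) False c] by blast
  show ?thesis
    using z z' p_pos[of z] assms(2) by (intro exI[of _ "p z"] conjI exI[of _ "p z'"] ballI) auto
qed (auto intro: exI[of _ 1])

lemma Cp_lipschitz:
  assumes "compact K" "K \<subseteq> future"
  shows "\<exists>L>0. \<forall>z\<in>K. \<forall>z'\<in>K. \<bar>C (p z) - C (p z')\<bar> \<le> L * \<bar>p z - p z'\<bar>"
proof -
  obtain m M where m: "m > 0" "\<And>z. z \<in> K \<Longrightarrow> p z \<in> {m..M}" using p_range[OF assms] by blast
  obtain L where "L > 0" "\<And>r s. r \<in> {m..M} \<Longrightarrow> s \<in> {m..M} \<Longrightarrow> \<bar>C r - C s\<bar> \<le> L * \<bar>r - s\<bar>"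
    using C_lipschitz[OF m(1), of M] by blast
  then show ?thesis using m(2) by blast
qed

subsection \<open>The region of constant entropy on the left\<close>

abbreviation speed :: "real \<times> real \<Rightarrow> real" where "speed z \<equiv> C (p z) * \<sigma> a"

definition riemann :: "real \<Rightarrow> real \<times> real \<Rightarrow> real" where
  "riemann e z = u z + e * (H (p z) / \<sigma> a)"

lemma speed_pos: "z \<in> future \<Longrightarrow> speed z > 0"
  using p_pos C_pos \<sigma>_pos by simp

text \<open>With \<open>c = speed (x, t)\<close>, the gradient is a multiple of
  \<open>(- e / c, 1)\<close>: the invariant of sign \<open>e\<close> is stationary in the direction
  \<open>dx / dt = e * c\<close>.\<close>

lemma riemann_deriv:
  assumes "e \<in> {1, - 1}" "x \<le> a" "t \<ge> 0"
  defines "B \<equiv> ut (x, t) + e * pt (x, t) / speed (x, t)"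
  shows "(riemann e has_derivative (\<lambda>(h, k). (- e / speed (x, t) * B) * h + B * k)) (at (x, t) within future)"
proof -
  let ?c = "speed (x, t)"
  have z: "(x, t) \<in> future" using assms by auto
  have C: "C (p (x, t)) > 0" "\<sigma> a > 0" using p_pos[OF z] C_pos \<sigma>_pos by auto
  have "sl x = \<sigma> a" using J(2) J(3)[of x] \<sigma>_const(1)[of x] assms(2) by fastforce
  then have ux: "ux (x, t) = - pt (x, t) / ?c\<^sup>2" using ux_left[OF assms(3), of x] by simp
  have "(H has_derivative (\<lambda>h. (1 / C (p (x, t))) * h)) (at (p (x, t)))"
    using H_deriv[OF p_pos[OF z]] unfolding has_field_derivative_def .
  from has_derivative_compose[OF dp[OF z] this]
  have Hp: "((\<lambda>z. H (p z)) has_derivative (\<lambda>z. (1 / C (p (x, t))) * (case z of (h, k) \<Rightarrow> - ut (x, t) * h + pt (x, t) * k))) (at (x, t) within future)" .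
  have "((\<lambda>z. u z + e / \<sigma> a * H (p z)) has_derivative
    (\<lambda>z. (case z of (h, k) \<Rightarrow> ux (x, t) * h + ut (x, t) * k) + 
       e / \<sigma> a * ((1 / C (p (x, t))) * (case z of (h, k) \<Rightarrow> - ut (x, t) * h + pt (x, t) * k)))) (at (x, t) within future)"
    by (intro has_derivative_add du[OF z] has_derivative_mult_right Hp)
  moreover have "riemann e = (\<lambda>z. u z + e / \<sigma> a * H (p z))"
    by (auto simp: riemann_def)
  ultimately have "(riemann e has_derivative
    (\<lambda>z. (case z of (h, k) \<Rightarrow> ux (x, t) * h + ut (x, t) * k) + 
       e / \<sigma> a * ((1 / C (p (x, t))) * (case z of (h, k) \<Rightarrow> - ut (x, t) * h + pt (x, t) * k)))) (at (x, t) within future)"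
    by simp
  then show ?thesis
    by (rule has_derivative_eq_rhs)
      (use assms(1) C in \<open>auto simp: B_def ux fun_eq_iff field_simps power2_eq_square\<close>)
qed

text \<open>Upper and lower bound both come from \<open>transport_le\<close>, for the invariant and
  for its negative. Backwards in time, \<open>K\<close> may be left only through points where the
  value is already known.\<close>

lemma riemann_transport:
  assumes "compact K" "K \<subseteq> {..a} \<times> {0..}" "e \<in> {1, - 1}"
    and step: "\<And>x t. (x, t) \<in> K \<Longrightarrow> riemann e (x, t) = M \<or>
      (\<exists>\<delta>>0. \<forall>s. 0 \<le> s \<and> s < \<delta> \<longrightarrow> (x - e * speed (x, t) * s, t - s) \<in> K)"
    and z0: "z0 \<in> K"
  shows "riemann e z0 = M"
proof -
  define B where "B z = ut z + e * pt z / speed z" for z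
  have KD: "K \<subseteq> future" using assms(2) by auto
  have d: "(riemann e has_derivative (\<lambda>(h, k). (- e / speed z * B z) * h + B z * k)) (at z within K)" if "z \<in> K" for z
  proof -
    have "z \<in> {..a} \<times> {0..}" using that assms(2) by blast
    then obtain x t where z: "z = (x, t)" "x \<le> a" "t \<ge> 0" by auto
    show ?thesis unfolding z(1) B_def
      by (rule has_derivative_subset[OF riemann_deriv[OF assms(3) z(2,3)] KD])
  qed
  have eq: "(- e / speed z * B z) * (- e * speed z) = B z" if "z \<in> K" for z
  proof -
    have "z \<in> future" using that KD by auto
    from speed_pos[OF this] show ?thesis using assms(3) by auto
  qed
  have step': "(riemann e (x, t) \<le> M \<and> M \<le> riemann e (x, t)) \<or>
      (\<exists>\<delta>. \<delta> > 0 \<and> (\<forall>s. 0 \<le> s \<and> s < \<delta> \<longrightarrow> (x + (- e * speed (x, t)) * s, t - s) \<in> K))"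
    if "(x, t) \<in> K" for x t
    using step[OF that] by auto
  have "riemann e z0 \<le> M"
  proof (rule transport_le[OF assms(1) _ d _ z0])
    show "snd z \<ge> 0" if "z \<in> K" for z using that assms(2) by auto
    fix x t assume xt: "(x, t) \<in> K"
    show "riemann e (x, t) \<le> M \<or> (\<exists>d \<delta>. \<delta> > 0 \<and> (- e / speed (x, t) * B (x, t)) * d = B (x, t) \<and>
        (\<forall>s. 0 \<le> s \<and> s < \<delta> \<longrightarrow> (x + d * s, t - s) \<in> K))"
      using step'[OF xt] eq[OF xt] by blast
  qed
  moreover have "- riemann e z0 \<le> - M"
  proof (rule transport_le[OF assms(1) _ has_derivative_neg2[OF d] _ z0])
    show "snd z \<ge> 0" if "z \<in> K" for z using that assms(2) by auto
    fix x t assume xt: "(x, t) \<in> K"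
    have "- (- e / speed (x, t) * B (x, t)) * (- e * speed (x, t)) = - B (x, t)"
      using eq[OF xt] by (metis mult_minus_left)
    with step'[OF xt]
    show "- riemann e (x, t) \<le> - M \<or> (\<exists>d \<delta>. \<delta> > 0 \<and> - (- e / speed (x, t) * B (x, t)) * d = - B (x, t) \<and>
        (\<forall>s. 0 \<le> s \<and> s < \<delta> \<longrightarrow> (x + d * s, t - s) \<in> K))"
      unfolding neg_le_iff_le by blast
  qed
  ultimately show ?thesis by simp
qed

text \<open>The trapezoid is closed under the backward characteristics as long as the speed is at most
  \<open>\<kappa>\<close>; a first time at which it reaches \<open>\<kappa>\<close> is excluded because the state is constant up to then.\<close>

lemma outer_cone:
  assumes \<kappa>: "\<kappa> > speed (a, 0)" and t: "t \<ge> 0" and x: "x \<le> a - \<kappa> * t"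
  shows "p (x, t) = p (a, 0)" "u (x, t) = u (a, 0)"
proof -
  have \<kappa>0: "\<kappa> > 0" using \<kappa> speed_pos[of "(a, 0)"] by auto
  \<comment> \<open>This choice makes the left edge of the trapezoid pass through
    \<open>(x, t)\<close>.\<close>
  define y where "y = x - \<kappa> * t"
  define K where "K T = {(x', t'). 0 \<le> t' \<and> t' \<le> T \<and> y + \<kappa> * t' \<le> x' \<and> x' \<le> a - \<kappa> * t'}" for T
  have compK: "compact (K T)" for T
  proof -
    have "K T \<subseteq> {y..a} \<times> {0..T}"
    proof (clarsimp simp: K_def)
      fix x' t' assume *: "0 \<le> t'" "y + \<kappa> * t' \<le> x'" "x' \<le> a - \<kappa> * t'"
      have "\<kappa> * t' \<ge> 0" using *(1) \<kappa>0 by simp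
      then show "y \<le> x' \<and> x' \<le> a" using * by linarith
    qed
    moreover have "closed (K T)"
      unfolding K_def split_def by (intro closed_Collect_conj closed_Collect_le continuous_intros)
    ultimately show ?thesis
      using compact_Int_closed[of "{y..a} \<times> {0..T}" "K T"] by (simp add: compact_Times inf.absorb2)
  qed
  have K_future: "K T \<subseteq> {..a} \<times> {0..}" for T
  proof (clarsimp simp: K_def)
    fix x' t' assume *: "0 \<le> t'" "x' \<le> a - \<kappa> * t'"
    have "\<kappa> * t' \<ge> 0" using *(1) \<kappa>0 by simp
    then show "x' \<le> a" using * by linarith
  qed
  have const: "p z = p (a, 0) \<and> u z = u (a, 0)" if slow: "\<And>z. z \<in> K T \<Longrightarrow> speed z \<le> \<kappa>" and z: "z \<in> K T" for T z
  proof -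
    have r: "riemann e z = riemann e (a, 0)" if e: "e \<in> {1, - 1}" for e
    proof (rule riemann_transport[OF compK K_future e _ z])
      fix x' t' assume xt: "(x', t') \<in> K T"
      show "riemann e (x', t') = riemann e (a, 0) \<or>
        (\<exists>\<delta>>0. \<forall>s. 0 \<le> s \<and> s < \<delta> \<longrightarrow> (x' - e * speed (x', t') * s, t' - s) \<in> K T)"
      proof (cases "t' = 0")
        case True
        then show ?thesis using xt data_left[of x'] by (auto simp: K_def riemann_def)
      next
        case False
        have "(x' - e * speed (x', t') * s, t' - s) \<in> K T" if s: "0 \<le> s" "s < t'" for s
        proof -
          have "speed (x', t') * s \<le> \<kappa> * s" using slow[OF xt] s by (intro mult_right_mono) auto
          moreover have "speed (x', t') * s \<ge> 0" 
            using mult_nonneg_nonneg[OF less_imp_le[OF speed_pos[of "(x', t')"]] s(1)] xt by (auto simp: K_def)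
          moreover have "e * speed (x', t') * s = speed (x', t') * s \<or> e * speed (x', t') * s = - (speed (x', t') * s)"
            using e by auto
          moreover have "\<kappa> * (t' - s) = \<kappa> * t' - \<kappa> * s" by (simp add: right_diff_distrib)
          ultimately show ?thesis using xt s unfolding K_def mem_Collect_eq prod.case by linarith
        qed
        then show ?thesis using False xt by (intro disjI2 exI[of _ t']) (auto simp: K_def)
      qed
    qed
    have "u z = u (a, 0)" using r[of 1] r[of "- 1"] by (auto simp: riemann_def)
    then have "H (p z) = H (p (a, 0))"
      using r[of 1] \<sigma>_pos(1)[of a] by (auto simp: riemann_def)
    moreover have "z \<in> future" using subsetD[OF K_future z] by auto
    ultimately have "p z = p (a, 0)"
      by (intro H_inj[OF p_pos p_pos]) auto
    with \<open>u z = u (a, 0)\<close> show ?thesis by simp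
  qed
  define Q where "Q = {z \<in> K t. speed z \<ge> \<kappa>}"
  have contsp: "continuous_on (K t) speed"
    by (intro continuous_intros continuous_on_subset[OF continuous_Cp]) (use K_future[of t] in auto)
  have "Q = {}"
  proof (rule ccontr)
    assume "Q \<noteq> {}"
    have "Q = K t \<inter> (\<lambda>z. speed z) -` {\<kappa>..}" by (auto simp: Q_def)
    moreover have "closed (K t \<inter> (\<lambda>z. speed z) -` {\<kappa>..})"
      by (intro continuous_closed_preimage contsp compact_imp_closed[OF compK] closed_atLeast)
    ultimately have "compact Q" using compK[of t] by (metis compact_Int_closed inf.left_idem)
    then obtain z1 where z1: "z1 \<in> Q" "\<And>z. z \<in> Q \<Longrightarrow> snd z1 \<le> snd z"
      using continuous_attains_inf[of Q snd] \<open>Q \<noteq> {}\<close> continuous_on_snd[OF continuous_on_id] by blast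
    have sub: "K (snd z1) \<subseteq> K t" using z1(1) by (auto simp: Q_def K_def)
    have "speed z \<le> \<kappa>" if z: "z \<in> K (snd z1)" for z
    proof (cases "snd z < snd z1")
      case True
      then have "z \<notin> Q" using z1(2)[of z] by linarith
      then show ?thesis using z sub by (auto simp: Q_def)
    next
      case False
      obtain x' where zx: "z = (x', snd z1)" using z False by (auto simp: K_def)
      show ?thesis
      proof (cases "snd z1 = 0")
        case True
        then show ?thesis using z zx \<kappa> data_left[of x'] by (auto simp: K_def)
      next
        case False
        then have pos: "snd z1 > 0" using z1(1) by (auto simp: Q_def K_def)
        \<comment> \<open>At the level of \<open>z1\<close> itself the bound on the speed is a limit
          from earlier times: the vertical segment below \<open>(x', snd z1)\<close> stays in the
          trapezoid and misses \<open>Q\<close>.\<close>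
        have "continuous_on {0..snd z1} (\<lambda>s. speed (x', s))"
          by (intro continuous_intros continuous_on_compose2[OF continuous_Cp]) auto
        then have "((\<lambda>s. speed (x', s)) \<longlongrightarrow> speed (x', snd z1)) (at_left (snd z1))"
          using pos unfolding continuous_on_def by (metis at_within_Icc_at_left atLeastAtMost_iff less_imp_le order_refl)
        moreover have "\<forall>\<^sub>F s in at_left (snd z1). speed (x', s) \<le> \<kappa>"
        proof -
          have "speed (x', s) \<le> \<kappa>" if s: "0 < s" "s < snd z1" for s
          proof -
            have "\<kappa> * s \<le> \<kappa> * snd z1" using s \<kappa>0 by simp
            then have "(x', s) \<in> K t" using z zx s z1(1) by (auto simp: K_def Q_def)
            moreover have "(x', s) \<notin> Q" using z1(2)[of "(x', s)"] s by auto
            ultimately show ?thesis by (auto simp: Q_def)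
          qed
          then show ?thesis unfolding eventually_at_left[OF pos] using pos by blast
        qed
        ultimately show ?thesis unfolding zx by (rule tendsto_upperbound) auto
      qed
    qed
    then have "p z1 = p (a, 0)"
      using const[of "snd z1" z1] z1(1) by (auto simp: Q_def K_def)
    then show False using z1(1) \<kappa> by (auto simp: Q_def)
  qed
  have "speed z \<le> \<kappa>" if "z \<in> K t" for z
  proof (rule ccontr)
    assume "\<not> ?thesis"
    then have "z \<in> Q" using that by (simp add: Q_def)
    with \<open>Q = {}\<close> show False by simp
  qed
  moreover have "(x, t) \<in> K t" using t x by (simp add: K_def y_def)
  ultimately have "p (x, t) = p (a, 0) \<and> u (x, t) = u (a, 0)" by (rule const)
  then show "p (x, t) = p (a, 0)" "u (x, t) = u (a, 0)" by simp_all
qed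

text \<open>This invariant is carried by forward characteristics. Traced back in time they move
  left, away from \<open>x = a\<close>, and end on the initial line or in the undisturbed cone;
  nothing that comes out of \<open>[a, b]\<close> can alter it.\<close>

lemma outer_riemann:
  assumes x: "x \<le> a" and t: "t \<ge> 0"
  shows "riemann 1 (x, t) = riemann 1 (a, 0)"
proof -
  define \<kappa> where "\<kappa> = speed (a, 0) + 1"
  \<comment> \<open>Chosen so that the left edge of the rectangle lies in the undisturbed cone
    throughout the time interval.\<close>
  define L where "L = min x (a - \<kappa> * t)"
  have \<kappa>: "\<kappa> > speed (a, 0)" "\<kappa> > 0" using speed_pos[of "(a, 0)"] by (auto simp: \<kappa>_def)
  show ?thesis
  proof (rule riemann_transport[of "{L..a} \<times> {0..t}"])
    fix x' t' assume xt: "(x', t') \<in> {L..a} \<times> {0..t}"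
    show "riemann 1 (x', t') = riemann 1 (a, 0) \<or>
        (\<exists>\<delta>>0. \<forall>s. 0 \<le> s \<and> s < \<delta> \<longrightarrow> (x' - 1 * speed (x', t') * s, t' - s) \<in> {L..a} \<times> {0..t})"
    proof (cases "t' = 0 \<or> x' = L")
      case True
      then have "x' \<le> a - \<kappa> * t'"
      proof
        assume "x' = L"
        moreover have "\<kappa> * t' \<le> \<kappa> * t" using xt \<kappa> by simp
        ultimately show ?thesis by (simp add: L_def)
      qed (use xt in auto)
      then show ?thesis using outer_cone[OF \<kappa>(1), of t' x'] xt by (auto simp: riemann_def)
    next
      case False
      then have pos: "t' > 0" "x' > L" using xt by auto
      let ?c = "speed (x', t')"
      have c: "?c > 0" using speed_pos[of "(x', t')"] xt by auto
      define \<delta> where "\<delta> = min t' ((x' - L) / ?c)"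
      have "\<delta> > 0" using pos c by (simp add: \<delta>_def)
      moreover have "(x' - 1 * ?c * s, t' - s) \<in> {L..a} \<times> {0..t}" if s: "0 \<le> s" "s < \<delta>" for s
      proof -
        have "?c * s \<ge> 0" using s c by simp
        moreover have "?c * s \<le> x' - L" using s c by (auto simp: \<delta>_def field_simps)
        ultimately show ?thesis using s xt by (auto simp: \<delta>_def)
      qed
      ultimately show ?thesis by blast
    qed
  qed (use x t in \<open>auto simp: L_def intro: compact_Times\<close>)
qed

lemma outer_pt:
  assumes x: "x \<le> a" and t: "t \<ge> 0"
  shows "pt (x, t) = - speed (x, t) * ut (x, t)"
proof -
  define B where "B = ut (x, t) + pt (x, t) / speed (x, t)"
  have 1: "((\<lambda>s. riemann 1 (x, s)) has_real_derivative (- 1 / speed (x, t) * B) * 0 + B * 1) (at t within {0..})"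
    by (rule has_real_derivative_along_path[where S = future])
      (use riemann_deriv[of 1 x t] x t in \<open>auto simp: B_def\<close>)
  have 2: "((\<lambda>s. riemann 1 (x, s)) has_real_derivative 0) (at t within {0..})"
    by (rule has_real_derivative_cong_on[of "\<lambda>_. riemann 1 (a, 0)"]) (use t in \<open>auto intro!: outer_riemann[OF x, symmetric]\<close>)
  have "B = 0" using DERIV_unique_Ici[OF 1 2 t] by simp
  then have "pt (x, t) / speed (x, t) = - ut (x, t)" by (simp add: B_def)
  moreover have "speed (x, t) > 0" using t by (intro speed_pos) auto
  ultimately show ?thesis by (simp only: divide_eq_eq) (auto simp: mult.commute)
qed

text \<open>One Riemann invariant being constant, backward characteristics are straight. The line
  with the slope frozen at \<open>(x0, t0)\<close> stands in for the characteristic: along it the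
  derivative of \<open>p\<close> is bounded by a multiple of the deviation of \<open>p\<close> from
  its initial value, so \<open>linear_ode_zero\<close> keeps the deviation zero.\<close>

lemma outer_line:
  assumes x: "x0 \<le> a" and t: "0 \<le> t0" "t0 \<le> t"
  shows "p (x0 - speed (x0, t0) * (t - t0), t) = p (x0, t0)"
proof -
  let ?c = "speed (x0, t0)"
  have c: "?c > 0" using speed_pos t by auto
  define z where "z s = (x0 - ?c * (s - t0), s)" for s
  have zf: "z s \<in> future" "fst (z s) \<le> a" if "s \<ge> t0" for s
  proof -
    have "?c * (s - t0) \<ge> 0" using that c by (intro mult_nonneg_nonneg[of ?c "s - t0"]) linarith+
    then show "fst (z s) \<le> a" using x unfolding z_def fst_conv by linarith
  qed (use that t in \<open>auto simp: z_def\<close>)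
  define K where "K = z ` {t0..t}"
  have "continuous_on {t0..t} z" unfolding z_def by (intro continuous_intros)
  then have K: "compact K" "K \<subseteq> future"
    using zf(1) unfolding K_def by (blast intro: compact_continuous_image compact_Icc, intro image_subsetI, simp)
  obtain L where L: "\<And>z z'. z \<in> K \<Longrightarrow> z' \<in> K \<Longrightarrow> \<bar>C (p z) - C (p z')\<bar> \<le> L * \<bar>p z - p z'\<bar>"
    using Cp_lipschitz[OF K] by blast
  obtain U where U: "U > 0" "\<And>z. z \<in> K \<Longrightarrow> \<bar>ut z\<bar> \<le> U"
    using compact_continuous_bound[OF K(1) continuous_on_subset[OF continuous_fields(4) K(2)]] by blast
  define f where "f s = p (z s) - p (x0, t0)" for s
  have "f t = 0"
  proof (rule linear_ode_zero[OF t(2)])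
    show "f t0 = 0" by (simp add: f_def z_def)
    fix s assume s: "s \<in> {t0..t}"
    show "(f has_real_derivative (- ut (z s) * (- ?c) + pt (z s) * 1)) (at s within {t0..t})"
      unfolding f_def z_def
      by (rule DERIV_diff[where E = 0, simplified], rule has_real_derivative_along_path[where S = future])
        (use dp zf s t in \<open>auto intro!: derivative_eq_intros simp: z_def\<close>)
    have zs: "z s \<in> K" "z t0 \<in> K" using s by (auto simp: K_def)
    have "pt (z s) = - speed (z s) * ut (z s)"
      using outer_pt[of "fst (z s)" "snd (z s)"] zf[of s] s t by (auto simp: z_def)
    then have "- ut (z s) * (- ?c) + pt (z s) * 1 = ut (z s) * \<sigma> a * (C (p (z t0)) - C (p (z s)))"
      by (simp add: z_def algebra_simps)
    then have "\<bar>- ut (z s) * (- ?c) + pt (z s) * 1\<bar> = \<bar>ut (z s)\<bar> * (\<sigma> a * \<bar>C (p (z t0)) - C (p (z s))\<bar>)"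
      using \<sigma>_pos(1)[of a] by (simp add: abs_mult)
    also have "\<dots> \<le> U * (\<sigma> a * (L * \<bar>p (z t0) - p (z s)\<bar>))"
      using U(1) U(2)[OF zs(1)] L[OF zs(2,1)] \<sigma>_pos(1)[of a] by (intro mult_mono) auto
    also have "\<dots> = (U * \<sigma> a * L) * \<bar>f s\<bar>" by (simp add: f_def z_def abs_minus_commute)
    finally show "\<bar>- ut (z s) * (- ?c) + pt (z s) * 1\<bar> \<le> (U * \<sigma> a * L) * \<bar>f s\<bar>" .
  qed
  then show ?thesis by (simp add: f_def z_def)
qed

text \<open>Otherwise two straight backward characteristics, which carry different pressures, would meet.\<close>

lemma outer_mono:
  assumes "x1 \<le> x2" "x2 \<le> a" "t \<ge> 0"
  shows "p (x2, t) \<le> p (x1, t)"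
proof (rule ccontr)
  assume "\<not> ?thesis"
  then have less: "p (x1, t) < p (x2, t)" by simp
  then have "x1 \<noteq> x2" by blast
  then have "x1 < x2" using assms(1) by simp
  have pp: "p (x1, t) > 0" "p (x2, t) > 0" using p_pos[of "(x1, t)"] p_pos[of "(x2, t)"] assms(3) by simp_all
  define c1 c2 where "c1 = speed (x1, t)" and "c2 = speed (x2, t)"
  have c: "c1 < c2" using C_strict[OF pp(1) less] \<sigma>_pos(1)[of a] by (simp add: c1_def c2_def)
  \<comment> \<open>Time after which the faster line, which starts on the right, catches up with the
    other one.\<close>
  define s where "s = (x2 - x1) / (c2 - c1)"
  have s: "s > 0" using c \<open>x1 < x2\<close> by (simp add: s_def)
  have "s * (c2 - c1) = x2 - x1" using c by (simp add: s_def)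
  then have "x1 - c1 * s = x2 - c2 * s" by (simp add: algebra_simps)
  moreover have "p (x1 - c1 * s, t + s) = p (x1, t)" "p (x2 - c2 * s, t + s) = p (x2, t)"
    using outer_line[of x1 t "t + s"] outer_line[of x2 t "t + s"] assms s by (auto simp: c1_def c2_def)
  ultimately show False using less by simp
qed

text \<open>The slope of \<open>p\<close> in \<open>x\<close> is \<open>- ut\<close>, so the
  monotone pressure of the outgoing wave becomes a sign for \<open>ut\<close>. This is all that the
  analysis of \<open>[a, b]\<close> takes from the left exterior.\<close>

lemma left_data:
  assumes t: "t \<ge> 0"
  shows "pt (a, t) = - speed (a, t) * ut (a, t)" "ut (a, t) \<ge> 0"
proof -
  show "pt (a, t) = - speed (a, t) * ut (a, t)" using outer_pt[OF order_refl t] .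
  have "((\<lambda>x. p (x, t)) has_real_derivative - ut (a, t) * 1 + pt (a, t) * 0) (at a)"
    by (rule has_real_derivative_along_path[where S = future])
      (use dp t in \<open>auto intro!: derivative_eq_intros\<close>)
  then have d: "((\<lambda>x. p (x, t)) has_real_derivative - ut (a, t)) (at a)" by simp
  show "ut (a, t) \<ge> 0"
  proof (rule ccontr)
    assume "\<not> ?thesis"
    then obtain e where "e > 0" "\<forall>h>0. h < e \<longrightarrow> p (a - h, t) < p (a, t)"
      using DERIV_pos_inc_left[OF d] by auto
    then have "p (a - e / 2, t) < p (a, t)" by auto
    moreover have "p (a, t) \<le> p (a - e / 2, t)" using outer_mono[of "a - e / 2" a t] t \<open>e > 0\<close> by auto
    ultimately show False by simp
  qed
qed

end

section \<open>Characteristics\<close>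

text \<open>Here \<open>X\<close> is the inverse of \<open>f\<close> along \<open>\<eta>\<close>,
  and the two difference quotients are divided. One-sided neighbourhoods are kept because the
  coordinate change \<open>stretch\<close> has different left and right derivatives at a jump of
  \<open>\<sigma>\<close>.\<close>

lemma has_real_derivative_inverse_along:
  fixes f X \<eta> :: "real \<Rightarrow> real"
  assumes f: "(f has_real_derivative 1 / q) (at (X t) within A)" and "q > 0"
    and \<eta>: "(\<eta> has_real_derivative g) (at t within B)"
    and X: "filterlim X (at (X t) within A) (at t within B)"
    and eq: "f (X t) = \<eta> t" "\<And>s. s \<in> B \<Longrightarrow> s \<noteq> t \<Longrightarrow> f (X s) = \<eta> s \<and> \<eta> s \<noteq> \<eta> t"
  shows "(X has_real_derivative g * q) (at t within B)"
proof -
  have "((\<lambda>x. (f x - f (X t)) / (x - X t)) \<longlongrightarrow> 1 / q) (at (X t) within A)"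
    using f by (simp add: has_field_derivative_iff)
  from filterlim_compose[OF this X]
  have 1: "((\<lambda>s. (f (X s) - f (X t)) / (X s - X t)) \<longlongrightarrow> 1 / q) (at t within B)" .
  have 2: "((\<lambda>s. (\<eta> s - \<eta> t) / (s - t)) \<longlongrightarrow> g) (at t within B)"
    using \<eta> by (simp add: has_field_derivative_iff)
  have "((\<lambda>s. ((\<eta> s - \<eta> t) / (s - t)) / ((f (X s) - f (X t)) / (X s - X t))) \<longlongrightarrow> g / (1 / q)) (at t within B)"
    by (rule tendsto_divide[OF 2 1]) (use \<open>q > 0\<close> in auto)
  moreover have "\<forall>\<^sub>F s in at t within B.
      ((\<eta> s - \<eta> t) / (s - t)) / ((f (X s) - f (X t)) / (X s - X t)) = (X s - X t) / (s - t)"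
    unfolding eventually_at_filter
    by (rule always_eventually) (use eq in auto)
  ultimately have "((\<lambda>s. (X s - X t) / (s - t)) \<longlongrightarrow> g / (1 / q)) (at t within B)"
    by (rule Lim_transform_eventually)
  then show ?thesis by (simp add: has_field_derivative_iff)
qed

section \<open>Stretched space coordinate and the characteristics that cross
  \<open>[a, b]\<close>\<close>

context flow
begin

text \<open>The reciprocal of a positive monotone function is integrable, so the jumps of
  \<open>\<sigma>\<close> cost only the two-sided differentiability of \<open>stretch\<close>; its
  inverse remains Lipschitz.\<close>

definition stretch :: "real \<Rightarrow> real" where
  "stretch x = integral {a..x} (\<lambda>x. 1 / \<sigma> x)"

abbreviation "\<sigma>min \<equiv> min (\<sigma> a) (\<sigma> b)"
abbreviation "\<sigma>max \<equiv> max (\<sigma> a) (\<sigma> b)"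

lemma \<sigma>_bounds: "\<sigma>min \<le> \<sigma> x" "\<sigma> x \<le> \<sigma>max" if "x \<in> {a..b}"
  using \<sigma>_mono that by (auto simp: monotone_on_def min_le_iff_disj le_max_iff_disj)

lemma \<sigma>min_pos: "\<sigma>min > 0" and \<sigma>max_pos: "\<sigma>max > 0"
  using \<sigma>_pos(1)[of a] \<sigma>_pos(1)[of b] by (auto simp: less_max_iff_disj)

lemma integrable_inverse_\<sigma>: "(\<lambda>x. 1 / \<sigma> x) integrable_on {c..d}"
  using \<sigma>_mono
proof
  assume "antimono \<sigma>"
  then have "mono_on {c..d} (\<lambda>x. 1 / \<sigma> x)"
    using \<sigma>_pos(1) by (auto simp: monotone_on_def intro!: frac_le)
  then show ?thesis by (rule integrable_on_mono_on)
next
  assume "mono \<sigma>"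
  then have "mono_on {c..d} (\<lambda>x. - (1 / \<sigma> x))"
    using \<sigma>_pos(1) by (auto simp: monotone_on_def intro!: frac_le)
  then have "(\<lambda>x. - (1 / \<sigma> x)) integrable_on {c..d}" by (rule integrable_on_mono_on)
  then show ?thesis by (simp only: integrable_neg_iff)
qed

lemma stretch_diff:
  assumes "a \<le> x" "x \<le> y"
  shows "stretch y - stretch x = integral {x..y} (\<lambda>x. 1 / \<sigma> x)"
  using Henstock_Kurzweil_Integration.integral_combine[OF assms integrable_inverse_\<sigma>] by (simp add: stretch_def)

lemma stretch_diff_bounds:
  assumes "a \<le> x" "x \<le> y" "y \<le> b"
  shows "(y - x) / \<sigma>max \<le> stretch y - stretch x"
proof -
  have "integral {x..y} (\<lambda>_. 1 / \<sigma>max) \<le> integral {x..y} (\<lambda>x. 1 / \<sigma> x)"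
    by (rule integral_le)
      (use assms integrable_inverse_\<sigma> \<sigma>_bounds(2) \<sigma>_pos(1) in \<open>auto intro!: divide_left_mono mult_pos_pos \<sigma>max_pos\<close>)
  then show ?thesis using stretch_diff[OF assms(1,2)] assms(2) by simp
qed

lemma stretch_strict: "a \<le> x \<Longrightarrow> x < y \<Longrightarrow> y \<le> b \<Longrightarrow> stretch x < stretch y"
  using stretch_diff_bounds[of x y] \<sigma>max_pos divide_pos_pos[of "y - x" \<sigma>max] by linarith

lemma stretch_a: "stretch a = 0"
  by (simp add: stretch_def)

lemma stretch_cont: "continuous_on {a..b} stretch"
  unfolding stretch_def by (rule indefinite_integral_continuous_1[OF integrable_inverse_\<sigma>])

lemma stretch_left_deriv:
  assumes "a < x" "x \<le> b"
  shows "(stretch has_real_derivative 1 / sl x) (at x within {a..x})"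
proof -
  \<comment> \<open>Changing the integrand at the single point \<open>x\<close> to its left limit
    preserves the integral and makes the integrand left-continuous there.\<close>
  define g where "g y = (if y = x then 1 / sl x else 1 / \<sigma> y)" for y
  have g: "integral {a..y} g = stretch y" for y
    unfolding stretch_def by (rule integral_spike[of "{x}"]) (auto simp: g_def)
  have int: "g integrable_on {a..x}"
    by (rule integrable_spike[OF integrable_inverse_\<sigma>, of "{x}"]) (auto simp: g_def)
  have "((\<lambda>y. 1 / \<sigma> y) \<longlongrightarrow> 1 / sl x) (at_left x)"
    using sl \<sigma>_pos(2)[of x] by (intro tendsto_intros) auto
  then have "(g \<longlongrightarrow> 1 / sl x) (at_left x)"
    by (rule Lim_transform_eventually) (auto simp: g_def eventually_at_filter)
  moreover have "g x = 1 / sl x" by (simp add: g_def)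
  ultimately have "continuous (at x within {a..x}) g"
    using assms by (simp add: continuous_within at_within_Icc_at_left)
  with int have "((\<lambda>u. integral {a..u} g) has_vector_derivative g x) (at x within {a..x} - {})"
    using assms by (intro integral_has_vector_derivative_continuous_at) auto
  moreover have "(\<lambda>u. integral {a..u} g) = stretch" using g by auto
  ultimately show ?thesis
    by (simp add: has_real_derivative_iff_has_vector_derivative g_def)
qed

lemma stretch_right_deriv:
  assumes "a \<le> x" "x < b"
  shows "(stretch has_real_derivative 1 / sr x) (at x within {x..b})"
proof -
  define g where "g y = (if y = x then 1 / sr x else 1 / \<sigma> y)" for y
  have g: "stretch x + integral {x..y} g = stretch y" if "y \<in> {x..b}" for y
  proof -
    have "integral {x..y} g = integral {x..y} (\<lambda>x. 1 / \<sigma> x)"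
      by (rule integral_spike[of "{x}"]) (auto simp: g_def)
    then show ?thesis using stretch_diff[of x y] that assms by auto
  qed
  have int: "g integrable_on {x..b}"
    by (rule integrable_spike[OF integrable_inverse_\<sigma>, of "{x}"]) (auto simp: g_def)
  have "((\<lambda>y. 1 / \<sigma> y) \<longlongrightarrow> 1 / sr x) (at_right x)"
    using sr \<sigma>_pos(3)[of x] by (intro tendsto_intros) auto
  then have "(g \<longlongrightarrow> 1 / sr x) (at_right x)"
    by (rule Lim_transform_eventually) (auto simp: g_def eventually_at_filter)
  moreover have "g x = 1 / sr x" by (simp add: g_def)
  ultimately have "continuous (at x within {x..b}) g"
    using assms by (simp add: continuous_within at_within_Icc_at_right)
  with int have "((\<lambda>u. integral {x..u} g) has_vector_derivative g x) (at x within {x..b} - {})"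
    using assms by (intro integral_has_vector_derivative_continuous_at) auto
  then have "((\<lambda>u. integral {x..u} g) has_real_derivative 1 / sr x) (at x within {x..b})"
    by (simp add: has_real_derivative_iff_has_vector_derivative g_def)
  then have "((\<lambda>u. stretch x + integral {x..u} g) has_real_derivative 1 / sr x) (at x within {x..b})"
    by (auto intro!: derivative_eq_intros)
  then show ?thesis
    by (rule has_real_derivative_cong_on) (use g assms in auto)
qed

definition unstretch :: "real \<Rightarrow> real" where
  "unstretch y = (THE x. x \<in> {a..b} \<and> stretch x = y)"

lemma stretch_inj: "x \<in> {a..b} \<Longrightarrow> y \<in> {a..b} \<Longrightarrow> stretch x = stretch y \<Longrightarrow> x = y"
  using stretch_strict[of x y] stretch_strict[of y x] by (cases x y rule: linorder_cases) auto

lemma unstretch: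
  assumes "0 \<le> y" "y \<le> stretch b"
  shows "unstretch y \<in> {a..b}" "stretch (unstretch y) = y"
proof -
  obtain x where x: "x \<in> {a..b}" "stretch x = y"
    using IVT'[of stretch a y b] assms ab stretch_cont by (auto simp: stretch_a)
  have "unstretch y = x"
    unfolding unstretch_def
  proof (rule the_equality)
    show "x' = x" if "x' \<in> {a..b} \<and> stretch x' = y" for x'
      by (rule stretch_inj) (use x that in simp_all)
  qed (use x in simp)
  then show "unstretch y \<in> {a..b}" "stretch (unstretch y) = y" using x by simp_all
qed

lemma unstretch_stretch: "x \<in> {a..b} \<Longrightarrow> unstretch (stretch x) = x"
  unfolding unstretch_def by (rule the_equality) (blast intro: stretch_inj)+

lemma unstretch_lipschitz:
  assumes "0 \<le> y" "y \<le> stretch b" "0 \<le> z" "z \<le> stretch b"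
  shows "\<bar>unstretch y - unstretch z\<bar> \<le> \<sigma>max * \<bar>y - z\<bar>"
proof -
  have *: "\<bar>unstretch y - unstretch z\<bar> \<le> \<sigma>max * \<bar>y - z\<bar>"
    if "0 \<le> y" "y \<le> stretch b" "0 \<le> z" "z \<le> stretch b" "unstretch y \<le> unstretch z" for y z
  proof -
    have "(unstretch z - unstretch y) / \<sigma>max \<le> z - y"
      using stretch_diff_bounds[of "unstretch y" "unstretch z"] unstretch[OF that(1,2)] unstretch[OF that(3,4)] that(5)
      by auto
    then have "unstretch z - unstretch y \<le> \<sigma>max * (z - y)"
      using \<sigma>max_pos by (simp add: pos_divide_le_eq mult.commute)
    also have "\<dots> \<le> \<sigma>max * \<bar>y - z\<bar>" using \<sigma>max_pos by (intro mult_left_mono) auto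
    finally show ?thesis using that(5) by simp
  qed
  show ?thesis using *[of y z] *[of z y] assms by (cases "unstretch y \<le> unstretch z") (auto simp: abs_minus_commute)
qed

lemma p_lipschitz_x: "\<exists>U>0. \<forall>t\<in>{t0..N}. \<forall>x\<in>{a..b}. \<forall>y\<in>{a..b}. \<bar>p (x, t) - p (y, t)\<bar> \<le> U * \<bar>x - y\<bar>" if "t0 \<ge> 0"
proof -
  have K: "compact ({a..b} \<times> {t0..N})" "{a..b} \<times> {t0..N} \<subseteq> future"
    using that by (auto intro: compact_Times)
  obtain U where U: "U > 0" "\<And>z. z \<in> {a..b} \<times> {t0..N} \<Longrightarrow> \<bar>ut z\<bar> \<le> U"
    using compact_continuous_bound[OF K(1) continuous_on_subset[OF continuous_fields(4) K(2)]] by blast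
  have "norm (p (x, t) - p (y, t)) \<le> U * norm (x - y)" if t: "t \<in> {t0..N}" and xy: "x \<in> {a..b}" "y \<in> {a..b}" for t x y
  proof (rule field_differentiable_bound[of "{a..b}" "\<lambda>x. p (x, t)" "\<lambda>x. - ut (x, t)"])
    fix z assume "z \<in> {a..b}"
    have "((\<lambda>x. p (x, t)) has_real_derivative - ut (z, t) * 1 + pt (z, t) * 0) (at z within {a..b})"
      by (rule has_real_derivative_along_path[where S = future])
        (use dp t \<open>t0 \<ge> 0\<close> in \<open>auto intro!: derivative_eq_intros\<close>)
    then show "((\<lambda>x. p (x, t)) has_real_derivative - ut (z, t)) (at z within {a..b})" by simp
    show "norm (- ut (z, t)) \<le> U" using U(2)[of "(z, t)"] t \<open>z \<in> {a..b}\<close> by simp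
  qed (use xy in auto)
  then show ?thesis using U(1) by auto
qed

text \<open>In the variable \<open>stretch x\<close> the speed of a forward characteristic is \<open>C p\<close>, which has no
  jumps.\<close>

lemma forward_flow:
  assumes t0: "t0 \<ge> 0"
  obtains \<eta> where "\<eta> t0 = 0" "continuous_on {t0..} \<eta>" "\<And>s t. t0 \<le> s \<Longrightarrow> s < t \<Longrightarrow> \<eta> s < \<eta> t"
    "\<And>t. t \<ge> t0 \<Longrightarrow> \<eta> t \<le> stretch b \<Longrightarrow> (\<eta> has_real_derivative C (p (unstretch (\<eta> t), t))) (at t within {t0..})"
proof -
  \<comment> \<open>Clamping to the range of \<open>stretch\<close> gives an equation for all
    \<open>y\<close> with a Lipschitz right-hand side, hence a global solution. Past
    \<open>stretch b\<close> that solution is artificial, so the derivative formula is claimed only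
    up to there.\<close>
  define cl where "cl y = max 0 (min y (stretch b))" for y
  have Y: "stretch b > 0" using stretch_strict[of a b] ab by (simp add: stretch_a)
  have cl: "0 \<le> cl y" "cl y \<le> stretch b" "\<bar>cl y - cl z\<bar> \<le> \<bar>y - z\<bar>" for y z
    using Y by (auto simp: cl_def)
  define X where "X y = unstretch (cl y)" for y
  have X: "X y \<in> {a..b}" for y unfolding X_def by (rule unstretch[OF cl(1,2)])
  have Xlip: "\<bar>X y - X z\<bar> \<le> \<sigma>max * \<bar>y - z\<bar>" for y z
  proof -
    have "\<bar>X y - X z\<bar> \<le> \<sigma>max * \<bar>cl y - cl z\<bar>" unfolding X_def by (rule unstretch_lipschitz[OF cl(1,2) cl(1,2)])
    also have "\<dots> \<le> \<sigma>max * \<bar>y - z\<bar>" using \<sigma>max_pos cl(3) by (intro mult_left_mono) auto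
    finally show ?thesis .
  qed
  have "\<sigma>max-lipschitz_on UNIV X"
    using Xlip \<sigma>max_pos by (auto simp: lipschitz_on_def dist_real_def)
  then have Xcont: "continuous_on UNIV X" by (rule lipschitz_on_continuous_on)
  have pos: "C (p (x, t)) > 0" if "t \<ge> t0" for x t
    using that t0 by (intro C_pos p_pos) auto
  obtain \<eta> where \<eta>: "\<eta> t0 = 0" "\<And>t. t \<ge> t0 \<Longrightarrow> (\<eta> has_real_derivative C (p (X (\<eta> t), t))) (at t within {t0..})"
  proof (rule picard_lindelof_Ici[of t0 "\<lambda>y t. C (p (X y, t))" 0])
    have "continuous_on (UNIV \<times> {t0..}) (\<lambda>z. C (p (X (fst z), snd z)))"
      by (rule continuous_on_compose2[OF continuous_Cp])
        (use t0 in \<open>auto intro!: continuous_intros continuous_on_compose2[OF Xcont]\<close>)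
    then show "continuous_on (UNIV \<times> {t0..}) (\<lambda>(y, t). C (p (X y, t)))" by (simp add: split_def)
  next
    fix N
    obtain U where U: "U > 0" "\<And>t x y. t \<in> {t0..N} \<Longrightarrow> x \<in> {a..b} \<Longrightarrow> y \<in> {a..b} \<Longrightarrow> \<bar>p (x, t) - p (y, t)\<bar> \<le> U * \<bar>x - y\<bar>"
      using p_lipschitz_x[OF t0] by blast
    have K: "compact ({a..b} \<times> {t0..N})" "{a..b} \<times> {t0..N} \<subseteq> future"
      using t0 by (auto intro: compact_Times)
    obtain L where L: "L > 0" "\<And>z z'. z \<in> {a..b} \<times> {t0..N} \<Longrightarrow> z' \<in> {a..b} \<times> {t0..N} \<Longrightarrow> \<bar>C (p z) - C (p z')\<bar> \<le> L * \<bar>p z - p z'\<bar>"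
      using Cp_lipschitz[OF K] by blast
    show "\<exists>L>0. \<forall>t\<in>{t0..N}. \<forall>y z. \<bar>C (p (X y, t)) - C (p (X z, t))\<bar> \<le> L * \<bar>y - z\<bar>"
    proof (intro exI[of _ "L * (U * \<sigma>max)"] conjI ballI allI)
      show "L * (U * \<sigma>max) > 0" using L(1) U(1) \<sigma>max_pos by (intro mult_pos_pos)
      fix t y z assume t: "t \<in> {t0..N}"
      have "\<bar>C (p (X y, t)) - C (p (X z, t))\<bar> \<le> L * \<bar>p (X y, t) - p (X z, t)\<bar>"
        using X t by (intro L(2)) auto
      also have "\<dots> \<le> L * (U * \<bar>X y - X z\<bar>)" using L(1) U(2)[OF t X X] by (intro mult_left_mono) auto
      also have "\<dots> \<le> L * (U * (\<sigma>max * \<bar>y - z\<bar>))" using L(1) U(1) Xlip by (intro mult_left_mono) auto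
      finally show "\<bar>C (p (X y, t)) - C (p (X z, t))\<bar> \<le> L * (U * \<sigma>max) * \<bar>y - z\<bar>" by (simp add: mult.assoc)
    qed
  qed blast
  have cont: "continuous_on {t0..} \<eta>"
    by (rule DERIV_continuous_on) (use \<eta>(2) in auto)
  have strict: "\<eta> s < \<eta> t" if "t0 \<le> s" "s < t" for s t
  proof (rule DERIV_pos_imp_increasing_open[OF that(2)])
    show "continuous_on {s..t} \<eta>" by (rule continuous_on_subset[OF cont]) (use that in auto)
    fix r assume r: "s < r" "r < t"
    then have "at r within {t0..} = at r" using that by (intro at_within_interior) auto
    then show "\<exists>d. (\<eta> has_real_derivative d) (at r) \<and> d > 0"
      using \<eta>(2)[of r] pos[of r] r that by (intro exI[of _ "C (p (X (\<eta> r), r))"]) auto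
  qed
  show thesis
  proof (rule that[OF \<eta>(1) cont strict])
    fix t assume t: "t \<ge> t0" "\<eta> t \<le> stretch b"
    then have "\<eta> t \<ge> 0" using strict[of t0 t] \<eta>(1) by (cases "t = t0") auto
    with t have "cl (\<eta> t) = \<eta> t" by (simp add: cl_def)
    then show "(\<eta> has_real_derivative C (p (unstretch (\<eta> t), t))) (at t within {t0..})"
      using \<eta>(2)[OF t(1)] by (simp add: X_def)
  qed
qed

text \<open>The forward characteristic from \<open>(a, t0)\<close> either reaches \<open>b\<close>
  in finite time or is increasing and bounded, hence convergent: a vertical asymptote. Left and
  right derivatives are stated separately because they differ where a jump of
  \<open>\<sigma>\<close> is crossed.\<close>

lemma forward_characteristic:
  assumes t0: "t0 \<ge> 0"
  shows "asymptotic_characteristic C p \<sigma> \<or> (\<exists>X T. T > t0 \<and> X t0 = a \<and> X T = b \<and> continuous_on {t0..T} X \<and>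
    (\<forall>s t. t0 \<le> s \<longrightarrow> s < t \<longrightarrow> t \<le> T \<longrightarrow> X s < X t) \<and>
    (\<forall>t. t0 < t \<longrightarrow> t \<le> T \<longrightarrow> (X has_real_derivative C (p (X t, t)) * sl (X t)) (at t within {t0..t})) \<and>
    (\<forall>t. t0 \<le> t \<longrightarrow> t < T \<longrightarrow> (X has_real_derivative C (p (X t, t)) * sr (X t)) (at t within {t..T})))"
proof -
  obtain \<eta> where \<eta>: "\<eta> t0 = 0" "continuous_on {t0..} \<eta>" "\<And>s t. t0 \<le> s \<Longrightarrow> s < t \<Longrightarrow> \<eta> s < \<eta> t"
    "\<And>t. t \<ge> t0 \<Longrightarrow> \<eta> t \<le> stretch b \<Longrightarrow> (\<eta> has_real_derivative C (p (unstretch (\<eta> t), t))) (at t within {t0..})"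
    using forward_flow[OF t0] by blast
  define X where "X t = unstretch (\<eta> t)" for t
  have nn: "\<eta> t \<ge> 0" if "t \<ge> t0" for t using \<eta>(3)[of t0 t] \<eta>(1) that by (cases "t = t0") auto
  have X: "X t \<in> {a..b}" "stretch (X t) = \<eta> t" if "t \<ge> t0" "\<eta> t \<le> stretch b" for t
    unfolding X_def using unstretch[OF nn[OF that(1)] that(2)] by auto
  have contX: "continuous_on I X" if I: "I \<subseteq> {t0..}" "\<And>t. t \<in> I \<Longrightarrow> \<eta> t \<le> stretch b" for I
  proof -
    have "\<sigma>max-lipschitz_on {0..stretch b} unstretch"
      using unstretch_lipschitz \<sigma>max_pos by (auto simp: lipschitz_on_def dist_real_def)
    then have "continuous_on {0..stretch b} unstretch" by (rule lipschitz_on_continuous_on)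
    then show ?thesis unfolding X_def
      by (rule continuous_on_compose2[OF _ continuous_on_subset[OF \<eta>(2) I(1)]]) (use I nn in auto)
  qed
  have Xstrict: "X s < X t" if "t0 \<le> s" "s < t" "\<eta> t \<le> stretch b" for s t
  proof (rule ccontr)
    assume "\<not> X s < X t"
    have s: "\<eta> s \<le> stretch b" using \<eta>(3)[OF that(1,2)] that(3) by simp
    have "stretch (X t) \<le> stretch (X s)"
      using stretch_strict[of "X t" "X s"] X(1)[of t] X(1)[of s] that s \<open>\<not> X s < X t\<close>
      by (cases "X t = X s") auto
    then show False using X(2)[of t] X(2)[of s] s that \<eta>(3)[OF that(1,2)] by auto
  qed
  have left: "(X has_real_derivative C (p (X t, t)) * sl (X t)) (at t within {t0..t})"
    if t: "t0 < t" "\<eta> t \<le> stretch b" for t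
  proof (rule has_real_derivative_inverse_along)
    have le: "\<eta> s \<le> stretch b" if "t0 \<le> s" "s \<le> t" for s
      using \<eta>(3)[of s t] that t by (cases "s = t") auto
    have "a < X t"
      using Xstrict[of t0 t] t X(1)[of t0] le by force
    then show "(stretch has_real_derivative 1 / sl (X t)) (at (X t) within {a..X t})"
      using X(1)[of t] t by (intro stretch_left_deriv) auto
    show "(\<eta> has_real_derivative C (p (X t, t))) (at t within {t0..t})"
      unfolding X_def by (rule has_field_derivative_subset[OF \<eta>(4)]) (use t in auto)
    have "continuous_on {t0..t} X" by (rule contX) (use le in auto)
    then have "(X \<longlongrightarrow> X t) (at t within {t0..t})" using t by (auto simp: continuous_on_def)
    moreover have "\<forall>\<^sub>F s in at t within {t0..t}. X s \<in> {a..X t} \<and> X s \<noteq> X t"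
      unfolding eventually_at_filter
    proof (rule always_eventually, intro allI impI)
      fix s assume "s \<noteq> t" "s \<in> {t0..t}"
      then show "X s \<in> {a..X t} \<and> X s \<noteq> X t"
        using Xstrict[of s t] t X(1)[of s] le[of s] by auto
    qed
    ultimately show "filterlim X (at (X t) within {a..X t}) (at t within {t0..t})"
      by (simp add: filterlim_at)
    show "stretch (X t) = \<eta> t" using X t by auto
    show "stretch (X s) = \<eta> s \<and> \<eta> s \<noteq> \<eta> t" if "s \<in> {t0..t}" "s \<noteq> t" for s
      using X(2)[of s] le[of s] \<eta>(3)[of s t] that by auto
  qed (use \<sigma>_pos in auto)
  have right: "(X has_real_derivative C (p (X t, t)) * sr (X t)) (at t within {t..T})"
    if t: "t0 \<le> t" "t < T" "\<eta> T \<le> stretch b" for t T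
  proof (rule has_real_derivative_inverse_along)
    have le: "\<eta> s \<le> stretch b" if "t \<le> s" "s \<le> T" for s
      using \<eta>(3)[of s T] that t by (cases "s = T") auto
    have tle: "\<eta> t \<le> stretch b" using le t by auto
    have "X t < b"
      using Xstrict[of t T] t X(1)[of T] by force
    then show "(stretch has_real_derivative 1 / sr (X t)) (at (X t) within {X t..b})"
      using X(1)[of t] t tle by (intro stretch_right_deriv) auto
    show "(\<eta> has_real_derivative C (p (X t, t))) (at t within {t..T})"
      unfolding X_def by (rule has_field_derivative_subset[OF \<eta>(4)]) (use t tle in auto)
    have "continuous_on {t..T} X" by (rule contX) (use le t in auto)
    then have "(X \<longlongrightarrow> X t) (at t within {t..T})" using t by (auto simp: continuous_on_def)
    moreover have "\<forall>\<^sub>F s in at t within {t..T}. X s \<in> {X t..b} \<and> X s \<noteq> X t"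
      unfolding eventually_at_filter
    proof (rule always_eventually, intro allI impI)
      fix s assume "s \<noteq> t" "s \<in> {t..T}"
      then show "X s \<in> {X t..b} \<and> X s \<noteq> X t"
        using Xstrict[of t s] t X(1)[of s] le[of s] by auto
    qed
    ultimately show "filterlim X (at (X t) within {X t..b}) (at t within {t..T})"
      by (simp add: filterlim_at)
    show "stretch (X t) = \<eta> t" using X t tle by auto
    show "stretch (X s) = \<eta> s \<and> \<eta> s \<noteq> \<eta> t" if "s \<in> {t..T}" "s \<noteq> t" for s
      using X(2)[of s] le[of s] \<eta>(3)[of t s] that t by auto
  qed (use \<sigma>_pos in auto)
  have X0: "X t0 = a" using unstretch_stretch[of a] ab by (simp add: X_def \<eta>(1) stretch_a)
  have Y: "stretch b > 0" using stretch_strict[of a b] ab by (simp add: stretch_a)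
  show ?thesis
  proof (cases "\<exists>T\<ge>t0. \<eta> T \<ge> stretch b")
    case True
    then obtain T1 where T1: "T1 \<ge> t0" "\<eta> T1 \<ge> stretch b" by blast
    have "continuous_on {t0..T1} \<eta>" by (rule continuous_on_subset[OF \<eta>(2)]) auto
    then obtain T where T: "t0 \<le> T" "\<eta> T = stretch b"
      using IVT'[of \<eta> t0 "stretch b" T1] T1 \<eta>(1) Y by auto
    have "T \<noteq> t0" using T Y \<eta>(1) by auto
    then have "T > t0" using T by simp
    have le: "\<eta> s \<le> stretch b" if "t0 \<le> s" "s \<le> T" for s
      using \<eta>(3)[of s T] that T by (cases "s = T") auto
    have "X T = b" using unstretch_stretch[of b] ab by (simp add: X_def T)
    moreover have "continuous_on {t0..T} X" by (rule contX) (use le in auto)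
    ultimately show ?thesis using \<open>T > t0\<close> X0 Xstrict left right le T(2)
      by (intro disjI2 exI[of _ X] exI[of _ T]) auto
  next
    case False
    then have le: "\<eta> t \<le> stretch b" if "t \<ge> t0" for t using that by (meson linear)
    have mono: "X s \<le> X t" if "t0 \<le> s" "s \<le> t" for s t
      using Xstrict[of s t] le[of t] that by (cases "s = t") auto
    \<comment> \<open>A strictly monotone curve meets each of the finitely many jump lines at most
      once, so from some time on both one-sided derivatives agree.\<close>
    have inj: "inj_on X {t0..}"
    proof (rule inj_onI)
      fix s t assume *: "s \<in> {t0..}" "t \<in> {t0..}" "X s = X t"
      show "s = t" using Xstrict[of s t] Xstrict[of t s] le[of s] le[of t] * by (cases s t rule: linorder_cases) auto
    qed
    have "finite ({t \<in> {t0..}. X t \<in> J})"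
      using finite_vimage_IntI[OF J(1) inj] by (rule rev_finite_subset) auto
    then have "bdd_above {t \<in> {t0..}. X t \<in> J}" by (rule bdd_above_finite)
    then obtain B where B: "\<And>t. t \<ge> t0 \<Longrightarrow> X t \<in> J \<Longrightarrow> t \<le> B" by (auto simp: bdd_above_def)
    define t1 where "t1 = max t0 B + 1"
    have "(X has_real_derivative C (p (X t, t)) * \<sigma> (X t)) (at t within {t1..})" if "t \<ge> t1" for t
    proof -
      have t: "t > t0" "t > B" using that by (auto simp: t1_def)
      then have "X t \<notin> J" using B[of t] by auto
      then have s: "sl (X t) = \<sigma> (X t)" "sr (X t) = \<sigma> (X t)" using J(3,4) by auto
      let ?q = "\<lambda>s. (X s - X t) / (s - t)" and ?d = "C (p (X t, t)) * \<sigma> (X t)"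
      have "(?q \<longlongrightarrow> ?d) (at_left t)"
        using left[OF t(1) le] t s by (simp add: has_field_derivative_iff at_within_Icc_at_left)
      moreover have "(?q \<longlongrightarrow> ?d) (at_right t)"
        using right[of t "t + 1"] le t s by (simp add: has_field_derivative_iff at_within_Icc_at_right)
      ultimately have "(X has_real_derivative ?d) (at t)"
        by (simp add: has_field_derivative_iff filterlim_at_split)
      then show ?thesis by (rule has_field_derivative_at_within)
    qed
    moreover have "(X \<longlongrightarrow> (SUP t\<in>{t0..}. X t)) at_top"
    proof (rule tendstoI)
      fix e :: real assume "e > 0"
      have bdd: "bdd_above (X ` {t0..})" using X(1) le by (auto simp: bdd_above_def)
      then obtain t2 where t2: "t2 \<ge> t0" "X t2 > (SUP t\<in>{t0..}. X t) - e"
        using less_cSUP_iff[of "{t0..}" X "(SUP t\<in>{t0..}. X t) - e"] \<open>e > 0\<close> by auto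
      show "\<forall>\<^sub>F t in at_top. dist (X t) (SUP t\<in>{t0..}. X t) < e"
      proof (rule eventually_mono[OF eventually_ge_at_top[of t2]])
        fix t assume t: "t2 \<le> t"
        have "X t \<le> (SUP t\<in>{t0..}. X t)" using t t2 by (intro cSUP_upper bdd) auto
        moreover have "X t2 \<le> X t" using mono t t2 by auto
        ultimately show "dist (X t) (SUP t\<in>{t0..}. X t) < e" using t2 \<open>e > 0\<close> by (simp add: dist_real_def)
      qed
    qed
    moreover have "t1 \<ge> 0" using t0 by (simp add: t1_def)
    ultimately show ?thesis unfolding asymptotic_characteristic_def
      by (intro disjI1 exI[of _ X] exI[of _ t1] exI[of _ "SUP t\<in>{t0..}. X t"] exI[of _ 1]) auto
  qed
qed

end

section \<open>Propagation of cone conditions in space\<close>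

text \<open>Supplies the left-continuous weights that \<open>cone_max_principle\<close> asks for;
  \<open>\<sigma>\<close> itself may take any intermediate value at a jump.\<close>

lemma left_limits_left_continuous:
  fixes f l :: "real \<Rightarrow> real"
  assumes "\<And>x. (f \<longlongrightarrow> l x) (at_left x)"
  shows "(l \<longlongrightarrow> l x) (at_left x)"
proof (rule tendstoI)
  fix e :: real assume "e > 0"
  then have "\<forall>\<^sub>F y in at_left x. dist (f y) (l x) < e / 2"
    using assms[of x] by (intro tendstoD) auto
  then obtain d where d: "d < x" "\<And>y. d < y \<Longrightarrow> y < x \<Longrightarrow> dist (f y) (l x) < e / 2"
    by (auto simp: eventually_at_left[of "x - 1" x])
  have "dist (l y) (l x) < e" if y: "d < y" "y < x" for y
  proof -
    have "\<forall>\<^sub>F z in at_left y. z \<in> {d<..<y}" using y by (intro eventually_at_left_real) auto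
    then have "\<forall>\<^sub>F z in at_left y. dist (f z) (l x) \<le> e / 2"
      by (rule eventually_mono) (use d(2) y in \<open>force intro: less_imp_le\<close>)
    moreover have "((\<lambda>z. dist (f z) (l x)) \<longlongrightarrow> dist (l y) (l x)) (at_left y)"
      by (intro tendsto_intros assms)
    ultimately have "dist (l y) (l x) \<le> e / 2"
      by (intro tendsto_upperbound) auto
    then show ?thesis using \<open>e > 0\<close> by simp
  qed
  then show "\<forall>\<^sub>F y in at_left x. dist (l y) (l x) < e"
    using d(1) by (auto simp: eventually_at_left[of "x - 1" x] intro!: exI[of _ d])
qed

lemma antimono_left_limits:
  fixes f l :: "real \<Rightarrow> real"
  assumes "antimono f" "\<And>x. (f \<longlongrightarrow> l x) (at_left x)"
  shows "antimono l"
proof (rule antimonoI)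
  fix x y :: real assume "x \<le> y"
  show "l y \<le> l x"
  proof (cases "x = y")
    case False
    with \<open>x \<le> y\<close> have "x < y" by simp
    then have "\<forall>\<^sub>F z in at_left y. z \<in> {x<..<y}" by (intro eventually_at_left_real) auto
    then have "\<forall>\<^sub>F z in at_left y. f z \<le> f x"
      by (rule eventually_mono) (use antimonoD[OF assms(1)] in auto)
    then have "l y \<le> f x" by (intro tendsto_upperbound[OF assms(2)]) auto
    moreover have "\<forall>\<^sub>F z in at_left x. z \<in> {x-1<..<x}" by (intro eventually_at_left_real) auto
    then have "\<forall>\<^sub>F z in at_left x. f x \<le> f z"
      by (rule eventually_mono) (use antimonoD[OF assms(1)] in auto)
    then have "f x \<le> l x" by (intro tendsto_lowerbound[OF assms(2)]) auto
    ultimately show ?thesis by simp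
  qed simp
qed

lemma has_real_derivative_along:
  fixes F g :: "real \<Rightarrow> real"
  assumes "(F has_real_derivative d) (at (g k) within I)" "(g has_real_derivative d') (at k within K)"
    and "g ` K \<subseteq> I"
  shows "((\<lambda>k. F (g k)) has_real_derivative d * d') (at k within K)"
  using DERIV_image_chain[OF has_field_derivative_subset[OF assms(1,3)] assms(2)] by (simp add: o_def)

context flow
begin

text \<open>Mirror image of \<open>forward_characteristic\<close>. The curve moves left as time
  increases, so its right derivative sees the left limit \<open>sl\<close>.\<close>

lemma backward_characteristic:
  assumes "\<not> asymptotic_characteristic C p \<sigma>" "t0 \<ge> 0"
  shows "\<exists>X T. T > t0 \<and> X t0 = b \<and> X T = a \<and> continuous_on {t0..T} X \<and>
    (\<forall>s t. t0 \<le> s \<longrightarrow> s < t \<longrightarrow> t \<le> T \<longrightarrow> X t < X s) \<and>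
    (\<forall>t. t0 \<le> t \<longrightarrow> t < T \<longrightarrow> (X has_real_derivative - (C (p (X t, t)) * sl (X t))) (at t within {t..T}))"
proof -
  interpret r: flow C C' H "\<lambda>(x, t). p (- x, t)" "\<lambda>(x, t). - u (- x, t)" "\<lambda>(x, t). pt (- x, t)"
    "\<lambda>(x, t). - ut (- x, t)" "\<lambda>(x, t). ux (- x, t)" "\<lambda>(x, t). utx (- x, t)" "\<lambda>(x, t). - utt (- x, t)"
    "\<lambda>(x, t). ptt (- x, t)" "\<lambda>x. \<sigma> (- x)" "\<lambda>x. sr (- x)" "\<lambda>x. sl (- x)" "uminus ` J" "- b" "- a"
    by (rule reflect)
  have "\<not> asymptotic_characteristic C (\<lambda>(x, t). p (- x, t)) (\<lambda>x. \<sigma> (- x))"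
    using assms(1) asymptotic_characteristic_reflect by blast
  then obtain X T where X: "T > t0" "X t0 = - b" "X T = - a" "continuous_on {t0..T} X"
    "\<And>s t. t0 \<le> s \<Longrightarrow> s < t \<Longrightarrow> t \<le> T \<Longrightarrow> X s < X t"
    "\<And>t. t0 \<le> t \<Longrightarrow> t < T \<Longrightarrow> (X has_real_derivative C (p (- X t, t)) * sl (- X t)) (at t within {t..T})"
    using r.forward_characteristic[OF assms(2)] by auto
  have d: "((\<lambda>t. - X t) has_real_derivative - (C (p (- X t, t)) * sl (- X t))) (at t within {t..T})"
    if "t0 \<le> t" "t < T" for t
    by (rule DERIV_minus[OF X(6)[OF that]])
  show ?thesis
    by (rule exI[of _ "\<lambda>t. - X t"], rule exI[of _ T]) (use X(1-5) d in \<open>auto intro: continuous_on_minus\<close>)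
qed

text \<open>Time derivative of the equation for \<open>ux\<close> at fixed \<open>x\<close>. As
  \<open>\<sigma>\<close> does not depend on time, its left limit acts as a constant and no
  derivative of the entropy appears.\<close>

lemma utx_eq:
  fixes x t :: real
  assumes t: "t \<ge> 0"
  defines "c \<equiv> C (p (x, t))" and "q \<equiv> sl x"
  shows "utx (x, t) = - ptt (x, t) / (c * q)\<^sup>2 + 2 * C' (p (x, t)) * (pt (x, t))\<^sup>2 / (c ^ 3 * q\<^sup>2)"
proof -
  have z: "(x, t) \<in> future" using t by simp
  have pos: "c > 0" "q > 0" using C_pos p_pos[OF z] \<sigma>_pos(2) by (auto simp: c_def q_def)
  have dt: "((\<lambda>s. f (x, s)) has_real_derivative B) (at t within {0..})"
    if "(f has_derivative (\<lambda>(h, k). A * h + B * k)) (at (x, t) within future)" for f A B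
  proof -
    have "((\<lambda>s. f (x, s)) has_real_derivative A * 0 + B * 1) (at t within {0..})"
      by (rule has_real_derivative_along_path[where S = future]) (use that in auto)
    then show ?thesis by simp
  qed
  have dC: "((\<lambda>s. C (p (x, s))) has_real_derivative C' (p (x, t)) * pt (x, t)) (at t within {0..})"
    by (rule DERIV_chain2[OF C_deriv[OF p_pos[OF z]] dt[OF dp[OF z]]])
  have "((\<lambda>s. - pt (x, s) / (C (p (x, s)) * q)\<^sup>2) has_real_derivative
      - ptt (x, t) / (c * q)\<^sup>2 + 2 * C' (p (x, t)) * (pt (x, t))\<^sup>2 / (c ^ 3 * q\<^sup>2)) (at t within {0..})"
    by (rule derivative_eq_intros dC dt[OF dpt[OF z]] refl)+
      (use pos in \<open>auto simp: c_def[symmetric] field_simps power2_eq_square power3_eq_cube power4_eq_xxxx\<close>)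
  then have "((\<lambda>s. ux (x, s)) has_real_derivative
      - ptt (x, t) / (c * q)\<^sup>2 + 2 * C' (p (x, t)) * (pt (x, t))\<^sup>2 / (c ^ 3 * q\<^sup>2)) (at t within {0..})"
    by (rule has_real_derivative_cong_on) (use t ux_left in \<open>auto simp: q_def\<close>)
  from DERIV_unique_Ici[OF dux[OF t] this t] show ?thesis .
qed

text \<open>With the entropy frozen at \<open>x\<close>, the derivative of \<open>E = p\<^sub>t + e c u\<^sub>t\<close> along a characteristic of
  direction \<open>e\<close> is a multiple of \<open>E\<close>. The monotonicity of the entropy takes care of the rest.\<close>

lemma frozen_step:
  fixes x t e :: real
  assumes z: "(x, t) \<in> future" and e: "e \<in> {1, - 1}" and "\<delta> > 0"
  defines "c \<equiv> C (p (x, t)) * sl x"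
  defines "E \<equiv> \<lambda>z. pt z + e * (C (p z) * sl x) * ut z"
  assumes \<zeta>: "\<zeta> 0 = x" "(\<zeta> has_real_derivative - c) (at 0 within {0..\<delta>})"
    and fut: "\<And>k. k \<in> {0..\<delta>} \<Longrightarrow> t - e * k \<ge> 0"
    and \<Lambda>: "\<Lambda> > \<bar>C' (p (x, t))\<bar> / C (p (x, t)) * (2 * \<bar>pt (x, t)\<bar> / c + \<bar>ut (x, t)\<bar>)"
    and pos: "r * E (x, t) > 0"
  shows "\<exists>k. 0 < k \<and> k < \<delta> \<and> exp (- \<Lambda> * \<zeta> k) * (r * E (\<zeta> k, t - e * k)) > exp (- \<Lambda> * x) * (r * E (x, t))"
proof -
  let ?C = "C (p (x, t))" and ?C' = "C' (p (x, t))" and ?q = "sl x" and ?P = "pt (x, t)" and ?U = "ut (x, t)"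
  have C: "?C > 0" "?q > 0" using C_pos p_pos[OF z] \<sigma>_pos(2) by auto
  then have c: "c > 0" by (simp add: c_def)
  have t: "t \<ge> 0" using z by simp
  \<comment> \<open>The path always moves left. For \<open>e = 1\<close> time runs backwards along a
    forward characteristic, for \<open>e = - 1\<close> it runs forwards along a backward
    one.\<close>
  have along: "((\<lambda>k. f (\<zeta> k, t - e * k)) has_real_derivative A * (- c) + B * (- e)) (at 0 within {0..\<delta>})"
    if "(f has_derivative (\<lambda>(h, k). A * h + B * k)) (at (x, t) within future)" for f A B
    by (rule has_real_derivative_along_path[where S = future])
      (use that \<zeta> fut in \<open>auto intro!: derivative_eq_intros\<close>)
  have p0: "((\<lambda>k. p (\<zeta> k, t - e * k)) has_real_derivative c * ?U - e * ?P) (at 0 within {0..\<delta>})"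
    using along[OF dp[OF z]] by (simp add: mult.commute)
  have dC: "((\<lambda>k. C (p (\<zeta> k, t - e * k))) has_real_derivative ?C' * (c * ?U - e * ?P)) (at 0 within {0..\<delta>})"
    by (rule DERIV_chain2[OF _ p0]) (use C_deriv[OF p_pos[OF z]] \<zeta>(1) in simp)
  define D where "D = (- utt (x, t) * (- c) + ptt (x, t) * (- e)) +
    e * ?q * (?C' * (c * ?U - e * ?P) * ?U + ?C * (utx (x, t) * (- c) + utt (x, t) * (- e)))"
  have dE: "((\<lambda>k. E (\<zeta> k, t - e * k)) has_real_derivative D) (at 0 within {0..\<delta>})"
    unfolding E_def D_def
    by (rule derivative_eq_intros dC along[OF dpt[OF z]] along[OF dut[OF z]] refl)+
      (simp add: \<zeta>(1) algebra_simps)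
  have ee: "e * e = 1" using e by auto
  \<comment> \<open>The terms in \<open>utt\<close> cancel because \<open>e * e = 1\<close>, and
    \<open>utx_eq\<close> removes \<open>ptt\<close>. What remains is a quadratic form in
    \<open>pt\<close> and \<open>ut\<close> that has \<open>E\<close> as a factor.\<close>
  have D: "D = - (e * ?C' / ?C) * E (x, t) * (2 * ?P - e * c * ?U)"
  proof -
    have 1: "c * c * utx (x, t) = - ptt (x, t) + 2 * ?C' * ?P\<^sup>2 / ?C"
      using C unfolding utx_eq[OF t] c_def by (simp add: field_simps power2_eq_square power3_eq_cube)
    have 2: "D = - e * ptt (x, t) - e * (c * c * utx (x, t)) + (1 - e * e) * (c * utt (x, t))
        + e * ?q * ?C' * c * ?U\<^sup>2 - (e * e) * ?q * ?C' * ?P * ?U"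
      unfolding D_def c_def by (simp add: algebra_simps power2_eq_square)
    have A: "D = e * ?q * ?C' * c * ?U\<^sup>2 - ?q * ?C' * ?P * ?U - e * (2 * ?C' * ?P\<^sup>2 / ?C)"
      unfolding 2 1 ee by (simp add: algebra_simps)
    have B: "- (e * ?C' / ?C) * E (x, t) * (2 * ?P - e * c * ?U) =
        - (e * ?C' / ?C) * (2 * ?P\<^sup>2) - (e * e) * (?C' / ?C) * c * ?P * ?U + (e * e) * e * (?C' / ?C) * c\<^sup>2 * ?U\<^sup>2"
      unfolding E_def c_def by (simp add: algebra_simps power2_eq_square)
    have "e * ?q * ?C' * c * ?U\<^sup>2 - ?q * ?C' * ?P * ?U - e * (2 * ?C' * ?P\<^sup>2 / ?C) =
        - (e * ?C' / ?C) * (2 * ?P\<^sup>2) - (e * e) * (?C' / ?C) * c * ?P * ?U + (e * e) * e * (?C' / ?C) * c\<^sup>2 * ?U\<^sup>2"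
      using C unfolding ee c_def by (simp add: field_simps power2_eq_square)
    then show ?thesis by (rule trans[OF A trans[OF _ B[symmetric]]])
  qed
  have "((\<lambda>k. exp (- \<Lambda> * \<zeta> k) * (r * E (\<zeta> k, t - e * k))) has_real_derivative
      exp (- \<Lambda> * x) * (r * E (x, t)) * (\<Lambda> * c - (e * ?C' / ?C) * (2 * ?P - e * c * ?U))) (at 0 within {0..\<delta>})"
    by (rule derivative_eq_intros dE \<zeta>(2) refl)+ (simp add: \<zeta>(1) D algebra_simps add_divide_distrib diff_divide_distrib)
  \<comment> \<open>Moving left, the exponential weight contributes the rate
    \<open>\<Lambda> * c\<close>, and \<open>\<Lambda>\<close> is assumed large enough to beat the
    factor of \<open>E\<close> found in \<open>D\<close>.\<close>
  moreover have "\<Lambda> * c - (e * ?C' / ?C) * (2 * ?P - e * c * ?U) > 0"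
  proof -
    have "(e * ?C' / ?C) * (2 * ?P - e * c * ?U) \<le> \<bar>(e * ?C' / ?C) * (2 * ?P - e * c * ?U)\<bar>" by (rule abs_ge_self)
    also have "\<dots> = (\<bar>?C'\<bar> / ?C) * \<bar>2 * ?P - e * c * ?U\<bar>"
      using e C by (auto simp: abs_mult)
    also have "\<dots> \<le> (\<bar>?C'\<bar> / ?C) * (2 * \<bar>?P\<bar> + c * \<bar>?U\<bar>)"
    proof (rule mult_left_mono)
      have "\<bar>e * c * ?U\<bar> = c * \<bar>?U\<bar>" using e c by (auto simp: abs_mult)
      then show "\<bar>2 * ?P - e * c * ?U\<bar> \<le> 2 * \<bar>?P\<bar> + c * \<bar>?U\<bar>"
        using abs_triangle_ineq4[of "2 * ?P" "e * c * ?U"] by simp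
    qed (use C in auto)
    also have "\<dots> = (\<bar>?C'\<bar> / ?C * (2 * \<bar>?P\<bar> / c + \<bar>?U\<bar>)) * c"
      using C c by (simp add: field_simps)
    also have "\<dots> < \<Lambda> * c" using \<Lambda> c by (intro mult_strict_right_mono)
    finally show ?thesis by simp
  qed
  then have "exp (- \<Lambda> * x) * (r * E (x, t)) * (\<Lambda> * c - (e * ?C' / ?C) * (2 * ?P - e * c * ?U)) > 0"
    by (rule mult_pos_pos[OF mult_pos_pos[OF exp_gt_zero pos]])
  moreover have "at (0::real) within {0..\<delta>} = at 0 within {0..}"
    by (rule at_within_nhd[of _ "{..<\<delta>}"]) (use \<open>\<delta> > 0\<close> in auto)
  ultimately show ?thesis
    using DERIV_pos_right_increases[OF _ _ \<open>\<delta> > 0\<close>, of "\<lambda>k. exp (- \<Lambda> * \<zeta> k) * (r * E (\<zeta> k, t - e * k))"] \<zeta>(1)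
    by auto
qed

lemma sl_bounds:
  assumes "x \<in> {a..b}"
  shows "\<sigma>min \<le> sl x"
proof (cases "x = a")
  case True
  moreover have "a \<notin> J" using J(2) by auto
  ultimately show ?thesis using J(3)[of a] by simp
next
  case False
  then have "a < x" using assms by simp
  then have "\<forall>\<^sub>F z in at_left x. z \<in> {a<..<x}" by (rule eventually_at_left_real)
  then have "\<forall>\<^sub>F z in at_left x. \<sigma>min \<le> \<sigma> z"
    by (rule eventually_mono) (use \<sigma>_bounds(1) assms in auto)
  then show ?thesis by (intro tendsto_lowerbound[OF sl]) auto
qed

text \<open>Since \<open>sl\<close> may jump, its positive lower bound \<open>\<sigma>min\<close>
  takes its place to give a continuous majorant on the compact set.\<close>

lemma growth_bound:
  assumes "compact \<Delta>" "\<Delta> \<subseteq> {a..b} \<times> {0..}"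
  shows "\<exists>\<Lambda>. \<forall>(x, t)\<in>\<Delta>. \<Lambda> > \<bar>C' (p (x, t))\<bar> / C (p (x, t)) *
    (2 * \<bar>pt (x, t)\<bar> / (C (p (x, t)) * sl x) + \<bar>ut (x, t)\<bar>)"
proof -
  have D: "\<Delta> \<subseteq> future" using assms(2) by auto
  have pos: "C (p z) > 0" if "z \<in> \<Delta>" for z using that D by (intro C_pos p_pos) auto
  have "continuous_on \<Delta> (\<lambda>z. C' (p z))"
    by (rule continuous_on_compose2[OF C'_cont continuous_on_subset[OF continuous_fields(1) D]])
      (use p_pos D in auto)
  moreover have "continuous_on \<Delta> (\<lambda>z. C (p z))" "continuous_on \<Delta> pt" "continuous_on \<Delta> ut"
    using continuous_Cp continuous_fields(3,4) D by (auto intro: continuous_on_subset)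
  ultimately have "continuous_on \<Delta> (\<lambda>z. \<bar>C' (p z)\<bar> / C (p z) * (2 * \<bar>pt z\<bar> / (C (p z) * \<sigma>min) + \<bar>ut z\<bar>))"
    using pos \<sigma>min_pos by (intro continuous_intros) (auto simp: less_le)
  from compact_continuous_bound[OF assms(1) this] obtain M where
    M: "\<And>z. z \<in> \<Delta> \<Longrightarrow> \<bar>C' (p z)\<bar> / C (p z) * (2 * \<bar>pt z\<bar> / (C (p z) * \<sigma>min) + \<bar>ut z\<bar>) \<le> M"
    by (meson abs_le_D1)
  show ?thesis
  proof (intro exI[of _ "M + 1"] ballI, clarify)
    fix x t assume xt: "(x, t) \<in> \<Delta>"
    have c: "C (p (x, t)) > 0" using pos xt by blast
    have "\<sigma>min \<le> sl x" using sl_bounds[of x] xt assms(2) by auto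
    then have "2 * \<bar>pt (x, t)\<bar> / (C (p (x, t)) * sl x) \<le> 2 * \<bar>pt (x, t)\<bar> / (C (p (x, t)) * \<sigma>min)"
      using c \<sigma>min_pos by (intro divide_left_mono mult_left_mono mult_pos_pos) auto
    then have "\<bar>C' (p (x, t))\<bar> / C (p (x, t)) * (2 * \<bar>pt (x, t)\<bar> / (C (p (x, t)) * sl x) + \<bar>ut (x, t)\<bar>)
        \<le> \<bar>C' (p (x, t))\<bar> / C (p (x, t)) * (2 * \<bar>pt (x, t)\<bar> / (C (p (x, t)) * \<sigma>min) + \<bar>ut (x, t)\<bar>)"
      using c by (intro mult_left_mono add_right_mono) auto
    also have "\<dots> \<le> M" by (rule M[OF xt])
    finally show "M + 1 > \<bar>C' (p (x, t))\<bar> / C (p (x, t)) *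
        (2 * \<bar>pt (x, t)\<bar> / (C (p (x, t)) * sl x) + \<bar>ut (x, t)\<bar>)" by simp
  qed
qed

text \<open>\<open>T\<close> is the time at which the forward characteristic from
  \<open>(a, t1)\<close> arrives at \<open>b\<close>: with \<open>x\<close> as time variable, points
  of \<open>[a, b]\<close> at later times depend only on data at \<open>x = a\<close> after
  \<open>t1\<close>. By \<open>rep\<close>, each face of the cone with its coefficient frozen is a
  multiple of the quantity that \<open>frozen_step\<close> controls.\<close>

lemma cone_propagation:
  fixes Y Z :: "real \<times> real \<Rightarrow> real" and m :: "real \<Rightarrow> real"
  assumes N: "\<not> asymptotic_characteristic C p \<sigma>" and t1: "t1 \<ge> 0"
    and m: "antimono m" "\<And>x. m x > 0" "\<And>x. (m \<longlongrightarrow> m x) (at_left x)"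
    and contY: "continuous_on future Y" and contZ: "continuous_on future Z"
    and rep: "\<And>e x. e \<in> {1, - 1} \<Longrightarrow> \<exists>e'\<in>{1, - 1}. \<exists>r. \<forall>z\<in>future.
      Y z + e * m x * Z z = r * (pt z + e' * (C (p z) * sl x) * ut z)"
    and base: "\<And>t. t \<ge> t1 \<Longrightarrow> Y (a, t) + m a * \<bar>Z (a, t)\<bar> \<le> 0"
  shows "\<exists>T\<ge>t1. \<forall>t\<ge>T. \<forall>x\<in>{a..b}. Y (x, t) + m x * \<bar>Z (x, t)\<bar> \<le> 0"
proof -
  obtain F T1 where F: "T1 > t1" "F t1 = a" "F T1 = b" "continuous_on {t1..T1} F"
    "\<And>s t. t1 \<le> s \<Longrightarrow> s < t \<Longrightarrow> t \<le> T1 \<Longrightarrow> F s < F t"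
    "\<And>t. t1 < t \<Longrightarrow> t \<le> T1 \<Longrightarrow> (F has_real_derivative C (p (F t, t)) * sl (F t)) (at t within {t1..t})"
    using forward_characteristic[OF t1] N by blast
  have "Y (x0, t0) + m x0 * \<bar>Z (x0, t0)\<bar> \<le> 0" if t0: "t0 \<ge> T1" and x0: "x0 \<in> {a..b}" for x0 t0
  proof -
    have "t0 \<ge> 0" using t0 F(1) t1 by simp
    obtain B T2 where B: "T2 > t0" "B t0 = b" "B T2 = a" "continuous_on {t0..T2} B"
      "\<And>s t. t0 \<le> s \<Longrightarrow> s < t \<Longrightarrow> t \<le> T2 \<Longrightarrow> B t < B s"
      "\<And>t. t0 \<le> t \<Longrightarrow> t < T2 \<Longrightarrow> (B has_real_derivative - (C (p (B t, t)) * sl (B t))) (at t within {t..T2})"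
      using backward_characteristic[OF N \<open>t0 \<ge> 0\<close>] by blast
    \<comment> \<open>Right boundary of the domain of dependence: along the forward characteristic
      \<open>F\<close> from \<open>a\<close> to \<open>b\<close>, then along \<open>x = b\<close>
      until \<open>t0\<close>, then back to \<open>a\<close> along the backward characteristic
      \<open>B\<close>.\<close>
    define f where "f s = (if s \<le> T1 then F s else if s \<le> t0 then b else B s)" for s
    have fF: "f s = F s" if "s \<in> {t1..T1}" for s using that by (auto simp: f_def)
    have fb: "f s = b" if "s \<in> {T1..t0}" for s using that F(3) by (cases "s = T1") (auto simp: f_def)
    have fB: "f s = B s" if "s \<in> {t0..T2}" for s
      using that F(3) B(2) t0 by (cases "s = t0"; cases "s = T1") (auto simp: f_def)
    have contf: "continuous_on {t1..T2} f"
    proof -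
      have "continuous_on ({t1..T1} \<union> ({T1..t0} \<union> {t0..T2})) f"
      proof (intro continuous_on_closed_Un closed_Un closed_atLeastAtMost)
        show "continuous_on {t1..T1} f" using F(4) by (rule continuous_on_eq) (simp add: fF)
        show "continuous_on {T1..t0} f" by (rule continuous_on_eq[OF continuous_on_const]) (simp add: fb)
        show "continuous_on {t0..T2} f" using B(4) by (rule continuous_on_eq) (simp add: fB)
      qed
      moreover have "{t1..T1} \<union> ({T1..t0} \<union> {t0..T2}) = {t1..T2}" using F(1) t0 B(1) by auto
      ultimately show ?thesis by simp
    qed
    have f_mono: "f s \<le> f t" if "t1 \<le> s" "s \<le> t" "t \<le> t0" for s t
    proof (cases "s \<le> T1")
      case True
      have "F s \<le> b" using F(5)[of s T1] F(3) that True by (cases "s = T1") auto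
      moreover have "F s \<le> F t" if "t \<le> T1" using F(5)[of s t] that \<open>t1 \<le> s\<close> \<open>s \<le> t\<close> by (cases "s = t") auto
      ultimately show ?thesis using True that by (auto simp: f_def)
    qed (use that in \<open>auto simp: f_def\<close>)
    have f_anti: "f t \<le> f s" if "T1 \<le> s" "s \<le> t" "t \<le> T2" for s t
    proof (cases "t \<ge> t0")
      case True
      have "B t \<le> b" using B(5)[of t0 t] B(2) that True by (cases "t = t0") auto
      moreover have "B t \<le> B s" if "s \<ge> t0" using B(5)[of s t] that \<open>t \<le> T2\<close> \<open>s \<le> t\<close> by (cases "s = t") auto
      ultimately show ?thesis using True that fB[of t] fb[of s] fB[of s] by (cases "s \<ge> t0") auto
    qed (use that fb in auto)
    have f_le: "f s \<le> b" if "s \<in> {t1..T2}" for s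
      using f_mono[of s t0] f_anti[of t0 s] fb[of t0] that t0 by (cases "s \<le> t0") auto
    define \<Delta> where "\<Delta> = {(x, s). s \<in> {t1..T2} \<and> a \<le> x \<and> x \<le> f s}"
    have \<Delta>sub: "\<Delta> \<subseteq> {a..b} \<times> {t1..T2}" using f_le by (force simp: \<Delta>_def)
    then have \<Delta>0: "\<Delta> \<subseteq> {a..b} \<times> {0..}" and \<Delta>fut: "\<Delta> \<subseteq> future" using t1 by auto
    have "compact \<Delta>"
    proof -
      have "closed {z \<in> {a..b} \<times> {t1..T2}. fst z \<le> f (snd z)}"
        by (rule continuous_on_closed_Collect_le)
          (auto intro!: continuous_intros continuous_on_compose2[OF contf] closed_Times)
      moreover have "\<Delta> = ({a..b} \<times> {t1..T2}) \<inter> {z \<in> {a..b} \<times> {t1..T2}. fst z \<le> f (snd z)}"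
        using \<Delta>sub by (auto simp: \<Delta>_def)
      ultimately show ?thesis by (metis compact_Int_closed compact_Times compact_Icc)
    qed
    obtain \<Lambda> where \<Lambda>: "\<And>x t. (x, t) \<in> \<Delta> \<Longrightarrow> \<Lambda> > \<bar>C' (p (x, t))\<bar> / C (p (x, t)) *
        (2 * \<bar>pt (x, t)\<bar> / (C (p (x, t)) * sl x) + \<bar>ut (x, t)\<bar>)"
      using growth_bound[OF \<open>compact \<Delta>\<close> \<Delta>0] by auto
    \<comment> \<open>From every point off \<open>x = a\<close> both characteristic directions can
      be followed to the left inside \<open>\<Delta>\<close>: along a straight tangent where there
      is room, along the boundary curve itself where the direction is tangent to it.\<close>
    have path: "\<exists>\<delta> \<zeta>. \<delta> > 0 \<and> \<zeta> 0 = x \<and> (\<zeta> has_real_derivative - (C (p (x, t)) * sl x)) (at 0 within {0..\<delta>}) \<and>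
        (\<forall>k\<in>{0..\<delta>}. (\<zeta> k, t - e * k) \<in> \<Delta> \<and> \<zeta> k \<le> x)"
      if xt: "(x, t) \<in> \<Delta>" and "x \<noteq> a" and e: "e \<in> {1, - 1}" for x t e
    proof -
      have x: "a < x" "x \<le> f t" "t \<in> {t1..T2}" using xt \<open>x \<noteq> a\<close> by (auto simp: \<Delta>_def)
      have "t \<noteq> t1" "t \<noteq> T2" using x fF[of t1] fB[of T2] F(1,2) B(1,3) by auto
      then have tt: "t1 < t" "t < T2" using x by auto
      let ?c = "C (p (x, t)) * sl x"
      have c: "?c > 0" using xt \<Delta>fut C_pos[OF p_pos[of "(x, t)"]] \<sigma>_pos(2)[of x] by (intro mult_pos_pos) auto
      have straight: ?thesis if d: "d > 0" "\<And>k. 0 \<le> k \<Longrightarrow> k < d \<Longrightarrow> t - e * k \<in> {t1..T2} \<Longrightarrow> x \<le> f (t - e * k)" for d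
      proof -
        define \<delta> where "\<delta> = min (min (d / 2) ((x - a) / ?c)) (min (t - t1) (T2 - t))"
        have \<delta>: "\<delta> > 0" using d(1) x c tt by (simp add: \<delta>_def)
        have "(x - ?c * k, t - e * k) \<in> \<Delta> \<and> x - ?c * k \<le> x" if k: "k \<in> {0..\<delta>}" for k
        proof -
          have k': "0 \<le> k" "k < d" "k \<le> (x - a) / ?c" "k \<le> t - t1" "k \<le> T2 - t"
            using k d(1) by (auto simp: \<delta>_def)
          have "t - e * k \<in> {t1..T2}" using e k' tt by auto
          moreover have "?c * k \<ge> 0" using c k'(1) by (intro mult_nonneg_nonneg[of ?c k]) linarith+
          moreover have "k * ?c \<le> x - a" using k'(3) c by (simp only: pos_le_divide_eq)
          ultimately show ?thesis using d(2)[OF k'(1,2)] by (auto simp: \<Delta>_def mult.commute)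
        qed
        moreover have "((\<lambda>k. x - ?c * k) has_real_derivative - ?c) (at 0 within {0..\<delta>})"
          by (auto intro!: derivative_eq_intros)
        ultimately show ?thesis using \<delta> by (intro exI[of _ \<delta>] exI[of _ "\<lambda>k. x - ?c * k"]) auto
      qed
      have near: "\<exists>d>0. \<forall>k. 0 \<le> k \<longrightarrow> k < d \<longrightarrow> t - e * k \<in> {t1..T2} \<longrightarrow> x \<le> f (t - e * k)" if "x < f t"
      proof -
        have "\<exists>d>0. \<forall>s\<in>{t1..T2}. dist s t < d \<longrightarrow> dist (f s) (f t) < f t - x"
        proof -
          have "\<forall>\<epsilon>>0. \<exists>d>0. \<forall>s\<in>{t1..T2}. dist s t < d \<longrightarrow> dist (f s) (f t) < \<epsilon>"
            using contf x(3) unfolding continuous_on_iff by blast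
          then show ?thesis using that by simp
        qed
        then obtain d where d: "d > 0" "\<And>s. s \<in> {t1..T2} \<Longrightarrow> dist s t < d \<Longrightarrow> dist (f s) (f t) < f t - x"
          by blast
        have "x \<le> f (t - e * k)" if "0 \<le> k" "k < d" "t - e * k \<in> {t1..T2}" for k
          using d(2)[OF that(3)] that e by (auto simp: dist_real_def)
        then show ?thesis using d(1) by blast
      qed
      \<comment> \<open>In cases 2 and 4 the direction is tangent to the boundary, on
        \<open>F\<close> and on \<open>B\<close> respectively. In cases 3 and 5 the boundary
        \<open>f\<close> does not decrease in the direction of time travelled, so a straight segment
        fits.\<close>
      consider "x < f t" | "x = f t" "e = 1" "t \<le> T1" | "x = f t" "e = 1" "t > T1"
        | "x = f t" "e = - 1" "t \<ge> t0" | "x = f t" "e = - 1" "t < t0"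
        using x(2) e by fastforce
      then show ?thesis
      proof cases
        case 1
        then show ?thesis using near straight by blast
      next
        case 2
        have xF: "x = F t" using 2 fF[of t] x by auto
        have "((\<lambda>k. F (t - k)) has_real_derivative (C (p (F t, t)) * sl (F t)) * (- 1)) (at 0 within {0..t - t1})"
          by (rule has_real_derivative_along[where g = "\<lambda>k. t - k" and I = "{t1..t}"])
            (use F(6)[of t] 2 tt in \<open>auto intro!: derivative_eq_intros\<close>)
        moreover have "(F (t - k), t - e * k) \<in> \<Delta> \<and> F (t - k) \<le> x" if "k \<in> {0..t - t1}" for k
        proof -
          have s: "t - k \<in> {t1..T1}" "t - k \<le> t" using that 2 by auto
          have "F t1 \<le> F (t - k)" using F(5)[of t1 "t - k"] s by (cases "t - k = t1") auto
          moreover have "F (t - k) \<le> F t" using F(5)[of "t - k" t] s 2 by (cases "k = 0") auto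
          ultimately show ?thesis using F(2) fF[OF s(1)] s x(3) 2(2) xF by (auto simp: \<Delta>_def)
        qed
        ultimately show ?thesis using tt xF
          by (intro exI[of _ "t - t1"] exI[of _ "\<lambda>k. F (t - k)"]) auto
      next
        case 3
        then have "x \<le> f (t - e * k)" if "0 \<le> k" "k < t - T1" for k
          using f_anti[of "t - k" t] that tt by auto
        then show ?thesis using straight[of "t - T1"] 3 by auto
      next
        case 4
        have xB: "x = B t" using 4 fB[of t] x by auto
        have "((\<lambda>k. B (t + k)) has_real_derivative (- (C (p (B t, t)) * sl (B t))) * 1) (at 0 within {0..T2 - t})"
          by (rule has_real_derivative_along[where g = "\<lambda>k. t + k" and I = "{t..T2}"])
            (use B(6)[of t] 4 tt in \<open>auto intro!: derivative_eq_intros\<close>)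
        moreover have "(B (t + k), t - e * k) \<in> \<Delta> \<and> B (t + k) \<le> x" if "k \<in> {0..T2 - t}" for k
        proof -
          have s: "t + k \<in> {t0..T2}" "t \<le> t + k" using that 4 by auto
          have "B T2 \<le> B (t + k)" using B(5)[of "t + k" T2] s by (cases "t + k = T2") auto
          moreover have "B (t + k) \<le> B t" using B(5)[of t "t + k"] s 4 by (cases "k = 0") auto
          ultimately show ?thesis using B(3) fB[OF s(1)] s x(3) 4(2) xB by (auto simp: \<Delta>_def)
        qed
        ultimately show ?thesis using tt xB
          by (intro exI[of _ "T2 - t"] exI[of _ "\<lambda>k. B (t + k)"]) auto
      next
        case 5
        then have "x \<le> f (t - e * k)" if "0 \<le> k" "k < t0 - t" for k
          using f_mono[of t "t + k"] that tt by auto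
        then show ?thesis using straight[of "t0 - t"] 5 by auto
      qed
    qed
    show ?thesis
    proof (rule cone_max_principle[OF \<open>compact \<Delta>\<close> continuous_on_subset[OF contY \<Delta>fut] continuous_on_subset[OF contZ \<Delta>fut] m])
      show "Y (a, t) + m a * \<bar>Z (a, t)\<bar> \<le> 0" if "(a, t) \<in> \<Delta>" for t
        using base that by (auto simp: \<Delta>_def)
      show "(x0, t0) \<in> \<Delta>" using x0 fb[of t0] t0 F(1) B(1) by (auto simp: \<Delta>_def)
      fix x t e assume xt: "(x, t) \<in> \<Delta>" "x \<noteq> a" and e: "e \<in> {1, - 1 :: real}" and pos: "Y (x, t) + e * m x * Z (x, t) > 0"
      obtain e' r where r: "e' \<in> {1, - 1}" "\<And>z. z \<in> future \<Longrightarrow>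
          Y z + e * m x * Z z = r * (pt z + e' * (C (p z) * sl x) * ut z)"
        using rep[OF e, of x] by blast
      obtain \<delta> \<zeta> where \<zeta>: "\<delta> > 0" "\<zeta> 0 = x" "(\<zeta> has_real_derivative - (C (p (x, t)) * sl x)) (at 0 within {0..\<delta>})"
        "\<And>k. k \<in> {0..\<delta>} \<Longrightarrow> (\<zeta> k, t - e' * k) \<in> \<Delta> \<and> \<zeta> k \<le> x"
        using path[OF xt r(1)] by blast
      have z: "(x, t) \<in> future" using xt \<Delta>fut by blast
      have fut: "(\<zeta> k, t - e' * k) \<in> future" if "k \<in> {0..\<delta>}" for k using \<zeta>(4)[OF that] \<Delta>fut by blast
      obtain k where k: "0 < k" "k < \<delta>"
        "exp (- \<Lambda> * \<zeta> k) * (r * (pt (\<zeta> k, t - e' * k) + e' * (C (p (\<zeta> k, t - e' * k)) * sl x) * ut (\<zeta> k, t - e' * k)))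
          > exp (- \<Lambda> * x) * (r * (pt (x, t) + e' * (C (p (x, t)) * sl x) * ut (x, t)))"
        using frozen_step[OF z r(1) \<zeta>(1-3) _ \<Lambda>[OF xt(1)], of r] fut r(2)[OF z] pos by auto
      have kk: "k \<in> {0..\<delta>}" using k by simp
      show "\<exists>x' t'. (x', t') \<in> \<Delta> \<and> x' \<le> x \<and>
          exp (- \<Lambda> * x') * (Y (x', t') + e * m x * Z (x', t')) > exp (- \<Lambda> * x) * (Y (x, t) + e * m x * Z (x, t))"
        using k(3) \<zeta>(4)[OF kk] unfolding r(2)[OF z] r(2)[OF fut[OF kk], symmetric] by blast
    qed
  qed
  then show ?thesis using F(1) by (intro exI[of _ T1]) auto
qed

text \<open>The reflected flow carries the first cone condition, divided by \<open>\<sigma>\<close>,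
  from \<open>b\<close> to \<open>a\<close>; the flow itself carries the second one back, for both
  signs of \<open>pt\<close>.\<close>

lemma antimono_interior:
  assumes anti: "antimono \<sigma>" and N: "\<not> asymptotic_characteristic C p \<sigma>"
  shows "\<exists>T\<ge>0. \<forall>t\<ge>T. \<forall>x\<in>{a..b}. pt (x, t) = 0 \<and> ut (x, t) = 0"
proof -
  interpret r: flow C C' H "\<lambda>(x, t). p (- x, t)" "\<lambda>(x, t). - u (- x, t)" "\<lambda>(x, t). pt (- x, t)"
    "\<lambda>(x, t). - ut (- x, t)" "\<lambda>(x, t). ux (- x, t)" "\<lambda>(x, t). utx (- x, t)" "\<lambda>(x, t). - utt (- x, t)"
    "\<lambda>(x, t). ptt (- x, t)" "\<lambda>x. \<sigma> (- x)" "\<lambda>x. sr (- x)" "\<lambda>x. sl (- x)" "uminus ` J" "- b" "- a"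
    by (rule reflect)
  have Nr: "\<not> asymptotic_characteristic C (\<lambda>(x, t). p (- x, t)) (\<lambda>x. \<sigma> (- x))"
    using N asymptotic_characteristic_reflect by blast
  have "\<exists>T\<ge>0. \<forall>t\<ge>T. \<forall>x\<in>{- b..- a}.
      C (p (- x, t)) * ut (- x, t) + (1 / sr (- x)) * \<bar>pt (- x, t)\<bar> \<le> 0"
  proof -
    \<comment> \<open>\<open>Y\<close> and \<open>Z\<close> are \<open>C p * ut\<close> and
      \<open>pt\<close> at the mirrored point; the two sign changes are kept so that the terms match
      the reflected flow.\<close>
    define Y where "Y z = - (C (case z of (x, t) \<Rightarrow> p (- x, t)) * (case z of (x, t) \<Rightarrow> - ut (- x, t)))" for z
    define Z where "Z z = (case z of (x, t) \<Rightarrow> pt (- x, t))" for z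
    have lim: "((\<lambda>x. 1 / \<sigma> (- x)) \<longlongrightarrow> 1 / sr (- x)) (at_left x)" for x
      using r.sl[of x] r.\<sigma>_pos(2)[of x] by (intro tendsto_intros) auto
    have "antimono (\<lambda>x. 1 / \<sigma> (- x))"
      using anti \<sigma>_pos(1) by (auto simp: monotone_on_def intro!: frac_le)
    then have m: "antimono (\<lambda>x. 1 / sr (- x))"
      by (rule antimono_left_limits) (rule lim)
    have "\<exists>T\<ge>0. \<forall>t\<ge>T. \<forall>x\<in>{- b..- a}. Y (x, t) + (1 / sr (- x)) * \<bar>Z (x, t)\<bar> \<le> 0"
    proof (rule r.cone_propagation[OF Nr order_refl m])
      show "1 / sr (- x) > 0" for x using \<sigma>_pos(3) by simp
      show "((\<lambda>x. 1 / sr (- x)) \<longlongrightarrow> 1 / sr (- x)) (at_left x)" for x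
        by (rule left_limits_left_continuous[OF lim])
      show "continuous_on future Y" unfolding Y_def
        by (intro continuous_intros r.continuous_Cp r.continuous_fields)
      show "continuous_on future Z" unfolding Z_def by (rule r.continuous_fields)
      show "\<exists>e'\<in>{1, - 1}. \<exists>r. \<forall>z\<in>future. Y z + e * (1 / sr (- x)) * Z z =
          r * ((case z of (x, t) \<Rightarrow> pt (- x, t)) + e' * (C (case z of (x, t) \<Rightarrow> p (- x, t)) * sr (- x)) *
            (case z of (x, t) \<Rightarrow> - ut (- x, t)))" if "e \<in> {1, - 1}" for e x
        by (rule bexI[of _ "- e"], rule exI[of _ "e / sr (- x)"])
          (use that \<sigma>_pos(3)[of "- x"] in \<open>auto simp: Y_def Z_def field_simps\<close>)
      \<comment> \<open>At \<open>b\<close> the cone condition holds with equality: there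
        \<open>pt\<close> is the speed times \<open>ut\<close>, and
        \<open>ut \<le> 0\<close>.\<close>
      show "Y (- b, t) + 1 / sr (- (- b)) * \<bar>Z (- b, t)\<bar> \<le> 0" if "t \<ge> 0" for t
      proof -
        have d: "pt (b, t) = C (p (b, t)) * \<sigma> b * ut (b, t)" "ut (b, t) \<le> 0"
          using r.left_data[OF that] by auto
        have "b \<notin> J" using J(2) by auto
        then have b: "sr b = \<sigma> b" by (rule J(4))
        have pos: "C (p (b, t)) > 0" "\<sigma> b > 0" using that by (auto intro!: C_pos p_pos \<sigma>_pos)
        have "\<bar>pt (b, t)\<bar> = - (C (p (b, t)) * \<sigma> b * ut (b, t))"
          unfolding d(1) using d(2) pos by (simp add: abs_mult)
        then show ?thesis using pos by (simp add: Y_def Z_def b)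
      qed
    qed
    then show ?thesis by (simp add: Y_def Z_def)
  qed
  then obtain T where T: "T \<ge> 0" "\<And>t x. t \<ge> T \<Longrightarrow> x \<in> {- b..- a} \<Longrightarrow>
      C (p (- x, t)) * ut (- x, t) + (1 / sr (- x)) * \<bar>pt (- x, t)\<bar> \<le> 0" by blast
  \<comment> \<open>The condition arriving from the right gives \<open>ut \<le> 0\<close> at
    \<open>a\<close>, against \<open>ut \<ge> 0\<close> from \<open>left_data\<close>.\<close>
  have zero: "pt (a, t) = 0" "ut (a, t) = 0" if t: "t \<ge> T" for t
  proof -
    have t0: "t \<ge> 0" using t T(1) by simp
    have pos: "C (p (a, t)) > 0" using t0 by (auto intro!: C_pos p_pos)
    have "C (p (a, t)) * ut (a, t) + (1 / sr a) * \<bar>pt (a, t)\<bar> \<le> 0"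
      using T(2)[OF t, of "- a"] ab by simp
    moreover have "(1 / sr a) * \<bar>pt (a, t)\<bar> \<ge> 0" using \<sigma>_pos(3)[of a] by simp
    ultimately have "C (p (a, t)) * ut (a, t) \<le> 0" by linarith
    then have "ut (a, t) \<le> 0" using pos by (simp add: mult_le_0_iff)
    then show "ut (a, t) = 0" using left_data(2)[OF t0] by simp
    then show "pt (a, t) = 0" using left_data(1)[OF t0] by simp
  qed
  \<comment> \<open>Zero data at \<open>a\<close> satisfy the second condition for both signs
    \<open>\<theta>\<close>; the two resulting inequalities squeeze first \<open>pt\<close> and then
    \<open>ut\<close> to zero.\<close>
  have cone: "\<exists>T1\<ge>T. \<forall>t\<ge>T1. \<forall>x\<in>{a..b}. \<theta> * pt (x, t) + sl x * \<bar>C (p (x, t)) * ut (x, t)\<bar> \<le> 0"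
    if \<theta>: "\<theta> \<in> {1, - 1}" for \<theta>
  proof (rule cone_propagation[OF N T(1) antimono_left_limits[OF anti sl] \<sigma>_pos(2) left_limits_left_continuous[OF sl],
        of "\<lambda>z. \<theta> * pt z" "\<lambda>z. C (p z) * ut z"])
    show "continuous_on future (\<lambda>z. \<theta> * pt z)" "continuous_on future (\<lambda>z. C (p z) * ut z)"
      by (intro continuous_intros continuous_Cp continuous_fields)+
    show "\<exists>e'\<in>{1, - 1}. \<exists>r. \<forall>z\<in>future. \<theta> * pt z + e * sl x * (C (p z) * ut z) =
        r * (pt z + e' * (C (p z) * sl x) * ut z)" if "e \<in> {1, - 1}" for e x
      by (rule bexI[of _ "e * \<theta>"], rule exI[of _ \<theta>]) (use that \<theta> in \<open>auto simp: algebra_simps\<close>)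
    show "\<theta> * pt (a, t) + sl a * \<bar>C (p (a, t)) * ut (a, t)\<bar> \<le> 0" if "t \<ge> T" for t
      using zero[OF that] by simp
  qed
  obtain T1 where T1: "T1 \<ge> T" "\<And>t x. t \<ge> T1 \<Longrightarrow> x \<in> {a..b} \<Longrightarrow>
      pt (x, t) + sl x * \<bar>C (p (x, t)) * ut (x, t)\<bar> \<le> 0" using cone[of 1] by auto
  obtain T2 where T2: "T2 \<ge> T" "\<And>t x. t \<ge> T2 \<Longrightarrow> x \<in> {a..b} \<Longrightarrow>
      - pt (x, t) + sl x * \<bar>C (p (x, t)) * ut (x, t)\<bar> \<le> 0" using cone[of "- 1"] by auto
  show ?thesis
  proof (rule exI[of _ "max T1 T2"], intro conjI allI impI ballI)
    show "max T1 T2 \<ge> 0" using T1(1) T(1) by simp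
    fix t x assume t: "max T1 T2 \<le> t" and x: "x \<in> {a..b}"
    have "t \<ge> 0" using t T1(1) T(1) by simp
    then have pos: "C (p (x, t)) > 0" "sl x > 0" by (auto intro!: C_pos p_pos \<sigma>_pos)
    have "pt (x, t) + sl x * \<bar>C (p (x, t)) * ut (x, t)\<bar> \<le> 0" "- pt (x, t) + sl x * \<bar>C (p (x, t)) * ut (x, t)\<bar> \<le> 0"
      using T1(2)[OF _ x, of t] T2(2)[OF _ x, of t] t by auto
    moreover have "sl x * \<bar>C (p (x, t)) * ut (x, t)\<bar> \<ge> 0" using pos by simp
    ultimately have "pt (x, t) = 0" "sl x * \<bar>C (p (x, t)) * ut (x, t)\<bar> = 0" by linarith+
    then show "pt (x, t) = 0" "ut (x, t) = 0" using pos by auto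
  qed
qed

lemma interior:
  assumes N: "\<not> asymptotic_characteristic C p \<sigma>"
  shows "\<exists>T\<ge>0. \<forall>t\<ge>T. \<forall>x\<in>{a..b}. pt (x, t) = 0 \<and> ut (x, t) = 0"
  using \<sigma>_mono
proof
  assume "antimono \<sigma>"
  then show ?thesis using N by (rule antimono_interior)
next
  assume "mono \<sigma>"
  interpret r: flow C C' H "\<lambda>(x, t). p (- x, t)" "\<lambda>(x, t). - u (- x, t)" "\<lambda>(x, t). pt (- x, t)"
    "\<lambda>(x, t). - ut (- x, t)" "\<lambda>(x, t). ux (- x, t)" "\<lambda>(x, t). utx (- x, t)" "\<lambda>(x, t). - utt (- x, t)"
    "\<lambda>(x, t). ptt (- x, t)" "\<lambda>x. \<sigma> (- x)" "\<lambda>x. sr (- x)" "\<lambda>x. sl (- x)" "uminus ` J" "- b" "- a"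
    by (rule reflect)
  have "antimono (\<lambda>x. \<sigma> (- x))" using \<open>mono \<sigma>\<close> by (auto simp: monotone_on_def)
  moreover have "\<not> asymptotic_characteristic C (\<lambda>(x, t). p (- x, t)) (\<lambda>x. \<sigma> (- x))"
    using N asymptotic_characteristic_reflect by blast
  ultimately obtain T where T: "T \<ge> 0" "\<And>t x. t \<ge> T \<Longrightarrow> x \<in> {- b..- a} \<Longrightarrow> pt (- x, t) = 0 \<and> ut (- x, t) = 0"
    using r.antimono_interior by auto
  show ?thesis
  proof (intro exI[of _ T] conjI T(1) allI impI ballI)
    fix t x assume "T \<le> t" "x \<in> {a..b}"
    then show "pt (x, t) = 0" "ut (x, t) = 0" using T(2)[of t "- x"] by auto
  qed
qed

end

section \<open>The final configuration\<close>

context flow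
begin

text \<open>The straight backward characteristics leaving \<open>x = a\<close> from time
  \<open>T\<close> on sweep this sector and carry \<open>p0\<close>; the constant Riemann invariant
  then yields \<open>u0\<close>.\<close>

lemma left_wave:
  assumes T: "T \<ge> 0" and const: "\<And>t. t \<ge> T \<Longrightarrow> p (a, t) = p0" "\<And>t. t \<ge> T \<Longrightarrow> u (a, t) = u0"
    and t: "t \<ge> T" and x: "a - C p0 * \<sigma> a * (t - T) \<le> x" "x \<le> a"
  shows "p (x, t) = p0" "u (x, t) = u0"
proof -
  define c where "c = C p0 * \<sigma> a"
  have "p0 > 0" using const(1)[of T] p_pos[of "(a, T)"] T by simp
  then have c: "c > 0" using C_pos \<sigma>_pos by (simp add: c_def)
  \<comment> \<open>Time at which the line of speed \<open>c\<close> through \<open>(x, t)\<close>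
    leaves \<open>x = a\<close>.\<close>
  define t0 where "t0 = t - (a - x) / c"
  have "(a - x) / c \<le> t - T" using x(1) c by (simp add: pos_divide_le_eq mult.commute c_def[symmetric])
  then have t0: "T \<le> t0" by (simp add: t0_def)
  moreover have "(a - x) / c \<ge> 0" using x(2) c by simp
  ultimately have "p (a - speed (a, t0) * (t - t0), t) = p (a, t0)"
    using T by (intro outer_line) (auto simp: t0_def)
  moreover have "c * (t - t0) = a - x"
    using c by (simp add: t0_def)
  ultimately show px: "p (x, t) = p0" using const(1)[OF t0] by (simp add: c_def)
  have "riemann 1 (x, t) = riemann 1 (a, t)"
    using outer_riemann[of x t] outer_riemann[of a t] x(2) T t by simp
  then show "u (x, t) = u0" using px const[OF t] by (simp add: riemann_def)
qed

lemma noninteracting: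
  assumes N: "\<not> asymptotic_characteristic C p \<sigma>"
  shows "\<exists>T\<ge>0. \<exists>p0>0. \<exists>u0. \<forall>t\<ge>T. \<forall>x. a - C p0 * \<sigma> a * (t - T) \<le> x \<longrightarrow> x \<le> b + C p0 * \<sigma> b * (t - T) \<longrightarrow>
    p (x, t) = p0 \<and> u (x, t) = u0"
proof -
  interpret r: flow C C' H "\<lambda>(x, t). p (- x, t)" "\<lambda>(x, t). - u (- x, t)" "\<lambda>(x, t). pt (- x, t)"
    "\<lambda>(x, t). - ut (- x, t)" "\<lambda>(x, t). ux (- x, t)" "\<lambda>(x, t). utx (- x, t)" "\<lambda>(x, t). - utt (- x, t)"
    "\<lambda>(x, t). ptt (- x, t)" "\<lambda>x. \<sigma> (- x)" "\<lambda>x. sr (- x)" "\<lambda>x. sl (- x)" "uminus ` J" "- b" "- a"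
    by (rule reflect)
  obtain T where T: "T \<ge> 0" "\<And>t x. t \<ge> T \<Longrightarrow> x \<in> {a..b} \<Longrightarrow> pt (x, t) = 0 \<and> ut (x, t) = 0"
    using interior[OF N] by blast
  define R where "R = {a..b} \<times> {T..}"
  have R: "convex R" "R \<subseteq> future" using T(1) by (auto simp: R_def intro!: convex_Times)
  \<comment> \<open>As \<open>ux\<close> is proportional to \<open>pt\<close>, it vanishes too;
    \<open>p\<close> and \<open>u\<close> have zero gradient on the convex set
    \<open>R\<close>.\<close>
  have zero: "pt z = 0" "ut z = 0" "ux z = 0" if "z \<in> R" for z
    using that T ux_left[of "snd z" "fst z"] by (auto simp: R_def)
  have "(p has_derivative (\<lambda>_. 0)) (at z within R)" if "z \<in> R" for z
    using has_derivative_subset[OF dp[OF subsetD[OF R(2) that]] R(2)] by (simp add: zero[OF that] split_def)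
  then obtain p0 where p0: "\<And>z. z \<in> R \<Longrightarrow> p z = p0"
    using has_derivative_zero_constant[OF R(1)] by blast
  have "(u has_derivative (\<lambda>_. 0)) (at z within R)" if "z \<in> R" for z
    using has_derivative_subset[OF du[OF subsetD[OF R(2) that]] R(2)] by (simp add: zero[OF that] split_def)
  then obtain u0 where u0: "\<And>z. z \<in> R \<Longrightarrow> u z = u0"
    using has_derivative_zero_constant[OF R(1)] by blast
  have in_R: "(x, t) \<in> R" if "x \<in> {a..b}" "t \<ge> T" for x t using that by (simp add: R_def)
  have pos: "p0 > 0" using p0[OF in_R[of a T]] p_pos[of "(a, T)"] T(1) ab by simp
  have main: "p (x, t) = p0 \<and> u (x, t) = u0"
    if t: "t \<ge> T" and x: "a - C p0 * \<sigma> a * (t - T) \<le> x" "x \<le> b + C p0 * \<sigma> b * (t - T)" for x t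
  proof -
    consider "x \<le> a" | "x \<in> {a..b}" | "b \<le> x" by force
    then show ?thesis
    proof cases
      case 1
      then show ?thesis
        using left_wave[OF T(1) _ _ t x(1), of u0] p0 u0 in_R[of a] ab by auto
    next
      case 2
      then show ?thesis using p0 u0 in_R t by blast
    next
      case 3
      then show ?thesis
        using r.left_wave[OF T(1), of p0 "- u0" t "- x"] p0 u0 in_R[of b] ab t x(2) by auto
    qed
  qed
  show ?thesis
    by (rule exI[of _ T], rule conjI[OF T(1)], rule exI[of _ p0], rule conjI[OF pos], rule exI[of _ u0])
      (intro allI impI main)
qed

lemma right_riemann:
  assumes "b \<le> x" "t \<ge> 0"
  shows "u (x, t) - H (p (x, t)) / \<sigma> b = u (b, 0) - H (p (b, 0)) / \<sigma> b"
proof -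
  interpret r: flow C C' H "\<lambda>(x, t). p (- x, t)" "\<lambda>(x, t). - u (- x, t)" "\<lambda>(x, t). pt (- x, t)"
    "\<lambda>(x, t). - ut (- x, t)" "\<lambda>(x, t). ux (- x, t)" "\<lambda>(x, t). utx (- x, t)" "\<lambda>(x, t). - utt (- x, t)"
    "\<lambda>(x, t). ptt (- x, t)" "\<lambda>x. \<sigma> (- x)" "\<lambda>x. sr (- x)" "\<lambda>x. sl (- x)" "uminus ` J" "- b" "- a"
    by (rule reflect)
  show ?thesis using r.outer_riemann[of "- x" t] assms by (simp add: r.riemann_def)
qed

lemma right_mono:
  assumes "b \<le> x1" "x1 \<le> x2" "t \<ge> 0"
  shows "p (x1, t) \<le> p (x2, t)"
proof -
  interpret r: flow C C' H "\<lambda>(x, t). p (- x, t)" "\<lambda>(x, t). - u (- x, t)" "\<lambda>(x, t). pt (- x, t)"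
    "\<lambda>(x, t). - ut (- x, t)" "\<lambda>(x, t). ux (- x, t)" "\<lambda>(x, t). utx (- x, t)" "\<lambda>(x, t). - utt (- x, t)"
    "\<lambda>(x, t). ptt (- x, t)" "\<lambda>x. \<sigma> (- x)" "\<lambda>x. sr (- x)" "\<lambda>x. sl (- x)" "uminus ` J" "- b" "- a"
    by (rule reflect)
  show ?thesis using r.outer_mono[of "- x2" "- x1" t] assms by simp
qed

end

section \<open>The polytropic gas\<close>

text \<open>Eliminating \<open>\<tau>\<close> in favour of the pressure splits the sound speed into
  this function of the pressure and the factor \<open>polytropic_\<sigma>\<close> of the
  entropy.\<close>

definition polytropic_C :: "real \<Rightarrow> real \<Rightarrow> real" where
  "polytropic_C \<gamma> r = sqrt \<gamma> * r powr ((\<gamma> + 1) / (2 * \<gamma>))"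

text \<open>The antiderivative of \<open>1 / polytropic_C \<gamma>\<close> that vanishes at zero
  pressure; divided by \<open>polytropic_\<sigma>\<close> it is the acoustic potential.\<close>

definition polytropic_H :: "real \<Rightarrow> real \<Rightarrow> real" where
  "polytropic_H \<gamma> r = 2 * sqrt \<gamma> / (\<gamma> - 1) * r powr ((\<gamma> - 1) / (2 * \<gamma>))"

text \<open>The exponent is \<open>1 / 2 - (\<gamma> + 1) / (2 * \<gamma>)\<close>: the square root
  in the sound speed, less the power that the pressure absorbs.\<close>

definition polytropic_\<sigma> :: "real \<Rightarrow> real \<Rightarrow> real \<Rightarrow> real \<Rightarrow> real" where
  "polytropic_\<sigma> \<gamma> K cv S = (K * exp (S / cv)) powr (- 1 / (2 * \<gamma>))"

lemma polytropic_gas: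
  assumes "\<gamma> > 1"
  shows "gas (polytropic_C \<gamma>) (\<lambda>r. sqrt \<gamma> * ((\<gamma> + 1) / (2 * \<gamma>) * r powr ((\<gamma> + 1) / (2 * \<gamma>) - 1))) (polytropic_H \<gamma>)"
proof
  fix r :: real assume r: "r > 0"
  show "polytropic_C \<gamma> r > 0" using r assms by (simp add: polytropic_C_def)
  show "(polytropic_C \<gamma> has_real_derivative sqrt \<gamma> * ((\<gamma> + 1) / (2 * \<gamma>) * r powr ((\<gamma> + 1) / (2 * \<gamma>) - 1))) (at r)"
    unfolding polytropic_C_def using r by (auto intro!: derivative_eq_intros)
  show "polytropic_C \<gamma> r < polytropic_C \<gamma> s" if "r < s" for s
    using r that assms by (auto simp: polytropic_C_def intro!: powr_less_mono2)
  have "((\<gamma> - 1) / (2 * \<gamma>) - 1) = - ((\<gamma> + 1) / (2 * \<gamma>))" using assms by (simp add: field_simps)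
  then have "2 * sqrt \<gamma> / (\<gamma> - 1) * ((\<gamma> - 1) / (2 * \<gamma>) * r powr ((\<gamma> - 1) / (2 * \<gamma>) - 1)) =
      (sqrt \<gamma> / \<gamma>) * (1 / r powr ((\<gamma> + 1) / (2 * \<gamma>)))"
    using assms by (simp add: powr_minus_divide)
  also have "sqrt \<gamma> / \<gamma> = 1 / sqrt \<gamma>"
    using assms real_sqrt_mult_self[of \<gamma>] by (simp add: field_simps)
  finally have eq: "2 * sqrt \<gamma> / (\<gamma> - 1) * ((\<gamma> - 1) / (2 * \<gamma>) * r powr ((\<gamma> - 1) / (2 * \<gamma>) - 1)) = 1 / polytropic_C \<gamma> r"
    by (simp add: polytropic_C_def)
  have "(polytropic_H \<gamma> has_real_derivative 2 * sqrt \<gamma> / (\<gamma> - 1) * ((\<gamma> - 1) / (2 * \<gamma>) * r powr ((\<gamma> - 1) / (2 * \<gamma>) - 1))) (at r)"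
    unfolding polytropic_H_def using r by (auto intro!: derivative_eq_intros)
  then show "(polytropic_H \<gamma> has_real_derivative 1 / polytropic_C \<gamma> r) (at r)" by (simp only: eq)
next
  show "continuous_on {0<..} (\<lambda>r. sqrt \<gamma> * ((\<gamma> + 1) / (2 * \<gamma>) * r powr ((\<gamma> + 1) / (2 * \<gamma>) - 1)))"
    by (intro continuous_intros) auto
qed

section \<open>Sound speed and acoustic potential as functions of pressure and entropy\<close>

lemma pressure_deriv:
  assumes "\<tau> > 0"
  shows "(pressure \<gamma> K cv S has_real_derivative - (\<gamma> * (K * exp (S / cv)) * \<tau> powr (- \<gamma> - 1))) (at \<tau>)"
  unfolding pressure_def using assms by (auto intro!: derivative_eq_intros)

lemma sound_speed_sqrt:
  assumes "\<tau> > 0"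
  shows "sound_speed \<gamma> K cv S \<tau> = sqrt (\<gamma> * (K * exp (S / cv)) * \<tau> powr (- \<gamma> - 1))"
  unfolding sound_speed_def DERIV_imp_deriv[OF pressure_deriv[OF assms]] by simp

lemma sound_speed_powr:
  assumes "\<gamma> > 1" "K > 0" "\<tau> > 0"
  shows "sound_speed \<gamma> K cv S \<tau> = sqrt \<gamma> * ((K * exp (S / cv)) powr (1 / 2) * \<tau> powr (- (\<gamma> + 1) / 2))"
proof -
  have "sqrt (\<tau> powr (- \<gamma> - 1)) = \<tau> powr ((- \<gamma> - 1) * (1 / 2))"
    by (simp only: powr_half_sqrt[OF powr_ge_zero, symmetric] powr_powr)
  also have "(- \<gamma> - 1) * (1 / 2) = - (\<gamma> + 1) / 2" by simp
  finally have "sqrt (\<tau> powr (- \<gamma> - 1)) = \<tau> powr (- (\<gamma> + 1) / 2)" .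
  then show ?thesis
    using assms by (simp add: sound_speed_sqrt real_sqrt_mult powr_half_sqrt[of "K * exp (S / cv)"])
qed

lemma powr_product_powr:
  fixes x y :: real
  assumes "x > 0" "y > 0"
  shows "(x * y powr g) powr e * x powr f = x powr (e + f) * y powr (g * e)"
  using assms by (simp add: powr_mult powr_powr powr_add)

lemma sound_speed_eq:
  assumes "\<gamma> > 1" "K > 0" "\<tau> > 0"
  shows "sound_speed \<gamma> K cv S \<tau> = polytropic_C \<gamma> (pressure \<gamma> K cv S \<tau>) * polytropic_\<sigma> \<gamma> K cv S"
proof -
  define \<kappa> where "\<kappa> = K * exp (S / cv)"
  have \<kappa>: "\<kappa> > 0" using assms by (simp add: \<kappa>_def)
  have exps: "(\<gamma> + 1) / (2 * \<gamma>) + - 1 / (2 * \<gamma>) = 1 / 2" "- \<gamma> * ((\<gamma> + 1) / (2 * \<gamma>)) = - (\<gamma> + 1) / 2"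
    using assms by (simp_all add: field_simps)
  have "(\<kappa> * \<tau> powr (- \<gamma>)) powr ((\<gamma> + 1) / (2 * \<gamma>)) * \<kappa> powr (- 1 / (2 * \<gamma>)) =
      \<kappa> powr (1 / 2) * \<tau> powr (- (\<gamma> + 1) / 2)"
    using powr_product_powr[OF \<kappa> assms(3), of "- \<gamma>" "(\<gamma> + 1) / (2 * \<gamma>)" "- 1 / (2 * \<gamma>)"]
    unfolding exps .
  then show ?thesis
    by (simp only: sound_speed_powr[OF assms] polytropic_C_def polytropic_\<sigma>_def pressure_def \<kappa>_def[symmetric] mult.assoc)
qed

lemma acoustic_potential_eq:
  assumes "\<gamma> > 1" "K > 0" "\<tau> > 0"
  shows "acoustic_potential \<gamma> K cv S \<tau> = polytropic_H \<gamma> (pressure \<gamma> K cv S \<tau>) / polytropic_\<sigma> \<gamma> K cv S"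
proof -
  define \<kappa> where "\<kappa> = K * exp (S / cv)"
  have \<kappa>: "\<kappa> > 0" using assms by (simp add: \<kappa>_def)
  have exps: "(\<gamma> - 1) / (2 * \<gamma>) + 1 / (2 * \<gamma>) = 1 / 2" "- \<gamma> * ((\<gamma> - 1) / (2 * \<gamma>)) = - (\<gamma> + 1) / 2 + 1"
    using assms by (simp_all add: field_simps)
  have \<tau>1: "\<tau> powr (- (\<gamma> + 1) / 2 + 1) = \<tau> powr (- (\<gamma> + 1) / 2) * \<tau>"
    unfolding powr_add using assms(3) by simp
  have "(\<kappa> * \<tau> powr (- \<gamma>)) powr ((\<gamma> - 1) / (2 * \<gamma>)) * \<kappa> powr (1 / (2 * \<gamma>)) =
      \<kappa> powr (1 / 2) * (\<tau> powr (- (\<gamma> + 1) / 2) * \<tau>)"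
    using powr_product_powr[OF \<kappa> assms(3), of "- \<gamma>" "(\<gamma> - 1) / (2 * \<gamma>)" "1 / (2 * \<gamma>)"]
    unfolding exps \<tau>1 .
  moreover have "\<kappa> powr (1 / (2 * \<gamma>)) = 1 / \<kappa> powr (- 1 / (2 * \<gamma>))"
    by (simp add: powr_minus_divide)
  ultimately have "(\<kappa> * \<tau> powr (- \<gamma>)) powr ((\<gamma> - 1) / (2 * \<gamma>)) / \<kappa> powr (- 1 / (2 * \<gamma>)) =
      \<kappa> powr (1 / 2) * (\<tau> powr (- (\<gamma> + 1) / 2) * \<tau>)"
    by (simp only: times_divide_eq_right mult_1_right)
  then have "polytropic_H \<gamma> (pressure \<gamma> K cv S \<tau>) / polytropic_\<sigma> \<gamma> K cv S =
      2 * sqrt \<gamma> / (\<gamma> - 1) * (\<kappa> powr (1 / 2) * (\<tau> powr (- (\<gamma> + 1) / 2) * \<tau>))"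
    by (simp only: polytropic_H_def polytropic_\<sigma>_def pressure_def \<kappa>_def[symmetric] times_divide_eq_right[symmetric])
  then show ?thesis
    by (simp add: acoustic_potential_def sound_speed_powr[OF assms] \<kappa>_def)
qed

section \<open>From a shock-free solution to the abstract flow\<close>

lemma eventually_not_in_finite_at_left:
  fixes J :: "real set"
  assumes "finite J"
  shows "\<forall>\<^sub>F y in at_left x. y \<notin> J" "\<forall>\<^sub>F y in at_right x. y \<notin> J"
proof -
  have "open (- (J - {x}))" using assms by (intro open_Compl finite_imp_closed) auto
  then have "\<forall>\<^sub>F y in nhds x. y \<in> - (J - {x})" by (rule eventually_nhds_in_open) auto
  then show "\<forall>\<^sub>F y in at_left x. y \<notin> J" "\<forall>\<^sub>F y in at_right x. y \<notin> J"
    unfolding eventually_at_filter by (auto elim!: eventually_mono)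
qed

text \<open>The equations hold pointwise only off the finite set \<open>J\<close>. As the
  derivatives of \<open>u\<close> and \<open>p\<close> are continuous, letting \<open>x\<close> tend
  to a point of \<open>J\<close> extends the equations there, with one-sided limits of
  \<open>\<sigma>\<close> where the entropy jumps.\<close>

lemma shock_free_flow:
  fixes \<gamma> K cv :: real and \<tau> u S :: "real \<Rightarrow> real \<Rightarrow> real"
  assumes \<gamma>: "\<gamma> > 1" and K: "K > 0" and cv: "cv > 0"
    and sol: "global_shock_free_solution \<gamma> K cv \<tau> u S"
    and csv: "compactly_supported_variation (\<lambda>x. (\<tau> x 0, u x 0, S x 0))"
    and mono: "mono (\<lambda>x. S x 0) \<or> antimono (\<lambda>x. S x 0)"
  obtains C' pt ut ux utx utt ptt sl sr J a b where
    "flow (polytropic_C \<gamma>) C' (polytropic_H \<gamma>) (\<lambda>(x, t). pressure \<gamma> K cv (S x t) (\<tau> x t)) (\<lambda>(x, t). u x t)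
      pt ut ux utx utt ptt (\<lambda>x. polytropic_\<sigma> \<gamma> K cv (S x 0)) sl sr J a b"
    "\<forall>x\<le>a. S x 0 = S a 0" "\<forall>x\<ge>b. S x 0 = S b 0"
proof -
  define C where "C = polytropic_C \<gamma>"
  define \<sigma> where "\<sigma> x = polytropic_\<sigma> \<gamma> K cv (S x 0)" for x
  define p where "p = (\<lambda>(x, t). pressure \<gamma> K cv (S x t) (\<tau> x t))"
  define v where "v = (\<lambda>(x, t). u x t)"
  interpret gas C "\<lambda>r. sqrt \<gamma> * ((\<gamma> + 1) / (2 * \<gamma>) * r powr ((\<gamma> + 1) / (2 * \<gamma>) - 1))" "polytropic_H \<gamma>"
    unfolding C_def by (rule polytropic_gas[OF \<gamma>])
  have \<tau>: "\<tau> x t > 0" and St: "S x t = S x 0" if "t \<ge> 0" for x t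
    using sol that unfolding global_shock_free_solution_def by blast+
  have p_pos: "p z > 0" if "z \<in> future" for z
    using that \<tau>[of "snd z" "fst z"] K by (auto simp: p_def pressure_def split_def)
  obtain J where J: "piecewise_C2_off J (\<lambda>x. S x 0)" "\<And>x t. x \<notin> J \<Longrightarrow> t \<ge> 0 \<Longrightarrow> euler_at \<gamma> K cv \<tau> u S x t"
    using sol unfolding global_shock_free_solution_def by blast
  have finJ: "finite J" using J(1) by (simp add: piecewise_C2_off_def)
  have "C2_on future v" using sol unfolding global_shock_free_solution_def v_def by blast
  then obtain ux ut where C1u: "C1_on future ux" "C1_on future ut"
    and du: "\<And>z. z \<in> future \<Longrightarrow> (v has_derivative (\<lambda>(h, k). ux z * h + ut z * k)) (at z within future)"
    unfolding C2_on_def by blast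
  have "C2_on future p" using sol unfolding global_shock_free_solution_def p_def by blast
  then obtain px pt where C1p: "C1_on future px" "C1_on future pt"
    and dp: "\<And>z. z \<in> future \<Longrightarrow> (p has_derivative (\<lambda>(h, k). px z * h + pt z * k)) (at z within future)"
    unfolding C2_on_def by blast
  obtain uxx uxt where cont_uxt: "continuous_on future uxt"
    and dux: "\<And>z. z \<in> future \<Longrightarrow> (ux has_derivative (\<lambda>(h, k). uxx z * h + uxt z * k)) (at z within future)"
    using C1u(1) unfolding C1_on_def by blast
  obtain utx utt where
    dut: "\<And>z. z \<in> future \<Longrightarrow> (ut has_derivative (\<lambda>(h, k). utx z * h + utt z * k)) (at z within future)"
    using C1u(2) unfolding C1_on_def by blast
  obtain pxx pxt where cont_pxt: "continuous_on future pxt"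
    and dpx: "\<And>z. z \<in> future \<Longrightarrow> (px has_derivative (\<lambda>(h, k). pxx z * h + pxt z * k)) (at z within future)"
    using C1p(1) unfolding C1_on_def by blast
  obtain ptx ptt where
    dpt: "\<And>z. z \<in> future \<Longrightarrow> (pt has_derivative (\<lambda>(h, k). ptx z * h + ptt z * k)) (at z within future)"
    using C1p(2) unfolding C1_on_def by blast
  \<comment> \<open>Used for \<open>dux\<close> and \<open>dpt\<close>, where time derivatives of
    \<open>ux\<close> and \<open>px\<close> must be read as space derivatives of \<open>ut\<close>
    and \<open>pt\<close>.\<close>
  have utx: "utx (x, t) = uxt (x, t)" and ptx: "ptx (x, t) = pxt (x, t)" if "t \<ge> 0" for x t
    using mixed_partials_eq[OF du dux dut cont_uxt, of x t] mixed_partials_eq[OF dp dpx dpt cont_pxt, of x t] that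
    by auto
  have xder: "((\<lambda>y. f (y, t)) has_real_derivative A) (at x)"
    if "(f has_derivative (\<lambda>(h, k). A * h + B * k)) (at (x, t) within future)" "t \<ge> 0" for f A B x t
  proof -
    have "((\<lambda>y. f (y, t)) has_real_derivative A * 1 + B * 0) (at x)"
      by (rule has_real_derivative_along_path[where S = future]) (use that in auto)
    then show ?thesis by simp
  qed
  have tder: "((\<lambda>s. f (x, s)) has_real_derivative B) (at t within {0..})"
    if "(f has_derivative (\<lambda>(h, k). A * h + B * k)) (at (x, t) within future)" for f A B x t
  proof -
    have "((\<lambda>s. f (x, s)) has_real_derivative A * 0 + B * 1) (at t within {0..})"
      by (rule has_real_derivative_along_path[where S = future]) (use that in auto)
    then show ?thesis by simp
  qed
  have p_x: "px (x, t) = - ut (x, t)" if x: "x \<notin> J" and t: "t \<ge> 0" for x t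
  proof -
    obtain d where d: "((\<lambda>s. u x s) has_real_derivative d) (at t within {0..})"
      "((\<lambda>y. pressure \<gamma> K cv (S y t) (\<tau> y t)) has_real_derivative - d) (at x)"
      using J(2)[OF x t] by (auto simp: euler_at_def conservation_law_at_def)
    have z: "(x, t) \<in> future" using t by simp
    have "ut (x, t) = d" using DERIV_unique_Ici[OF tder[OF du[OF z]] _ t] d(1) by (simp add: v_def)
    moreover have "px (x, t) = - d" using DERIV_unique[OF xder[OF dp[OF z] t]] d(2) by (simp add: p_def)
    ultimately show ?thesis by simp
  qed
  have u_x: "ux (x, t) = - pt (x, t) / (C (p (x, t)) * \<sigma> x)\<^sup>2" if x: "x \<notin> J" and t: "t \<ge> 0" for x t
  proof -
    obtain d where d: "((\<lambda>s. \<tau> x s) has_real_derivative d) (at t within {0..})"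
      "((\<lambda>y. - u y t) has_real_derivative - d) (at x)"
      using J(2)[OF x t] by (auto simp: euler_at_def conservation_law_at_def)
    have z: "(x, t) \<in> future" using t by simp
    have "((\<lambda>y. u y t) has_real_derivative d) (at x)" using DERIV_minus[OF d(2)] by simp
    then have "ux (x, t) = d" using DERIV_unique[OF xder[OF du[OF z] t]] by (simp add: v_def)
    \<comment> \<open>\<open>w\<close> is minus the derivative of the pressure in
      \<open>\<tau>\<close>, the square of the sound speed. As the entropy is constant in time,
      \<open>pt\<close> is \<open>- w\<close> times the time derivative of \<open>\<tau>\<close>,
      which is \<open>ux\<close>.\<close>
    define w where "w = \<gamma> * (K * exp (S x 0 / cv)) * \<tau> x t powr (- \<gamma> - 1)"
    have "((\<lambda>s. pressure \<gamma> K cv (S x 0) (\<tau> x s)) has_real_derivative - w * d) (at t within {0..})"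
      unfolding w_def by (rule DERIV_chain2[OF pressure_deriv[OF \<tau>[OF t]] d(1)])
    then have "((\<lambda>s. p (x, s)) has_real_derivative - w * d) (at t within {0..})"
    proof (rule has_real_derivative_cong_on)
      show "pressure \<gamma> K cv (S x 0) (\<tau> x s) = p (x, s)" if "s \<in> {0..}" for s
        using St[of s x] that by (simp add: p_def)
    qed (use t in simp)
    then have "pt (x, t) = - w * d" using DERIV_unique_Ici[OF tder[OF dp[OF z]] _ t] by simp
    moreover have "w > 0" using \<gamma> K \<tau>[OF t, of x] by (simp add: w_def)
    moreover have "(C (p (x, t)) * \<sigma> x)\<^sup>2 = w"
    proof -
      have "C (p (x, t)) * \<sigma> x = sound_speed \<gamma> K cv (S x t) (\<tau> x t)"
        using sound_speed_eq[OF \<gamma> K \<tau>[OF t]] St[OF t] by (simp add: C_def \<sigma>_def p_def)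
      also have "\<dots> = sqrt w" using sound_speed_sqrt[OF \<tau>[OF t]] St[OF t] by (simp add: w_def)
      finally show ?thesis using \<open>w > 0\<close> by simp
    qed
    ultimately show ?thesis using \<open>ux (x, t) = d\<close> by simp
  qed
  obtain Sl where Sl: "\<And>x. ((\<lambda>x. S x 0) \<longlongrightarrow> Sl x) (at_left x)"
    using J(1) unfolding piecewise_C2_off_def by metis
  obtain Sr where Sr: "\<And>x. ((\<lambda>x. S x 0) \<longlongrightarrow> Sr x) (at_right x)"
    using J(1) unfolding piecewise_C2_off_def by metis
  have S_off: "Sl x = S x 0" "Sr x = S x 0" if "x \<notin> J" for x
  proof -
    have "isCont (\<lambda>x. S x 0) x"
      using J(1) that unfolding piecewise_C2_off_def by (auto dest!: bspec[of _ _ x] DERIV_isCont)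
    then have "((\<lambda>x. S x 0) \<longlongrightarrow> S x 0) (at_left x)" "((\<lambda>x. S x 0) \<longlongrightarrow> S x 0) (at_right x)"
      by (auto simp: isCont_def filterlim_at_split)
    then show "Sl x = S x 0" "Sr x = S x 0"
      using tendsto_unique[OF _ Sl] tendsto_unique[OF _ Sr] by (auto simp: trivial_limit_at_left_real trivial_limit_at_right_real)
  qed
  have pos\<sigma>: "polytropic_\<sigma> \<gamma> K cv s > 0" for s using K by (simp add: polytropic_\<sigma>_def)
  define sl where "sl x = polytropic_\<sigma> \<gamma> K cv (Sl x)" for x
  define sr where "sr x = polytropic_\<sigma> \<gamma> K cv (Sr x)" for x
  have sl: "(\<sigma> \<longlongrightarrow> sl x) (at_left x)" for x
    unfolding \<sigma>_def sl_def polytropic_\<sigma>_def using K cv by (intro tendsto_intros Sl) auto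
  have sr: "(\<sigma> \<longlongrightarrow> sr x) (at_right x)" for x
    unfolding \<sigma>_def sr_def polytropic_\<sigma>_def using K cv by (intro tendsto_intros Sr) auto
  \<comment> \<open>\<open>J\<close> being finite, an identity that holds off \<open>J\<close>
    passes to the limit at every \<open>x\<close> from either side.\<close>
  have side_limit: "f (x, t) = l" if f: "\<And>z. z \<in> future \<Longrightarrow> (f has_derivative f' z) (at z within future)" "t \<ge> 0"
    and lim: "((\<lambda>y. g y) \<longlongrightarrow> l) F" and eq: "\<And>y. y \<notin> J \<Longrightarrow> f (y, t) = g y" and F: "F = at_left x \<or> F = at_right x"
    for f f' g l F x t
  proof -
    have "continuous_on future f" by (rule has_derivative_continuous_on) (rule f(1))
    then have "continuous_on UNIV (\<lambda>y. f (y, t))"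
      by (rule continuous_on_compose2) (use \<open>t \<ge> 0\<close> in \<open>auto intro!: continuous_intros\<close>)
    then have "isCont (\<lambda>y. f (y, t)) x" by (simp add: continuous_on_eq_continuous_at)
    then have 1: "((\<lambda>y. f (y, t)) \<longlongrightarrow> f (x, t)) F"
      using F by (auto simp: isCont_def filterlim_at_split)
    have ev: "\<forall>\<^sub>F y in F. y \<notin> J" using F eventually_not_in_finite_at_left[OF finJ] by auto
    have "((\<lambda>y. f (y, t)) \<longlongrightarrow> l) F"
      by (rule Lim_transform_eventually[OF lim]) (use ev eq in \<open>auto elim!: eventually_mono\<close>)
    moreover have "F \<noteq> bot" using F trivial_limit_at_left_real trivial_limit_at_right_real by metis
    ultimately show ?thesis using 1 tendsto_unique by blast
  qed
  have contx: "((\<lambda>y. f (y, t)) \<longlongrightarrow> f (x, t)) F"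
    if f: "\<And>z. z \<in> future \<Longrightarrow> (f has_derivative f' z) (at z within future)" "t \<ge> 0" "F = at_left x \<or> F = at_right x"
    for f f' x t F
  proof -
    have "continuous_on future f" by (rule has_derivative_continuous_on) (rule f(1))
    then have "continuous_on UNIV (\<lambda>y. f (y, t))"
      by (rule continuous_on_compose2) (use \<open>t \<ge> 0\<close> in \<open>auto intro!: continuous_intros\<close>)
    then have "isCont (\<lambda>y. f (y, t)) x" by (simp add: continuous_on_eq_continuous_at)
    then show ?thesis using f(3) by (auto simp: isCont_def filterlim_at_split)
  qed
  have p_x_all: "px (x, t) = - ut (x, t)" if t: "t \<ge> 0" for x t
    by (rule side_limit[OF dpx t tendsto_minus[OF contx[OF dut t]], of "at_left x" x]) (use p_x t in auto)
  \<comment> \<open>The two choices of \<open>F\<close> yield the equation with \<open>sl\<close>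
    and with \<open>sr\<close>. At a genuine jump both hold, which is compatible only with
    \<open>pt = 0\<close> there.\<close>
  have ux_side: "ux (x, t) = - pt (x, t) / (C (p (x, t)) * q)\<^sup>2"
    if t: "t \<ge> 0" and F: "F = at_left x \<or> F = at_right x" and q: "(\<sigma> \<longlongrightarrow> q) F" "q > 0" for x t q F
  proof (rule side_limit[OF dux t _ _ F])
    have z: "(x, t) \<in> future" using t by simp
    have "isCont C (p (x, t))" using C_deriv[OF p_pos[OF z]] by (rule DERIV_isCont)
    then have "((\<lambda>y. C (p (y, t))) \<longlongrightarrow> C (p (x, t))) F"
      by (rule isCont_tendsto_compose) (rule contx[OF dp t F])
    then show "((\<lambda>y. - pt (y, t) / (C (p (y, t)) * \<sigma> y)\<^sup>2) \<longlongrightarrow> - pt (x, t) / (C (p (x, t)) * q)\<^sup>2) F"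
      by (intro tendsto_intros contx[OF dpt t F] q) (use q(2) C_pos[OF p_pos[OF z]] in auto)
    show "ux (y, t) = - pt (y, t) / (C (p (y, t)) * \<sigma> y)\<^sup>2" if "y \<notin> J" for y by (rule u_x[OF that t])
  qed
  have ptx': "ptx (x, t) = - utt (x, t)" if t: "t \<ge> 0" for x t
  proof -
    have z: "(x, t) \<in> future" using t by simp
    have "((\<lambda>s. px (x, s)) has_real_derivative - utt (x, t)) (at t within {0..})"
      by (rule has_real_derivative_cong_on[OF DERIV_minus[OF tder[OF dut[OF z]]]]) (use t p_x_all in auto)
    from DERIV_unique_Ici[OF tder[OF dpx[OF z]] this t] show ?thesis using ptx[OF t] by simp
  qed
  obtain a0 b0 where ab0: "a0 \<le> b0" "\<And>x. x \<le> a0 \<Longrightarrow> (\<tau> x 0, u x 0, S x 0) = (\<tau> a0 0, u a0 0, S a0 0)"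
    "\<And>x. x \<ge> b0 \<Longrightarrow> (\<tau> x 0, u x 0, S x 0) = (\<tau> b0 0, u b0 0, S b0 0)"
    using csv unfolding compactly_supported_variation_def by blast
  obtain M where M: "\<And>x. x \<in> J \<Longrightarrow> \<bar>x\<bar> \<le> M"
    using finite_imp_bounded[OF finJ] by (auto simp: bounded_iff)
  \<comment> \<open>Widened beyond the variation of the data so that \<open>J\<close> lies strictly
    between \<open>a\<close> and \<open>b\<close>; the summand 1 also gives
    \<open>a < b\<close>.\<close>
  define a where "a = min a0 (- M) - 1"
  define b where "b = max b0 M + 1"
  have L: "\<tau> x 0 = \<tau> a 0" "u x 0 = u a 0" "S x 0 = S a 0" if "x \<le> a" for x
    using ab0(2)[of x] ab0(2)[of a] that by (auto simp: a_def)
  have R: "\<tau> x 0 = \<tau> b 0" "u x 0 = u b 0" "S x 0 = S b 0" if "x \<ge> b" for x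
    using ab0(3)[of x] ab0(3)[of b] that by (auto simp: b_def)
  \<comment> \<open>The exponent is negative, so \<open>\<sigma>\<close> is monotone in the sense
    opposite to the entropy.\<close>
  have \<sigma>_anti: "polytropic_\<sigma> \<gamma> K cv s' \<le> polytropic_\<sigma> \<gamma> K cv s" if "s \<le> s'" for s s'
    unfolding polytropic_\<sigma>_def using that K cv \<gamma> by (intro powr_mono2') (auto simp: divide_right_mono)
  show thesis
  proof (rule that[of _ pt ut ux utx utt ptt sl sr J a b])
    show "flow (polytropic_C \<gamma>) (\<lambda>r. sqrt \<gamma> * ((\<gamma> + 1) / (2 * \<gamma>) * r powr ((\<gamma> + 1) / (2 * \<gamma>) - 1))) (polytropic_H \<gamma>)
      (\<lambda>(x, t). pressure \<gamma> K cv (S x t) (\<tau> x t)) (\<lambda>(x, t). u x t)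
      pt ut ux utx utt ptt (\<lambda>x. polytropic_\<sigma> \<gamma> K cv (S x 0)) sl sr J a b"
      unfolding C_def[symmetric] p_def[symmetric] v_def[symmetric] \<sigma>_def[symmetric]
    proof unfold_locales
      show "p z > 0" if "z \<in> future" for z by (rule p_pos[OF that])
      show "(p has_derivative (\<lambda>(h, k). - ut z * h + pt z * k)) (at z within future)" if "z \<in> future" for z
        using dp[OF that] p_x_all[of "snd z" "fst z"] that by (cases z) auto
      show "(v has_derivative (\<lambda>(h, k). ux z * h + ut z * k)) (at z within future)" if "z \<in> future" for z
        by (rule du[OF that])
      show "(ut has_derivative (\<lambda>(h, k). utx z * h + utt z * k)) (at z within future)" if "z \<in> future" for z
        by (rule dut[OF that])
      show "(pt has_derivative (\<lambda>(h, k). - utt z * h + ptt z * k)) (at z within future)" if "z \<in> future" for z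
        using dpt[OF that] ptx'[of "snd z" "fst z"] that by (cases z) auto
      show "((\<lambda>s. ux (x, s)) has_real_derivative utx (x, t)) (at t within {0..})" if "t \<ge> 0" for x t
        using tder[OF dux, of x t] utx[OF that] that by simp
      show "ux (x, t) = - pt (x, t) / (C (p (x, t)) * sl x)\<^sup>2" if "t \<ge> 0" for x t
        by (rule ux_side[OF that _ sl]) (simp_all add: sl_def pos\<sigma>)
      show "ux (x, t) = - pt (x, t) / (C (p (x, t)) * sr x)\<^sup>2" if "t \<ge> 0" for x t
        by (rule ux_side[OF that _ sr]) (simp_all add: sr_def pos\<sigma>)
      show "mono \<sigma> \<or> antimono \<sigma>"
        using mono by (auto simp: \<sigma>_def monotone_on_def intro!: \<sigma>_anti)
      show "\<sigma> x > 0" "sl x > 0" "sr x > 0" for x by (simp_all add: \<sigma>_def sl_def sr_def pos\<sigma>)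
      show "(\<sigma> \<longlongrightarrow> sl x) (at_left x)" "(\<sigma> \<longlongrightarrow> sr x) (at_right x)" for x by (rule sl sr)+
      show "finite J" by (rule finJ)
      show "J \<subseteq> {a<..<b}" using M by (force simp: a_def b_def)
      show "sl x = \<sigma> x" "sr x = \<sigma> x" if "x \<notin> J" for x
        using S_off[OF that] by (simp_all add: sl_def sr_def \<sigma>_def)
      show "a < b" using ab0(1) by (simp add: a_def b_def)
      show "\<sigma> x = \<sigma> a" if "x \<le> a" for x using L(3)[OF that] by (simp add: \<sigma>_def)
      show "\<sigma> x = \<sigma> b" if "x \<ge> b" for x using R(3)[OF that] by (simp add: \<sigma>_def)
      show "p (x, 0) = p (a, 0)" "v (x, 0) = v (a, 0)" if "x \<le> a" for x
        using L[OF that] by (simp_all add: p_def v_def)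
      show "p (x, 0) = p (b, 0)" "v (x, 0) = v (b, 0)" if "x \<ge> b" for x
        using R[OF that] by (simp_all add: p_def v_def)
    qed
    show "\<forall>x\<le>a. S x 0 = S a 0" "\<forall>x\<ge>b. S x 0 = S b 0" using L(3) R(3) by blast+
  qed
qed

theorem theorem2:
  fixes \<gamma> K cv :: real and \<tau> u S :: "real \<Rightarrow> real \<Rightarrow> real"
  assumes "\<gamma> > 1" and "K > 0" and "cv > 0"
    and "global_shock_free_solution \<gamma> K cv \<tau> u S"
    and "compactly_supported_variation (\<lambda>x. (\<tau> x 0, u x 0, S x 0))"
    and "mono (\<lambda>x. S x 0) \<or> antimono (\<lambda>x. S x 0)"
  shows "eventually_noninteracting \<gamma> K cv \<tau> u S \<or> contains_asymptotic_vacuum \<gamma> K cv \<tau> S"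
proof -
  obtain C' pt ut ux utx utt ptt sl sr J a b where
    flow: "flow (polytropic_C \<gamma>) C' (polytropic_H \<gamma>) (\<lambda>(x, t). pressure \<gamma> K cv (S x t) (\<tau> x t)) (\<lambda>(x, t). u x t)
      pt ut ux utx utt ptt (\<lambda>x. polytropic_\<sigma> \<gamma> K cv (S x 0)) sl sr J a b"
    and Sa: "\<forall>x\<le>a. S x 0 = S a 0" and Sb: "\<forall>x\<ge>b. S x 0 = S b 0"
    by (rule shock_free_flow[OF assms]) (rule that, assumption+)
  define C where "C = polytropic_C \<gamma>"
  define H where "H = polytropic_H \<gamma>"
  define \<sigma> where "\<sigma> x = polytropic_\<sigma> \<gamma> K cv (S x 0)" for x
  define p where "p = (\<lambda>(x, t). pressure \<gamma> K cv (S x t) (\<tau> x t))"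
  define v where "v = (\<lambda>(x, t). u x t)"
  interpret flow C C' H p v pt ut ux utx utt ptt \<sigma> sl sr J a b
    using flow by (simp only: C_def H_def \<sigma>_def[abs_def] p_def v_def)
  have \<tau>: "\<tau> x t > 0" and St: "S x t = S x 0" if "t \<ge> 0" for x t
    using assms(4) that unfolding global_shock_free_solution_def by blast+
  have c: "sound_speed \<gamma> K cv (S x t) (\<tau> x t) = C (p (x, t)) * \<sigma> x" if "t \<ge> 0" for x t
    using sound_speed_eq[OF assms(1,2) \<tau>[OF that]] St[OF that] by (simp add: C_def \<sigma>_def p_def)
  have h: "acoustic_potential \<gamma> K cv (S x t) (\<tau> x t) = H (p (x, t)) / \<sigma> x" if "t \<ge> 0" for x t
    using acoustic_potential_eq[OF assms(1,2) \<tau>[OF that]] St[OF that] by (simp add: H_def \<sigma>_def p_def)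
  show ?thesis
  proof (cases "asymptotic_characteristic C p \<sigma>")
    case True
    then obtain X t0 xlim e where X: "t0 \<ge> 0" "e \<in> {1, - 1 :: real}" "(X \<longlongrightarrow> xlim) at_top"
      "\<And>t. t \<ge> t0 \<Longrightarrow> (X has_real_derivative e * (C (p (X t, t)) * \<sigma> (X t))) (at t within {t0..})"
      unfolding asymptotic_characteristic_def by auto
    have "(X has_real_derivative e * sound_speed \<gamma> K cv (S (X t) t) (\<tau> (X t) t)) (at t within {t0..})"
      if "t \<ge> t0" for t
      using X(4)[OF that] c[of t "X t"] X(1) that by simp
    then have "contains_asymptotic_vacuum \<gamma> K cv \<tau> S"
      unfolding contains_asymptotic_vacuum_def using X(1-3)
      by (intro exI[of _ X] exI[of _ t0] exI[of _ xlim]) auto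
    then show ?thesis ..
  next
    case False
    from noninteracting[OF False] obtain T p0 u0 where T: "T \<ge> 0" "p0 > 0"
      and const: "\<forall>t\<ge>T. \<forall>x. a - C p0 * \<sigma> a * (t - T) \<le> x \<longrightarrow> x \<le> b + C p0 * \<sigma> b * (t - T) \<longrightarrow>
        p (x, t) = p0 \<and> v (x, t) = u0"
      by blast
    \<comment> \<open>\<open>A\<close> and \<open>B\<close> are the straight characteristics issuing
      from \<open>(a, T)\<close> and \<open>(b, T)\<close>. The state with pressure
      \<open>p0\<close> fills the region between them, edges included, which makes their speeds
      constant.\<close>
    define A where "A t = a - C p0 * \<sigma> a * (t - T)" for t
    define B where "B t = b + C p0 * \<sigma> b * (t - T)" for t
    have A: "A t \<le> a" and B: "b \<le> B t" if "t \<ge> T" for t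
      using that C_pos[OF T(2)] \<sigma>_pos(1)[of a] \<sigma>_pos(1)[of b] by (auto simp: A_def B_def)
    have AB: "A t < B t" if "t \<ge> T" for t using A[OF that] B[OF that] ab by simp
    have mid: "p (x, t) = p0 \<and> v (x, t) = u0" if "t \<ge> T" "A t \<le> x" "x \<le> B t" for t x
      using const that unfolding A_def B_def by blast
    have t0: "t \<ge> 0" if "t \<ge> T" for t using that T(1) by simp
    \<comment> \<open>Since \<open>A t \<le> a\<close>, the wave inherits its constant entropy, its
      Riemann invariant and its monotone pressure from the whole exterior
      \<open>x \<le> a\<close>.\<close>
    have "backward_rarefaction \<gamma> K cv \<tau> u S T A"
      unfolding backward_rarefaction_def
    proof (intro conjI allI impI)
      fix t assume t: "t \<ge> T"
      have "p (A t, t) = p0" using mid[OF t, of "A t"] AB[OF t] by simp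
      then have "sound_speed \<gamma> K cv (S (A t) t) (\<tau> (A t) t) = C p0 * \<sigma> a"
        using c[OF t0[OF t], of "A t"] \<sigma>_const(1)[OF A[OF t]] by simp
      then show "(A has_real_derivative - sound_speed \<gamma> K cv (S (A t) t) (\<tau> (A t) t)) (at t within {T..})"
        unfolding A_def by (auto intro!: derivative_eq_intros)
    next
      show "\<exists>S1. \<forall>t\<ge>T. \<forall>x\<le>A t. S x t = S1"
        using Sa St t0 A by (intro exI[of _ "S a 0"]) (metis order_trans)
      show "\<exists>k. \<forall>t\<ge>T. \<forall>x\<le>A t. u x t + acoustic_potential \<gamma> K cv (S x t) (\<tau> x t) = k"
      proof (intro exI[of _ "riemann 1 (a, 0)"] allI impI)
        fix t x assume t: "T \<le> t" and "x \<le> A t"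
        then have x: "x \<le> a" using A[OF t] by simp
        show "u x t + acoustic_potential \<gamma> K cv (S x t) (\<tau> x t) = riemann 1 (a, 0)"
          using outer_riemann[OF x t0[OF t]] h[OF t0[OF t], of x] \<sigma>_const(1)[OF x] unfolding riemann_def by (simp add: v_def)
      qed
      fix t assume t: "t \<ge> T"
      show "mono_on {..A t} (\<lambda>x. - sound_speed \<gamma> K cv (S x t) (\<tau> x t))"
      proof (rule mono_onI)
        fix x y assume xy: "x \<in> {..A t}" "y \<in> {..A t}" "x \<le> y"
        then have "x \<le> a" "y \<le> a" using A[OF t] by auto
        have "C (p (y, t)) \<le> C (p (x, t))"
          using outer_mono[OF xy(3) \<open>y \<le> a\<close> t0[OF t]] C_strict[OF p_pos[of "(y, t)"], of "p (x, t)"] t0[OF t]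
          by (cases "p (x, t) = p (y, t)") auto
        then show "- sound_speed \<gamma> K cv (S x t) (\<tau> x t) \<le> - sound_speed \<gamma> K cv (S y t) (\<tau> y t)"
          using c[OF t0[OF t]] \<sigma>_const(1)[OF \<open>x \<le> a\<close>] \<sigma>_const(1)[OF \<open>y \<le> a\<close>] \<sigma>_pos(1)[of a] by simp
      qed
    qed
    moreover have "forward_rarefaction \<gamma> K cv \<tau> u S T B"
      unfolding forward_rarefaction_def
    proof (intro conjI allI impI)
      fix t assume t: "t \<ge> T"
      have "p (B t, t) = p0" using mid[OF t, of "B t"] AB[OF t] by simp
      then have "sound_speed \<gamma> K cv (S (B t) t) (\<tau> (B t) t) = C p0 * \<sigma> b"
        using c[OF t0[OF t], of "B t"] \<sigma>_const(2)[OF B[OF t]] by simp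
      then show "(B has_real_derivative sound_speed \<gamma> K cv (S (B t) t) (\<tau> (B t) t)) (at t within {T..})"
        unfolding B_def by (auto intro!: derivative_eq_intros)
    next
      show "\<exists>S1. \<forall>t\<ge>T. \<forall>x\<ge>B t. S x t = S1"
        using Sb St t0 B by (intro exI[of _ "S b 0"]) (metis order_trans)
      show "\<exists>k. \<forall>t\<ge>T. \<forall>x\<ge>B t. u x t - acoustic_potential \<gamma> K cv (S x t) (\<tau> x t) = k"
      proof (intro exI[of _ "v (b, 0) - H (p (b, 0)) / \<sigma> b"] allI impI)
        fix t x assume t: "T \<le> t" and "B t \<le> x"
        then have x: "b \<le> x" using B[OF t] by simp
        show "u x t - acoustic_potential \<gamma> K cv (S x t) (\<tau> x t) = v (b, 0) - H (p (b, 0)) / \<sigma> b"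
          using right_riemann[OF x t0[OF t]] h[OF t0[OF t], of x] \<sigma>_const(2)[OF x] by (simp add: v_def)
      qed
      fix t assume t: "t \<ge> T"
      show "mono_on {B t..} (\<lambda>x. sound_speed \<gamma> K cv (S x t) (\<tau> x t))"
      proof (rule mono_onI)
        fix x y assume xy: "x \<in> {B t..}" "y \<in> {B t..}" "x \<le> y"
        then have "b \<le> x" "b \<le> y" using B[OF t] by auto
        have "C (p (x, t)) \<le> C (p (y, t))"
          using right_mono[OF \<open>b \<le> x\<close> xy(3) t0[OF t]] C_strict[OF p_pos[of "(x, t)"], of "p (y, t)"] t0[OF t]
          by (cases "p (x, t) = p (y, t)") auto
        then show "sound_speed \<gamma> K cv (S x t) (\<tau> x t) \<le> sound_speed \<gamma> K cv (S y t) (\<tau> y t)"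
          using c[OF t0[OF t]] \<sigma>_const(2)[OF \<open>b \<le> x\<close>] \<sigma>_const(2)[OF \<open>b \<le> y\<close>] \<sigma>_pos(1)[of b] by simp
      qed
    qed
    moreover have "stationary_between \<gamma> K cv \<tau> u S T A B"
      unfolding stationary_between_def
    proof (rule exI[of _ u0], rule exI[of _ p0], rule exI[of _ "\<lambda>x. S x 0"], intro allI impI, elim conjE)
      fix t x assume t: "T \<le> t" and x: "A t < x" "x < B t"
      show "u x t = u0 \<and> pressure \<gamma> K cv (S x t) (\<tau> x t) = p0 \<and> S x t = S x 0"
        using mid[OF t, of x] x St[OF t0[OF t], of x] by (simp add: p_def v_def)
    qed
    ultimately have "eventually_noninteracting \<gamma> K cv \<tau> u S"
      unfolding eventually_noninteracting_def using T(1) AB by blast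
    then show ?thesis ..
  qed
qed

end
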